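(* Let $(M,g)$ be a smooth $n$-dimensional Riemannian manifold with constant sectional curvature $c$, and let $k$ be a real constant. Let $a_1:[0,\infty)\to\mathbb{R}$ be a smooth function such that, with $$b_1=\frac{a_1a_1'-c}{a_1-2ta_1'},\qquad \lambda=\frac{k}{a_1},\qquad \mu=\lambda',$$ (all denominators being nowhere zero) one has $a_1>0$, $a_1+2tb_1>0$, $\lambda>0$, $\lambda+2t\lambda'>0$ for all $t\ge0$. Let $(G,J)$ be the natural Kählerian structure of diagonal type on $T^*M$ determined by $a_1,b_1,\lambda,\mu$. Then the manifold $(T^*M,G,J)$ is Kähler Einstein. It cannot have constant holomorphic sectional curvature.
   Context: Let $(M,g)$ be an $n$-dimensional Riemannian manifold and $\pi:T^*M\to M$ its cotangent bundle. A local chart $(U,x^1,\dots,x^n)$ of $M$ induces a chart $(\pi^{-1}(U),q^1,\dots,q^n,p_1,\dots,p_n)$ of $T^*M$ with $q^i=x^i\circ\pi$ and $p=p_i\,dx^i_{\pi(p)}$. Summation convention is used. Let $g_{ij}$ be the components of $g$, $\Gamma^k_{ij}$ the Christoffel symbols of the Levi-Civita connection of $g$, $(g^{ij})$ the inverse matrix of $(g_{ij})$, $\Gamma^0_{ih}=p_k\Gamma^k_{ih}$, $g^{0i}=p_hg^{hi}$, $\partial^i=\partial/\partial p_i$ and $\delta_i=\partial/\partial q^i+\Gamma^0_{ih}\,\partial/\partial p_h$. Then $(\partial^1,\dots,\partial^n,\delta_1,\dots,\delta_n)$ is a local frame on $T^*M$. Let $t=\frac12 g^{ik}p_ip_k\in[0,\infty)$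 be the energy density; functions of $t$ are regarded as functions on $T^*M$, and a prime denotes $d/dt$. The natural structure $(G,J)$ of diagonal type determined by $a_1,b_1,\lambda,\mu$ is $$J\delta_i=a_1g_{ij}\partial^j+b_1p_ip_j\partial^j,\qquad J\partial^i=-a_2g^{ij}\delta_j-b_2g^{0i}g^{0j}\delta_j,$$ $$G(\delta_i,\delta_j)=c_1g_{ij}+d_1p_ip_j,\qquad G(\partial^i,\partial^j)=c_2g^{ij}+d_2g^{0i}g^{0j},\qquad G(\partial^i,\delta_j)=0,$$ where $a_2=\frac1{a_1}$, $b_2=-\frac{b_1}{a_1(a_1+2tb_1)}$, $c_1=\lambda a_1$, $c_2=\lambda a_2$, $d_1=\lambda b_1+\mu(a_1+2tb_1)$, $d_2=\lambda b_2+\mu(a_2+2tb_2)$. Kähler means that $J$ is an integrable almost complex structure, $G(JX,JY)=G(X,Y)$, and $\phi(X,Y)=G(X,JY)$ is closed; Einstein means that the Ricci tensor of $G$ is a constant multiple of $G$. A Kähler manifold $(T^*M,G,J)$ has constant holomorphic sectional curvature $\kappa$ (a real constant) if its curvature tensor $K(X,Y)Z=\nabla_X\nabla_YZ-\nabla_Y\nabla_XZ-\nabla_{[X,Y]}Z$ (with $\nabla$ the Levi-Civita connection of $G$) satisfies $$K(X,Y)Z=\tfrac{\kappa}{4}\big(G(Z,Y)X-G(Z,X)Y+G(Z,JY)JX-G(Z,JX)JY+2G(X,JY)JZ\big).$$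
   Formalization: The last sentence is proved only for n ≥ 2, and for c = 0 only nonzero constants κ are excluded: if n = 1 the holomorphic sectional curvature is always the constant c/k, and if c = 0 the structure is flat (e.g. flat C^n for a_1 = 1), so κ = 0 occurs. *)

theory Defs
  imports "HOL-Analysis.Analysis"
begin

section \<open>Smooth functions\<close>

primrec Ck_on :: "nat \<Rightarrow> 'a::euclidean_space set \<Rightarrow> ('a \<Rightarrow> 'b::real_normed_vector) \<Rightarrow> bool" where
  "Ck_on 0 S f \<longleftrightarrow> continuous_on S f"
| "Ck_on (Suc k) S f \<longleftrightarrow>
     (\<forall>x\<in>S. f differentiable (at x)) \<and> (\<forall>v. Ck_on k S (\<lambda>x. frechet_derivative f (at x) v))"

text \<open>Meant for open \<open>S\<close> only.\<close>

definition smooth_on :: "'a::euclidean_space set \<Rightarrow> ('a \<Rightarrow> 'b::real_normed_vector) \<Rightarrow> bool" where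
  "smooth_on S f \<longleftrightarrow> (\<forall>k. Ck_on k S f)"

text \<open>Functions on \<open>[0,\<infinity>)\<close>, with the one-sided derivative at \<open>0\<close>. Values at negative
  arguments are irrelevant.\<close>

definition halfline_deriv :: "(real \<Rightarrow> real) \<Rightarrow> real \<Rightarrow> real" where
  "halfline_deriv f t = vector_derivative f (at t within {0..})"

definition smooth_halfline :: "(real \<Rightarrow> real) \<Rightarrow> bool" where
  "smooth_halfline f \<longleftrightarrow>
     (\<forall>k. \<forall>t\<ge>0. ((halfline_deriv ^^ k) f) differentiable (at t within {0..}))"

section \<open>Smooth manifolds\<close>

text \<open>A chart is a pair of its domain and its coordinate map; the values of the coordinate map
  outside the domain are irrelevant. The topology of a manifold is the one determined by its
  atlas. Atlases need not be maximal.\<close>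

type_synonym ('m, 'e) chart = "'m set \<times> ('m \<Rightarrow> 'e)"

definition chart_image :: "('m, 'e) chart \<Rightarrow> 'e set" where
  "chart_image C = snd C ` fst C"

definition overlap :: "('m, 'e) chart \<Rightarrow> ('m, 'e) chart \<Rightarrow> 'e set" where
  "overlap C C' = snd C ` (fst C \<inter> fst C')"

definition transition :: "('m, 'e) chart \<Rightarrow> ('m, 'e) chart \<Rightarrow> 'e \<Rightarrow> 'e" where
  "transition C C' = snd C' \<circ> inv_into (fst C) (snd C)"

abbreviation transition_deriv ::
  "('m, 'e::euclidean_space) chart \<Rightarrow> ('m, 'e) chart \<Rightarrow> 'e \<Rightarrow> 'e \<Rightarrow> 'e" where
  "transition_deriv C C' x \<equiv> frechet_derivative (transition C C') (at x)"

definition smooth_atlas :: "'m set \<Rightarrow> ('m, 'e::euclidean_space) chart set \<Rightarrow> bool" where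
  "smooth_atlas M A \<longleftrightarrow>
     (\<Union>C\<in>A. fst C) = M \<and>
     (\<forall>C\<in>A. inj_on (snd C) (fst C) \<and> open (chart_image C)) \<and>
     (\<forall>C\<in>A. \<forall>C'\<in>A. open (overlap C C') \<and> smooth_on (overlap C C') (transition C C'))"

definition atlas_topology :: "'m set \<Rightarrow> ('m, 'e::euclidean_space) chart set \<Rightarrow> 'm topology" where
  "atlas_topology M A = topology (\<lambda>W. W \<subseteq> M \<and> (\<forall>C\<in>A. open (snd C ` (W \<inter> fst C))))"

lemma openin_atlas_topology:
  assumes "smooth_atlas M A"
  shows "openin (atlas_topology M A) W \<longleftrightarrow> W \<subseteq> M \<and> (\<forall>C\<in>A. open (snd C ` (W \<inter> fst C)))"
proof -
  have inj: "inj_on (snd C) (fst C)" if "C \<in> A" for C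
    using assms that by (auto simp: smooth_atlas_def)
  have "istopology (\<lambda>W. W \<subseteq> M \<and> (\<forall>C\<in>A. open (snd C ` (W \<inter> fst C))))"
    unfolding istopology_def
  proof (intro conjI allI impI)
    fix S T
    assume S: "S \<subseteq> M \<and> (\<forall>C\<in>A. open (snd C ` (S \<inter> fst C)))"
      and T: "T \<subseteq> M \<and> (\<forall>C\<in>A. open (snd C ` (T \<inter> fst C)))"
    have "snd C ` (S \<inter> T \<inter> fst C) = snd C ` (S \<inter> fst C) \<inter> snd C ` (T \<inter> fst C)" if "C \<in> A" for C
    proof -
      have "S \<inter> T \<inter> fst C = (S \<inter> fst C) \<inter> (T \<inter> fst C)" by blast
      then show ?thesis
        using inj_on_image_Int[OF inj[OF that], of "S \<inter> fst C" "T \<inter> fst C"] by auto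
    qed
    with S T show "\<forall>C\<in>A. open (snd C ` (S \<inter> T \<inter> fst C))" by auto
    show "S \<inter> T \<subseteq> M" using S by blast
  next
    fix \<K> :: "'a set set"
    assume K: "\<forall>K\<in>\<K>. K \<subseteq> M \<and> (\<forall>C\<in>A. open (snd C ` (K \<inter> fst C)))"
    show "\<Union>\<K> \<subseteq> M" using K by blast
    have "snd C ` (\<Union>\<K> \<inter> fst C) = (\<Union>K\<in>\<K>. snd C ` (K \<inter> fst C))" for C by blast
    then show "\<forall>C\<in>A. open (snd C ` (\<Union>\<K> \<inter> fst C))"
      using K by (metis (no_types, lifting) open_UN)
  qed
  then show ?thesis by (simp add: atlas_topology_def topology_inverse')
qed

definition smooth_manifold :: "'m set \<Rightarrow> ('m, 'e::euclidean_space) chart set \<Rightarrow> bool" where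
  "smooth_manifold M A \<longleftrightarrow>
     M \<noteq> {} \<and> smooth_atlas M A \<and>
     Hausdorff_space (atlas_topology M A) \<and> second_countable (atlas_topology M A)"

section \<open>Local differential geometry in a chart\<close>

text \<open>A vector field on a chart image is a map \<open>'e \<Rightarrow> 'e\<close>; a field of bilinear forms is a map
  \<open>'e \<Rightarrow> 'e \<Rightarrow> 'e \<Rightarrow> real\<close> whose first argument is the point.\<close>

definition lie_bracket :: "('e::euclidean_space \<Rightarrow> 'e) \<Rightarrow> ('e \<Rightarrow> 'e) \<Rightarrow> 'e \<Rightarrow> 'e" where
  "lie_bracket X Y = (\<lambda>x. frechet_derivative Y (at x) (X x) - frechet_derivative X (at x) (Y x))"

text \<open>\<open>christoffel g x u v\<close> is \<open>\<nabla>\<^sub>u v\<close> for the Levi-Civita connection of \<open>g\<close> and constant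
  (coordinate) fields \<open>u, v\<close>, given by the Koszul formula. For the standard basis its
  \<open>k\<close>-th component is the Christoffel symbol with upper index \<open>k\<close>.\<close>

definition christoffel ::
  "('e::euclidean_space \<Rightarrow> 'e \<Rightarrow> 'e \<Rightarrow> real) \<Rightarrow> 'e \<Rightarrow> 'e \<Rightarrow> 'e \<Rightarrow> 'e" where
  "christoffel g x u v = (THE z. \<forall>w. 2 * g x z w =
       frechet_derivative (\<lambda>y. g y v w) (at x) u
     + frechet_derivative (\<lambda>y. g y u w) (at x) v
     - frechet_derivative (\<lambda>y. g y u v) (at x) w)"

definition levi_civita ::
  "('e::euclidean_space \<Rightarrow> 'e \<Rightarrow> 'e \<Rightarrow> real) \<Rightarrow> ('e \<Rightarrow> 'e) \<Rightarrow> ('e \<Rightarrow> 'e) \<Rightarrow> 'e \<Rightarrow> 'e" where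
  "levi_civita g X Y = (\<lambda>x. frechet_derivative Y (at x) (X x) + christoffel g x (X x) (Y x))"

definition curvature_operator ::
  "('e::euclidean_space \<Rightarrow> 'e \<Rightarrow> 'e \<Rightarrow> real) \<Rightarrow> ('e \<Rightarrow> 'e) \<Rightarrow> ('e \<Rightarrow> 'e) \<Rightarrow> ('e \<Rightarrow> 'e) \<Rightarrow> 'e \<Rightarrow> 'e" where
  "curvature_operator g X Y Z = (\<lambda>x. levi_civita g X (levi_civita g Y Z) x
     - levi_civita g Y (levi_civita g X Z) x - levi_civita g (lie_bracket X Y) Z x)"

text \<open>The curvature operator is tensorial, so its value on tangent vectors at a point is computed
  by extending them to constant fields. The same applies to the Nijenhuis tensor below.\<close>

definition curvature ::
  "('e::euclidean_space \<Rightarrow> 'e \<Rightarrow> 'e \<Rightarrow> real) \<Rightarrow> 'e \<Rightarrow> 'e \<Rightarrow> 'e \<Rightarrow> 'e \<Rightarrow> 'e" where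
  "curvature g x u v w = curvature_operator g (\<lambda>_. u) (\<lambda>_. v) (\<lambda>_. w) x"

text \<open>The trace of \<open>X \<mapsto> K(X, v) w\<close>.\<close>

definition ricci ::
  "('e::euclidean_space \<Rightarrow> 'e \<Rightarrow> 'e \<Rightarrow> real) \<Rightarrow> 'e \<Rightarrow> 'e \<Rightarrow> 'e \<Rightarrow> real" where
  "ricci g x v w = (\<Sum>b\<in>Basis. curvature g x b v w \<bullet> b)"

definition sectional_curvature ::
  "('e::euclidean_space \<Rightarrow> 'e \<Rightarrow> 'e \<Rightarrow> real) \<Rightarrow> 'e \<Rightarrow> 'e \<Rightarrow> 'e \<Rightarrow> real" where
  "sectional_curvature g x u v =
     g x (curvature g x u v v) u / (g x u u * g x v v - (g x u v)\<^sup>2)"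

definition nijenhuis ::
  "('e::euclidean_space \<Rightarrow> 'e \<Rightarrow> 'e) \<Rightarrow> 'e \<Rightarrow> 'e \<Rightarrow> 'e \<Rightarrow> 'e" where
  "nijenhuis J x u v =
     lie_bracket (\<lambda>y. J y u) (\<lambda>y. J y v) x
     - J x (lie_bracket (\<lambda>y. J y u) (\<lambda>_. v) x)
     - J x (lie_bracket (\<lambda>_. u) (\<lambda>y. J y v) x)
     - lie_bracket (\<lambda>_. u) (\<lambda>_. v) x"

section \<open>Geometric structures on manifolds\<close>

text \<open>A tensor field is the family of its coordinate expressions, one for each chart of the
  atlas, subject to the transformation law under change of charts.\<close>

definition riemannian_metric ::
  "('m, 'e::euclidean_space) chart set \<Rightarrow> (('m, 'e) chart \<Rightarrow> 'e \<Rightarrow> 'e \<Rightarrow> 'e \<Rightarrow> real) \<Rightarrow> bool" where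
  "riemannian_metric A g \<longleftrightarrow>
     (\<forall>C\<in>A. \<forall>x\<in>chart_image C. bilinear (g C x) \<and> (\<forall>u v. g C x u v = g C x v u) \<and>
                                 (\<forall>u. u \<noteq> 0 \<longrightarrow> g C x u u > 0)) \<and>
     (\<forall>C\<in>A. \<forall>u v. smooth_on (chart_image C) (\<lambda>x. g C x u v)) \<and>
     (\<forall>C\<in>A. \<forall>C'\<in>A. \<forall>x\<in>overlap C C'. \<forall>u v.
        g C x u v = g C' (transition C C' x) (transition_deriv C C' x u) (transition_deriv C C' x v))"

definition almost_complex_structure ::
  "('m, 'e::euclidean_space) chart set \<Rightarrow> (('m, 'e) chart \<Rightarrow> 'e \<Rightarrow> 'e \<Rightarrow> 'e) \<Rightarrow> bool" where
  "almost_complex_structure A J \<longleftrightarrow>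
     (\<forall>C\<in>A. \<forall>x\<in>chart_image C. linear (J C x) \<and> (\<forall>u. J C x (J C x u) = - u)) \<and>
     (\<forall>C\<in>A. \<forall>u. smooth_on (chart_image C) (\<lambda>x. J C x u)) \<and>
     (\<forall>C\<in>A. \<forall>C'\<in>A. \<forall>x\<in>overlap C C'. \<forall>u.
        transition_deriv C C' x (J C x u) = J C' (transition C C' x) (transition_deriv C C' x u))"

definition integrable_structure ::
  "('m, 'e::euclidean_space) chart set \<Rightarrow> (('m, 'e) chart \<Rightarrow> 'e \<Rightarrow> 'e \<Rightarrow> 'e) \<Rightarrow> bool" where
  "integrable_structure A J \<longleftrightarrow>
     (\<forall>C\<in>A. \<forall>x\<in>chart_image C. \<forall>u v. nijenhuis (J C) x u v = 0)"

definition kaehler ::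
  "('m, 'e::euclidean_space) chart set \<Rightarrow> (('m, 'e) chart \<Rightarrow> 'e \<Rightarrow> 'e \<Rightarrow> 'e \<Rightarrow> real) \<Rightarrow>
   (('m, 'e) chart \<Rightarrow> 'e \<Rightarrow> 'e \<Rightarrow> 'e) \<Rightarrow> bool" where
  "kaehler A G J \<longleftrightarrow>
     riemannian_metric A G \<and> almost_complex_structure A J \<and> integrable_structure A J \<and>
     (\<forall>C\<in>A. \<forall>x\<in>chart_image C. \<forall>u v. G C x (J C x u) (J C x v) = G C x u v) \<and>
     (\<forall>C\<in>A. \<forall>x\<in>chart_image C. \<forall>u v w.
        (let \<phi> = (\<lambda>v w y. G C y v (J C y w)) in
           frechet_derivative (\<phi> v w) (at x) u + frechet_derivative (\<phi> w u) (at x) v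
           + frechet_derivative (\<phi> u v) (at x) w = 0))"

definition einstein ::
  "('m, 'e::euclidean_space) chart set \<Rightarrow> (('m, 'e) chart \<Rightarrow> 'e \<Rightarrow> 'e \<Rightarrow> 'e \<Rightarrow> real) \<Rightarrow> bool" where
  "einstein A G \<longleftrightarrow>
     (\<exists>E. \<forall>C\<in>A. \<forall>x\<in>chart_image C. \<forall>u v. ricci (G C) x u v = E * G C x u v)"

definition constant_sectional_curvature ::
  "('m, 'e::euclidean_space) chart set \<Rightarrow> (('m, 'e) chart \<Rightarrow> 'e \<Rightarrow> 'e \<Rightarrow> 'e \<Rightarrow> real) \<Rightarrow> real \<Rightarrow> bool"
where
  "constant_sectional_curvature A g c \<longleftrightarrow>
     (\<forall>C\<in>A. \<forall>x\<in>chart_image C. \<forall>u v. u \<noteq> v \<and> independent {u, v} \<longrightarrow>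
        sectional_curvature (g C) x u v = c)"

definition constant_holomorphic_sectional_curvature ::
  "('m, 'e::euclidean_space) chart set \<Rightarrow> (('m, 'e) chart \<Rightarrow> 'e \<Rightarrow> 'e \<Rightarrow> 'e \<Rightarrow> real) \<Rightarrow>
   (('m, 'e) chart \<Rightarrow> 'e \<Rightarrow> 'e \<Rightarrow> 'e) \<Rightarrow> real \<Rightarrow> bool" where
  "constant_holomorphic_sectional_curvature A G J \<kappa> \<longleftrightarrow>
     (\<forall>C\<in>A. \<forall>x\<in>chart_image C. \<forall>X Y Z.
        curvature (G C) x X Y Z = (\<kappa> / 4) *\<^sub>R
          (G C x Z Y *\<^sub>R X - G C x Z X *\<^sub>R Y
           + G C x Z (J C x Y) *\<^sub>R J C x X - G C x Z (J C x X) *\<^sub>R J C x Y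
           + (2 * G C x X (J C x Y)) *\<^sub>R J C x Z))"

section \<open>The cotangent bundle\<close>

text \<open>A covector at \<open>x\<close> is the family of its component vectors in all charts around \<open>x\<close>, which
  are related by the transformation law of covectors; the entries for all other arguments are
  set to \<open>0\<close> to make the representation unique.\<close>

type_synonym ('m, 'n) cotangent = "'m \<times> (('m, real^'n) chart \<Rightarrow> real^'n)"

definition cotangent_bundle :: "('m, real^'n) chart set \<Rightarrow> ('m, 'n) cotangent set" where
  "cotangent_bundle A = {(x, \<omega>). x \<in> (\<Union>C\<in>A. fst C) \<and>
     (\<forall>C\<in>A. \<forall>C'\<in>A. x \<in> fst C \<inter> fst C' \<longrightarrow>
        (\<forall>u. \<omega> C \<bullet> u = \<omega> C' \<bullet> transition_deriv C C' (snd C x) u)) \<and>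
     (\<forall>C. \<not> (C \<in> A \<and> x \<in> fst C) \<longrightarrow> \<omega> C = 0)}"

text \<open>The chart with coordinates \<open>(q, p)\<close> induced by a chart of the base manifold.\<close>

definition cotangent_chart ::
  "('m, real^'n) chart set \<Rightarrow> ('m, real^'n) chart \<Rightarrow> (('m, 'n) cotangent, (real^'n) \<times> (real^'n)) chart"
where
  "cotangent_chart A C =
     ({(x, \<omega>) \<in> cotangent_bundle A. x \<in> fst C}, (\<lambda>(x, \<omega>). (snd C x, \<omega> C)))"

definition cotangent_atlas ::
  "('m, real^'n) chart set \<Rightarrow> (('m, 'n) cotangent, (real^'n) \<times> (real^'n)) chart set" where
  "cotangent_atlas A = cotangent_chart A ` A"

section \<open>Natural structures of diagonal type\<close>

text \<open>In the definitions of this section \<open>g\<close> is the coordinate expression of the metric in one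
  chart of the base.\<close>

abbreviation coord_vec :: "'n::finite \<Rightarrow> real^'n" where
  "coord_vec i \<equiv> axis i 1"

definition metric_lower :: "(real^'n \<Rightarrow> real^'n \<Rightarrow> real^'n \<Rightarrow> real) \<Rightarrow> real^'n \<Rightarrow> real^'n^'n" where
  "metric_lower g q = (\<chi> i j. g q (coord_vec i) (coord_vec j))"

definition metric_upper :: "(real^'n \<Rightarrow> real^'n \<Rightarrow> real^'n \<Rightarrow> real) \<Rightarrow> real^'n \<Rightarrow> real^'n^'n" where
  "metric_upper g q = matrix_inv (metric_lower g q)"

text \<open>\<open>g\<^sup>0\<^sup>i\<close>, \<open>t\<close> and \<open>\<Gamma>\<^sup>0\<^sub>i\<^sub>h\<close> at \<open>(q, p)\<close>.\<close>

definition p_raised ::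
  "(real^'n \<Rightarrow> real^'n \<Rightarrow> real^'n \<Rightarrow> real) \<Rightarrow> real^'n \<Rightarrow> real^'n \<Rightarrow> 'n \<Rightarrow> real" where
  "p_raised g q p i = (\<Sum>h\<in>UNIV. p $ h * metric_upper g q $ h $ i)"

definition energy :: "(real^'n \<Rightarrow> real^'n \<Rightarrow> real^'n \<Rightarrow> real) \<Rightarrow> real^'n \<Rightarrow> real^'n \<Rightarrow> real" where
  "energy g q p = 1/2 * (\<Sum>i\<in>UNIV. \<Sum>k\<in>UNIV. metric_upper g q $ i $ k * p $ i * p $ k)"

definition Gamma0 ::
  "(real^'n \<Rightarrow> real^'n \<Rightarrow> real^'n \<Rightarrow> real) \<Rightarrow> real^'n \<Rightarrow> real^'n \<Rightarrow> 'n \<Rightarrow> 'n \<Rightarrow> real" where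
  "Gamma0 g q p i h = (\<Sum>k\<in>UNIV. p $ k * christoffel g q (coord_vec i) (coord_vec h) $ k)"

definition vert :: "'n::finite \<Rightarrow> (real^'n) \<times> (real^'n)" where
  "vert i = (0, coord_vec i)"

definition hor ::
  "(real^'n \<Rightarrow> real^'n \<Rightarrow> real^'n \<Rightarrow> real) \<Rightarrow> real^'n \<Rightarrow> real^'n \<Rightarrow> 'n \<Rightarrow> (real^'n) \<times> (real^'n)" where
  "hor g q p i = (coord_vec i, \<Sum>h\<in>UNIV. Gamma0 g q p i h *\<^sub>R coord_vec h)"

text \<open>The values on the frame \<open>\<partial>\<^sup>i\<close> (here \<open>vert\<close>), \<open>\<delta>\<^sub>i\<close> (here \<open>hor\<close>), together with linearity of
  \<open>J\<close> and bilinearity and symmetry of \<open>G\<close>, determine \<open>G\<close> and \<open>J\<close> on every induced chart.\<close>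

definition natural_diagonal_structure ::
  "('m, real^'n) chart set \<Rightarrow>
   (('m, real^'n) chart \<Rightarrow> real^'n \<Rightarrow> real^'n \<Rightarrow> real^'n \<Rightarrow> real) \<Rightarrow>
   (real \<Rightarrow> real) \<Rightarrow> (real \<Rightarrow> real) \<Rightarrow> (real \<Rightarrow> real) \<Rightarrow> (real \<Rightarrow> real) \<Rightarrow>
   ((('m, 'n) cotangent, (real^'n) \<times> (real^'n)) chart \<Rightarrow>
      (real^'n) \<times> (real^'n) \<Rightarrow> (real^'n) \<times> (real^'n) \<Rightarrow> (real^'n) \<times> (real^'n) \<Rightarrow> real) \<Rightarrow>
   ((('m, 'n) cotangent, (real^'n) \<times> (real^'n)) chart \<Rightarrow>
      (real^'n) \<times> (real^'n) \<Rightarrow> (real^'n) \<times> (real^'n) \<Rightarrow> (real^'n) \<times> (real^'n)) \<Rightarrow> bool" where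
  "natural_diagonal_structure A g a1f b1f lamf muf G J \<longleftrightarrow>
     (\<forall>C\<in>A. \<forall>(q, p)\<in>chart_image (cotangent_chart A C).
        let t = energy (g C) q p;
            a1 = a1f t; b1 = b1f t; lam = lamf t; mu = muf t;
            a2 = 1 / a1; b2 = - b1 / (a1 * (a1 + 2 * t * b1));
            c1 = lam * a1; c2 = lam * a2;
            d1 = lam * b1 + mu * (a1 + 2 * t * b1);
            d2 = lam * b2 + mu * (a2 + 2 * t * b2);
            gl = (\<lambda>i j. metric_lower (g C) q $ i $ j);
            gu = (\<lambda>i j. metric_upper (g C) q $ i $ j);
            g0 = p_raised (g C) q p;
            \<delta> = hor (g C) q p;
            JJ = J (cotangent_chart A C) (q, p);
            GG = G (cotangent_chart A C) (q, p)
        in linear JJ \<and>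
           (\<forall>i. JJ (\<delta> i) = (\<Sum>j\<in>UNIV. (a1 * gl i j + b1 * p $ i * p $ j) *\<^sub>R vert j)) \<and>
           (\<forall>i. JJ (vert i) = (\<Sum>j\<in>UNIV. (- a2 * gu i j - b2 * g0 i * g0 j) *\<^sub>R \<delta> j)) \<and>
           bilinear GG \<and> (\<forall>v w. GG v w = GG w v) \<and>
           (\<forall>i j. GG (\<delta> i) (\<delta> j) = c1 * gl i j + d1 * p $ i * p $ j) \<and>
           (\<forall>i j. GG (vert i) (vert j) = c2 * gu i j + d2 * g0 i * g0 j) \<and>
           (\<forall>i j. GG (vert i) (\<delta> j) = 0))"

end

theory Submission
  imports Defs
begin

text \<open>
  Put \<open>t = |p|\<^sup>2 / 2\<close>, \<open>w = \<surd>(a\<^sub>1\<^sup>2 - 2tc)\<close> and let \<open>S = p\<^sup>\<sharp> / (a\<^sub>1 + w)\<close>, a vector field of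
  the base along the cotangent bundle, with covariant derivative \<open>\<tau> = DS\<close>; let \<open>N = 1 + c|S|\<^sup>2\<close>.
  In terms of \<open>\<alpha>(X) = x - (2c/N) \<langle>S, x\<rangle> S\<close>, where \<open>x\<close> is the projection of \<open>X\<close>, and \<open>\<beta> = (2/N) \<tau>\<close>
  every structure of the family becomes \<open>G = k (|\<alpha>|\<^sup>2 + |\<beta>|\<^sup>2)\<close>, with \<open>J\<close> acting on \<open>\<alpha> + i\<beta>\<close> as
  multiplication by \<open>i\<close>, so that \<open>a\<^sub>1\<close> has disappeared. On pairs of vectors of the base consider
  the connection \<open>D + \<Omega> + i\<theta>\<close> with \<open>\<Omega>(X) = (2c/N) S \<and> \<tau>(X)\<close> and \<open>\<theta>(X) = (2c/N) \<langle>S, x\<rangle>\<close>. It is metric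
  and complex linear, and \<open>\<alpha> + i\<beta>\<close> has no torsion because the base has constant curvature \<open>c\<close>.
  Hence it is the Levi-Civita connection of \<open>G\<close>, and \<open>G\<close> is Kaehler. Its curvature has the real
  part \<open>c (\<alpha> \<and> \<alpha> + \<beta> \<and> \<beta>)\<close> and the imaginary part \<open>- c (\<langle>\<alpha>(X), \<beta>(Y)\<rangle> - \<langle>\<alpha>(Y), \<beta>(X)\<rangle>)\<close>, which is
  the curvature of the complex quadric (\<open>c > 0\<close>) or of its noncompact dual (\<open>c < 0\<close>). Its trace
  gives the Einstein constant \<open>nc/k\<close>. If the holomorphic sectional curvature were a constant
  \<open>\<kappa>\<close>, two values of the curvature tensor would give \<open>c = k\<kappa>\<close> and \<open>4c = k\<kappa>\<close>.\<close>


section \<open>Calculus of smooth functions\<close>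

text \<open>For c > 0 define an angle \<chi> by
  \<open>sin \<chi> = \<surd>c |p| / a\<^sub>1\<close>. Then
  \<open>cos \<chi> = w / a\<^sub>1\<close> and \<open>\<surd>c |S| = tan (\<chi>/2)\<close>: on a
  fibre S is a stereographic coordinate, the vertical part 4 |dS|^2 / N^2 of |\<beta>|^2 is the
  metric of curvature c, and \<alpha> fixes the vectors orthogonal to S and multiplies S by cos
  \<chi>. For c < 0 hyperbolic functions take over. So \<open>a\<^sub>1\<close> only says how |p|
  parametrizes the radius, which is why it can disappear; the positivity hypotheses say that
  \<open>|p| / a\<^sub>1\<close> is strictly increasing and that the radicand of w stays positive.
  As |p| is not smooth on the zero section, all scalars are functions of t, with one-sided
  derivatives at t = 0. A direct computation of the curvature of G would differentiate
  \<open>a\<^sub>1\<close> up to order three. In the gauge, \<open>a\<^sub>1\<close> enters only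
  through a few scalar identities; beyond them the inputs are the curvature of the base and its
  value on S, and what remains are polynomial identities in scalar products modulo N (1/N) =
  1.\<close>

abbreviation dd :: "('a::real_normed_vector \<Rightarrow> 'b::real_normed_vector) \<Rightarrow> 'a \<Rightarrow> 'a \<Rightarrow> 'b" where
  "dd f x v \<equiv> frechet_derivative f (at x) v"

lemma dd_eqI: "(f has_derivative f') (at x) \<Longrightarrow> dd f x v = f' v"
  by (metis frechet_derivative_at)

lemma differentiable_has_dd: "f differentiable (at x) \<Longrightarrow> (f has_derivative dd f x) (at x)"
  using frechet_derivative_works by blast

lemma differentiable_cong_open:
  assumes "open S" "x \<in> S" "\<And>y. y \<in> S \<Longrightarrow> f y = g y"
  shows "f differentiable (at x) \<longleftrightarrow> g differentiable (at x)"
  using has_derivative_transform_within_open[OF _ assms(1,2), of f _ UNIV g]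
    has_derivative_transform_within_open[OF _ assms(1,2), of g _ UNIV f] assms(3)
  unfolding differentiable_def by metis

lemma dd_cong_open:
  assumes "open S" "x \<in> S" "\<And>y. y \<in> S \<Longrightarrow> f y = g y"
  shows "dd f x v = dd g x v"
proof -
  have "(f has_derivative f') (at x) \<longleftrightarrow> (g has_derivative f') (at x)" for f'
    using has_derivative_transform_within_open[OF _ assms(1,2), of f f' UNIV g]
      has_derivative_transform_within_open[OF _ assms(1,2), of g f' UNIV f] assms(3) by metis
  then show ?thesis by (simp add: frechet_derivative_def)
qed

lemma dd_linear:
  assumes "f differentiable (at x)"
  shows "dd f x (u + v) = dd f x u + dd f x v" "dd f x (r *\<^sub>R u) = r *\<^sub>R dd f x u"
    "dd f x (u - v) = dd f x u - dd f x v" "dd f x 0 = 0" "dd f x (- u) = - dd f x u"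
  using linear_frechet_derivative[OF assms]
  by (simp_all add: linear_add linear_cmul linear_diff linear_0 linear_neg)

lemma dd_add:
  assumes "f differentiable (at x)" "g differentiable (at x)"
  shows "dd (\<lambda>y. f y + g y) x v = dd f x v + dd g x v"
  by (rule dd_eqI) (intro has_derivative_add differentiable_has_dd assms)

lemma dd_diff:
  assumes "f differentiable (at x)" "g differentiable (at x)"
  shows "dd (\<lambda>y. f y - g y) x v = dd f x v - dd g x v"
  by (rule dd_eqI) (intro has_derivative_diff differentiable_has_dd assms)

lemma dd_sum:
  assumes "\<And>i. i \<in> I \<Longrightarrow> f i differentiable (at x)"
  shows "dd (\<lambda>y. \<Sum>i\<in>I. f i y) x v = (\<Sum>i\<in>I. dd (f i) x v)"
  by (rule dd_eqI) (intro has_derivative_sum differentiable_has_dd assms)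

lemma dd_bounded_linear:
  assumes "bounded_linear L" "f differentiable (at x)"
  shows "dd (\<lambda>y. L (f y)) x v = L (dd f x v)"
  by (rule dd_eqI) (intro bounded_linear.has_derivative[OF assms(1)] differentiable_has_dd assms)

lemma dd_bounded_bilinear:
  assumes "bounded_bilinear B" "f differentiable (at x)" "g differentiable (at x)"
  shows "dd (\<lambda>y. B (f y) (g y)) x v = B (f x) (dd g x v) + B (dd f x v) (g x)"
  by (rule dd_eqI[OF bounded_bilinear.FDERIV[OF assms(1)]]) (intro differentiable_has_dd assms)+

lemma differentiable_bounded_bilinear:
  assumes "bounded_bilinear B" "f differentiable (at x)" "g differentiable (at x)"
  shows "(\<lambda>y. B (f y) (g y)) differentiable (at x)"
  using bounded_bilinear.FDERIV[OF assms(1) assms(2,3)[THEN differentiable_has_dd]]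
  by (rule differentiableI)

lemma differentiable_bounded_linear:
  assumes "bounded_linear L" "f differentiable (at x)"
  shows "(\<lambda>y. L (f y)) differentiable (at x)"
  using bounded_linear.has_derivative[OF assms(1) differentiable_has_dd[OF assms(2)]]
  by (rule differentiableI)

lemmas dd_mult = dd_bounded_bilinear[OF bounded_bilinear_mult]
lemmas dd_scaleR = dd_bounded_bilinear[OF bounded_bilinear_scaleR]

lemma dd_compose:
  assumes "g differentiable (at (f x))" "f differentiable (at x)"
  shows "dd (\<lambda>y. g (f y)) x v = dd g (f x) (dd f x v)"
proof -
  have "((\<lambda>y. g (f y)) has_derivative (\<lambda>v. dd g (f x) (dd f x v))) (at x)"
    using has_derivative_compose[of f "dd f x" x UNIV g "dd g (f x)"] assms
    by (simp add: differentiable_has_dd)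
  then show ?thesis by (rule dd_eqI)
qed

lemma differentiable_compose:
  assumes "g differentiable (at (f x))" "f differentiable (at x)"
  shows "(\<lambda>y. g (f y)) differentiable (at x)"
  using differentiable_chain_at[OF assms(2,1)] by (simp add: o_def)

lemma dd_Pair:
  assumes "f differentiable (at x)" "g differentiable (at x)"
  shows "dd (\<lambda>y. (f y, g y)) x v = (dd f x v, dd g x v)"
  by (rule dd_eqI) (intro has_derivative_Pair differentiable_has_dd assms)

section \<open>Closure properties of smooth maps\<close>

lemma Ck_on_cong:
  assumes "open S" "\<And>x. x \<in> S \<Longrightarrow> f x = g x"
  shows "Ck_on k S f \<longleftrightarrow> Ck_on k S g"
  using assms(2)
proof (induction k arbitrary: f g)
  case 0
  then show ?case by (simp cong: continuous_on_cong)
next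
  case (Suc k)
  have "Ck_on k S (\<lambda>x. dd f x v) \<longleftrightarrow> Ck_on k S (\<lambda>x. dd g x v)" for v
    by (rule Suc.IH) (use dd_cong_open[OF assms(1)] Suc.prems in blast)
  moreover have "f differentiable (at x) \<longleftrightarrow> g differentiable (at x)" if "x \<in> S" for x
    by (rule differentiable_cong_open[OF assms(1) that Suc.prems])
  ultimately show ?case by auto
qed

lemma Ck_on_mono: "Ck_on (Suc k) S f \<Longrightarrow> Ck_on k S f"
proof (induction k arbitrary: f)
  case 0
  then have "f differentiable_on S"
    by (auto simp: differentiable_on_def intro: differentiable_at_withinI)
  then show ?case by (simp add: differentiable_imp_continuous_on)
next
  case (Suc k)
  then show ?case by (metis Ck_on.simps(2))
qed

lemma Ck_on_const: "Ck_on k S (\<lambda>_. a)"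
  by (induction k arbitrary: a) auto

lemma Ck_on_bounded_linear:
  assumes "bounded_linear L" "open S" "Ck_on k S f"
  shows "Ck_on k S (\<lambda>x. L (f x))"
  using assms(3)
proof (induction k arbitrary: f)
  case 0
  then show ?case
    using bounded_linear.continuous_on[OF assms(1)] by auto
next
  case (Suc k)
  have d: "f differentiable (at x)" if "x \<in> S" for x using Suc.prems that by simp
  have "Ck_on k S (\<lambda>x. dd (\<lambda>x. L (f x)) x v)" for v
    using Suc.IH[of "\<lambda>x. dd f x v"] Suc.prems
    by (simp add: Ck_on_cong[OF assms(2) dd_bounded_linear[OF assms(1) d]])
  then show ?case by (simp add: differentiable_bounded_linear[OF assms(1) d])
qed

lemma Ck_on_add:
  assumes "open S" "Ck_on k S f" "Ck_on k S g"
  shows "Ck_on k S (\<lambda>x. f x + g x)"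
  using assms(2,3)
proof (induction k arbitrary: f g)
  case 0
  then show ?case by (auto intro: continuous_on_add)
next
  case (Suc k)
  have d: "f differentiable (at x)" "g differentiable (at x)" if "x \<in> S" for x
    using Suc.prems that by simp_all
  have "Ck_on k S (\<lambda>x. dd (\<lambda>x. f x + g x) x v)" for v
    using Suc.IH[of "\<lambda>x. dd f x v" "\<lambda>x. dd g x v"] Suc.prems
    by (simp add: Ck_on_cong[OF assms(1) dd_add[OF d]])
  then show ?case by (simp add: d)
qed

lemma Ck_on_bounded_bilinear:
  assumes "bounded_bilinear B" "open S" "Ck_on k S f" "Ck_on k S g"
  shows "Ck_on k S (\<lambda>x. B (f x) (g x))"
  using assms(3,4)
proof (induction k arbitrary: f g)
  case 0
  then show ?case
    using bounded_bilinear.continuous_on[OF assms(1)] by auto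
next
  case (Suc k)
  have d: "f differentiable (at x)" "g differentiable (at x)" if "x \<in> S" for x
    using Suc.prems that by simp_all
  have "Ck_on k S (\<lambda>x. B (f x) (dd g x v) + B (dd f x v) (g x))" for v
    using Suc.prems Ck_on_mono[OF Suc.prems(1)] Ck_on_mono[OF Suc.prems(2)]
    by (intro Ck_on_add Suc.IH assms) simp_all
  then have "Ck_on k S (\<lambda>x. dd (\<lambda>x. B (f x) (g x)) x v)" for v
    by (simp add: Ck_on_cong[OF assms(2) dd_bounded_bilinear[OF assms(1) d]])
  then show ?case by (simp add: differentiable_bounded_bilinear[OF assms(1)] d)
qed

lemma smooth_on_differentiable: "smooth_on S f \<Longrightarrow> x \<in> S \<Longrightarrow> f differentiable (at x)"
  unfolding smooth_on_def by (metis Ck_on.simps(2))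

lemma smooth_on_dd: "smooth_on S f \<Longrightarrow> smooth_on S (\<lambda>x. dd f x v)"
  unfolding smooth_on_def by (metis Ck_on.simps(2))

lemma smooth_on_cong:
  "open S \<Longrightarrow> (\<And>x. x \<in> S \<Longrightarrow> f x = g x) \<Longrightarrow> smooth_on S f \<longleftrightarrow> smooth_on S g"
  unfolding smooth_on_def using Ck_on_cong by blast

lemma Ck_on_subset: "Ck_on k S f \<Longrightarrow> T \<subseteq> S \<Longrightarrow> Ck_on k T f"
  by (induction k arbitrary: f) (auto intro: continuous_on_subset)

lemma smooth_on_subset: "smooth_on S f \<Longrightarrow> T \<subseteq> S \<Longrightarrow> smooth_on T f"
  unfolding smooth_on_def using Ck_on_subset by blast

lemma smooth_on_const: "smooth_on S (\<lambda>_. a)"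
  by (simp add: smooth_on_def Ck_on_const)

lemma smooth_on_bounded_linear:
  "open S \<Longrightarrow> bounded_linear L \<Longrightarrow> smooth_on S f \<Longrightarrow> smooth_on S (\<lambda>x. L (f x))"
  by (simp add: smooth_on_def Ck_on_bounded_linear)

lemma smooth_on_linear:
  fixes L :: "'b::euclidean_space \<Rightarrow> 'c::real_normed_vector"
  shows "open S \<Longrightarrow> linear L \<Longrightarrow> smooth_on S f \<Longrightarrow> smooth_on S (\<lambda>x. L (f x))"
  by (simp add: smooth_on_bounded_linear linear_conv_bounded_linear)

lemma smooth_on_id: "smooth_on S (\<lambda>x. x)"
proof -
  have "Ck_on k S (\<lambda>x. x)" for k
    by (cases k) (simp_all add: Ck_on_const continuous_on_id)
  then show ?thesis by (simp add: smooth_on_def)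
qed

lemma smooth_on_add:
  "open S \<Longrightarrow> smooth_on S f \<Longrightarrow> smooth_on S g \<Longrightarrow> smooth_on S (\<lambda>x. f x + g x)"
  by (simp add: smooth_on_def Ck_on_add)

lemma smooth_on_minus: "open S \<Longrightarrow> smooth_on S f \<Longrightarrow> smooth_on S (\<lambda>x. - f x)"
  by (rule smooth_on_bounded_linear[OF _ bounded_linear_minus[OF bounded_linear_ident]])

lemma smooth_on_diff:
  "open S \<Longrightarrow> smooth_on S f \<Longrightarrow> smooth_on S g \<Longrightarrow> smooth_on S (\<lambda>x. f x - g x)"
  using smooth_on_add[of S f "\<lambda>x. - g x"] smooth_on_minus[of S g] by simp

lemma smooth_on_sum:
  "open S \<Longrightarrow> (\<And>i. i \<in> I \<Longrightarrow> smooth_on S (f i)) \<Longrightarrow> smooth_on S (\<lambda>x. \<Sum>i\<in>I. f i x)"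
  by (induction I rule: infinite_finite_induct) (simp_all add: smooth_on_const smooth_on_add)

lemma smooth_on_bounded_bilinear:
  "open S \<Longrightarrow> bounded_bilinear B \<Longrightarrow> smooth_on S f \<Longrightarrow> smooth_on S g \<Longrightarrow> smooth_on S (\<lambda>x. B (f x) (g x))"
  by (simp add: smooth_on_def Ck_on_bounded_bilinear)

lemmas smooth_on_scaleR = smooth_on_bounded_bilinear[OF _ bounded_bilinear_scaleR]
lemmas smooth_on_mult = smooth_on_bounded_bilinear[OF _ bounded_bilinear_mult[where ?'a = real]]
lemmas smooth_on_inner = smooth_on_bounded_bilinear[OF _ bounded_bilinear_inner]

lemma smooth_on_prod:
  "open S \<Longrightarrow> (\<And>i. i \<in> I \<Longrightarrow> smooth_on S (f i)) \<Longrightarrow> smooth_on S (\<lambda>x. \<Prod>i\<in>I. f i x :: real)"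
  by (induction I rule: infinite_finite_induct) (simp_all add: smooth_on_const smooth_on_mult)

lemma smooth_on_Pair:
  assumes "open S" "smooth_on S f" "smooth_on S g"
  shows "smooth_on S (\<lambda>x. (f x, g x))"
proof -
  have "smooth_on S (\<lambda>x. (f x, 0) + (0, g x))"
    by (rule smooth_on_add[OF assms(1)
          smooth_on_bounded_linear[OF assms(1) bounded_linear_Pair[OF bounded_linear_ident bounded_linear_zero] assms(2)]
          smooth_on_bounded_linear[OF assms(1) bounded_linear_Pair[OF bounded_linear_zero bounded_linear_ident] assms(3)]])
  then show ?thesis by simp
qed

text \<open>A directional derivative of a composition with \<open>fst\<close> is again a composition
  with \<open>fst\<close>, so the induction on \<open>k\<close> closes over all \<open>f\<close>.
  This carries the tensors of the base to the cotangent bundle.\<close>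

lemma smooth_on_compose_fst:
  fixes f :: "'a::euclidean_space \<Rightarrow> 'b::real_normed_vector"
  assumes "open U" "smooth_on U f"
  shows "smooth_on (U \<times> (UNIV :: 'c::euclidean_space set)) (\<lambda>z. f (fst z))"
proof -
  have op: "open (U \<times> (UNIV :: 'c set))" using assms by (simp add: open_Times)
  have "Ck_on k (U \<times> (UNIV :: 'c set)) (\<lambda>z. f (fst z))" if "Ck_on k U f"
    for k and f :: "'a \<Rightarrow> 'b"
    using that
  proof (induction k arbitrary: f)
    case 0
    then have "continuous_on U f" by simp
    then have "continuous_on (U \<times> (UNIV :: 'c set)) (\<lambda>z. f (fst z))"
      by (rule continuous_on_compose2) (auto intro: continuous_on_fst continuous_on_id)
    then show ?case by simp
  next
    case (Suc k)
    have fst: "fst differentiable (at z)" "dd fst z v = fst v" for z v :: "'a \<times> 'c"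
      by (auto simp: bounded_linear_imp_differentiable bounded_linear_fst
          intro!: dd_eqI bounded_linear_imp_has_derivative)
    have d: "f differentiable (at (fst z))" if "z \<in> U \<times> (UNIV :: 'c set)" for z
      using Suc.prems that by auto
    have e: "dd (\<lambda>z. f (fst z)) z v = dd f (fst z) (fst v)" if "z \<in> U \<times> (UNIV :: 'c set)" for z v
      using dd_compose[OF d[OF that] fst(1)] fst(2) by simp
    have "Ck_on k (U \<times> (UNIV :: 'c set)) (\<lambda>z. dd f (fst z) (fst v))" for v :: "'a \<times> 'c"
      by (rule Suc.IH) (use Suc.prems in simp)
    then have "Ck_on k (U \<times> (UNIV :: 'c set)) (\<lambda>z. dd (\<lambda>z. f (fst z)) z v)" for v
      by (simp only: Ck_on_cong[OF op e])
    moreover have "(\<lambda>z. f (fst z)) differentiable (at z)" if "z \<in> U \<times> (UNIV :: 'c set)" for z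
      by (rule differentiable_compose[OF d[OF that] fst(1)])
    ultimately show ?case unfolding Ck_on.simps by blast
  qed
  then show ?thesis using assms(2) by (simp add: smooth_on_def)
qed

text \<open>The derivative \<open>- (1/f) df (1/f)\<close> contains only the reciprocal itself and
  the smooth \<open>df\<close>, so the induction on \<open>k\<close> gains one order with
  \<open>f\<close> fixed.\<close>

lemma smooth_on_inverse:
  fixes f :: "'a::euclidean_space \<Rightarrow> real"
  assumes "open S" "smooth_on S f" "\<And>x. x \<in> S \<Longrightarrow> f x \<noteq> 0"
  shows "smooth_on S (\<lambda>x. inverse (f x))"
proof -
  have "Ck_on k S (\<lambda>x. inverse (f x))" for k
  proof (induction k)
    case 0
    then show ?case
      using assms smooth_on_def[of S f] by (auto intro!: continuous_on_inverse) (metis Ck_on.simps(1))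
  next
    case (Suc k)
    have h: "((\<lambda>x. inverse (f x)) has_derivative (\<lambda>v. - (inverse (f x) * dd f x v * inverse (f x)))) (at x)"
      if "x \<in> S" for x
      by (rule Deriv.has_derivative_inverse[OF assms(3)[OF that]
            differentiable_has_dd[OF smooth_on_differentiable[OF assms(2) that]]])
    have "Ck_on k S (\<lambda>x. dd f x v)" for v
      using smooth_on_dd[OF assms(2)] by (simp add: smooth_on_def)
    then have "Ck_on k S (\<lambda>x. - (inverse (f x) * dd f x v * inverse (f x)))" for v
      by (intro Ck_on_bounded_linear[OF bounded_linear_minus[OF bounded_linear_ident]]
          Ck_on_bounded_bilinear[OF bounded_bilinear_mult] Suc assms)
    then show ?case
      using h by (auto simp: differentiable_def Ck_on_cong[OF assms(1) dd_eqI[OF h]])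
  qed
  then show ?thesis by (simp add: smooth_on_def)
qed

lemma smooth_on_divide:
  fixes f g :: "'a::euclidean_space \<Rightarrow> real"
  assumes "open S" "smooth_on S f" "smooth_on S g" "\<And>x. x \<in> S \<Longrightarrow> g x \<noteq> 0"
  shows "smooth_on S (\<lambda>x. f x / g x)"
  unfolding divide_inverse by (intro smooth_on_mult smooth_on_inverse assms)

lemma smooth_on_sqrt:
  fixes f :: "'a::euclidean_space \<Rightarrow> real"
  assumes "open S" "smooth_on S f" "\<And>x. x \<in> S \<Longrightarrow> f x > 0"
  shows "smooth_on S (\<lambda>x. sqrt (f x))"
proof -
  have "Ck_on k S (\<lambda>x. sqrt (f x))" for k
  proof (induction k)
    case 0
    then show ?case
      using assms smooth_on_def[of S f] by (auto intro!: continuous_on_real_sqrt) (metis Ck_on.simps(1))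
  next
    case (Suc k)
    \<comment> \<open>Writing \<open>1 / sqrt f\<close> as \<open>sqrt f * inverse f\<close> keeps
      the root in the numerator, where the induction hypothesis applies.\<close>
    have h: "((\<lambda>x. sqrt (f x)) has_derivative (\<lambda>v. (1/2) * (dd f x v * (sqrt (f x) * inverse (f x))))) (at x)"
      if "x \<in> S" for x
    proof -
      have "inverse (sqrt (f x)) = sqrt (f x) * inverse (f x)"
        using assms(3)[OF that] by (simp add: field_simps)
      then show ?thesis
        using has_derivative_real_sqrt[of f x "dd f x" UNIV, OF assms(3)[OF that]
            differentiable_has_dd[OF smooth_on_differentiable[OF assms(2) that]]]
        by (simp only: mult.commute mult.left_commute divide_inverse mult_1_left)
    qed
    have "Ck_on k S (\<lambda>x. dd f x v)" "Ck_on k S (\<lambda>x. inverse (f x))" for v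
      using smooth_on_dd[OF assms(2)] smooth_on_inverse[OF assms(1,2)] assms(3)
      by (fastforce simp: smooth_on_def)+
    then have "Ck_on k S (\<lambda>x. (1/2) * (dd f x v * (sqrt (f x) * inverse (f x))))" for v
      by (intro Ck_on_bounded_bilinear[OF bounded_bilinear_mult] Suc assms Ck_on_const)
    then show ?case
      using h by (auto simp: differentiable_def Ck_on_cong[OF assms(1) dd_eqI[OF h]])
  qed
  then show ?thesis by (simp add: smooth_on_def)
qed

lemma dd_sqrt:
  assumes "f differentiable (at x)" "f x > 0"
  shows "dd (\<lambda>y. sqrt (f y)) x v = dd f x v / (2 * sqrt (f x))"
  using has_derivative_real_sqrt[of f x "dd f x" UNIV, OF assms(2) differentiable_has_dd[OF assms(1)]]
  by (subst dd_eqI) (auto simp: field_simps)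

lemma dd_divide:
  fixes f g :: "'a::real_normed_vector \<Rightarrow> real"
  assumes "f differentiable (at x)" "g differentiable (at x)" "g x \<noteq> 0"
  shows "dd (\<lambda>y. f y / g y) x v = (dd f x v * g x - f x * dd g x v) / (g x * g x)"
  using has_derivative_divide'[OF differentiable_has_dd[OF assms(1)] differentiable_has_dd[OF assms(2)] assms(3)]
  by (subst dd_eqI) auto

section \<open>Functions on the half-line composed with a nonnegative function\<close>

lemma halfline_has_derivative:
  assumes "f differentiable (at t within {0..})" "t \<ge> 0"
  shows "(f has_derivative (\<lambda>r. r * halfline_deriv f t)) (at t within {0..})"
  using assms vector_derivative_works[of f "at t within {0..}"]
  by (auto simp: halfline_deriv_def has_vector_derivative_def)

text \<open>Since \<open>e\<close> maps the open set \<open>S\<close> into the half-line, a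
  one-sided derivative of \<open>f\<close> suffices for a two-sided derivative of the composite.
  This matters on the zero section, where the energy takes its boundary value 0.\<close>

lemma halfline_compose:
  assumes "f differentiable (at (e x) within {0..})" "open S" "x \<in> S"
    and "e differentiable (at x)" "\<And>y. y \<in> S \<Longrightarrow> e y \<ge> 0"
  shows "((\<lambda>y. f (e y)) has_derivative (\<lambda>v. dd e x v * halfline_deriv f (e x))) (at x)"
proof -
  have "(e has_derivative dd e x) (at x within S)"
    using assms by (simp add: differentiable_has_dd has_derivative_at_withinI)
  moreover have "(f has_derivative (\<lambda>r. r * halfline_deriv f (e x))) (at (e x) within e ` S)"
    using halfline_has_derivative[OF assms(1)] assms(3,5)
    by (auto intro: has_derivative_subset)
  ultimately have "((\<lambda>y. f (e y)) has_derivative (\<lambda>v. dd e x v * halfline_deriv f (e x))) (at x within S)"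
    by (rule has_derivative_in_compose)
  then show ?thesis by (simp only: at_within_open[OF assms(3,2)])
qed

lemma smooth_halfline_D:
  assumes "smooth_halfline f"
  shows "t \<ge> 0 \<Longrightarrow> f differentiable (at t within {0..})" "smooth_halfline (halfline_deriv f)"
proof -
  show "t \<ge> 0 \<Longrightarrow> f differentiable (at t within {0..})"
    using assms unfolding smooth_halfline_def by (metis funpow_0)
  show "smooth_halfline (halfline_deriv f)"
    unfolding smooth_halfline_def
  proof (intro allI impI)
    fix k t assume "0 \<le> (t :: real)"
    moreover have "(halfline_deriv ^^ k) (halfline_deriv f) = (halfline_deriv ^^ Suc k) f"
      by (simp add: funpow_swap1)
    ultimately show "(halfline_deriv ^^ k) (halfline_deriv f) differentiable at t within {0..}"
      using assms unfolding smooth_halfline_def by metis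
  qed
qed

lemma dd_halfline_compose:
  assumes "smooth_halfline f" "open S" "x \<in> S" "smooth_on S e" "\<And>y. y \<in> S \<Longrightarrow> e y \<ge> 0"
  shows "dd (\<lambda>y. f (e y)) x v = dd e x v * halfline_deriv f (e x)"
  using assms smooth_halfline_D(1)[OF assms(1)]
  by (intro dd_eqI halfline_compose[where S=S]) (auto intro: smooth_on_differentiable)

lemma smooth_on_halfline_compose:
  assumes "smooth_halfline f" "open S" "smooth_on S e" "\<And>y. y \<in> S \<Longrightarrow> e y \<ge> 0"
  shows "smooth_on S (\<lambda>x. f (e x))"
proof -
  have "Ck_on k S (\<lambda>x. f (e x))" if "smooth_halfline f" for k and f :: "real \<Rightarrow> real"
    using that
  proof (induction k arbitrary: f)
    case 0
    have "continuous_on S e"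
      using assms(3) unfolding smooth_on_def by (metis Ck_on.simps(1))
    moreover have "continuous_on {0..} f"
      using smooth_halfline_D(1)[OF 0]
      by (auto intro!: differentiable_imp_continuous_on simp: differentiable_on_def)
    ultimately have "continuous_on S (\<lambda>x. f (e x))"
      using assms(4) by (auto intro!: continuous_on_compose2[of "{0..}" f])
    then show ?case by simp
  next
    case (Suc k)
    have h: "((\<lambda>y. f (e y)) has_derivative (\<lambda>v. dd e x v * halfline_deriv f (e x))) (at x)" if "x \<in> S" for x
      using that assms smooth_halfline_D(1)[OF Suc.prems]
      by (intro halfline_compose[where S=S]) (auto intro: smooth_on_differentiable)
    have "Ck_on k S (\<lambda>x. dd e x v)" for v
      using smooth_on_dd[OF assms(3)] by (simp add: smooth_on_def)
    then have "Ck_on k S (\<lambda>x. dd e x v * halfline_deriv f (e x))" for v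
      by (intro Ck_on_bounded_bilinear[OF bounded_bilinear_mult] assms Suc.IH smooth_halfline_D(2) Suc.prems)
    then show ?case
      using h by (auto simp: differentiable_def Ck_on_cong[OF assms(2) dd_eqI[OF h]])
  qed
  then show ?thesis using assms(1) by (simp add: smooth_on_def)
qed

section \<open>Symmetry of second derivatives\<close>

text \<open>The mean value theorem is used twice: in direction \<open>u\<close> for the difference
  of \<open>f\<close> along \<open>v\<close>, and in direction \<open>v\<close> for the derivative
  of \<open>f\<close> along \<open>u\<close>. The bound on \<open>s\<close> keeps all intermediate
  points in the ball.\<close>

lemma second_difference:
  fixes f :: "'a::euclidean_space \<Rightarrow> real"
  assumes f: "smooth_on (ball x d) f" and s: "s > 0" "s * (norm u + norm v) < d"
  obtains y where "norm (y - x) \<le> s * (norm u + norm v)"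
    "f (x + s *\<^sub>R u + s *\<^sub>R v) - f (x + s *\<^sub>R u) - f (x + s *\<^sub>R v) + f x
      = s * (s * dd (\<lambda>y. dd f y u) y v)"
proof -
  have le: "norm (a *\<^sub>R u + b *\<^sub>R v) \<le> s * (norm u + norm v)"
    if "0 \<le> a" "a \<le> s" "0 \<le> b" "b \<le> s" for a b
  proof -
    have "norm (a *\<^sub>R u + b *\<^sub>R v) \<le> a * norm u + b * norm v"
      using norm_triangle_ineq[of "a *\<^sub>R u" "b *\<^sub>R v"] that by simp
    also have "\<dots> \<le> s * norm u + s * norm v"
      using that by (intro add_mono mult_right_mono) auto
    finally show ?thesis by (simp add: distrib_left)
  qed
  have inb: "x + (a *\<^sub>R u + b *\<^sub>R v) \<in> ball x d" if "0 \<le> a" "a \<le> s" "0 \<le> b" "b \<le> s" for a b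
    using le[OF that] s by (simp add: dist_norm norm_minus_commute[of 0] flip: norm_minus_cancel[of "a *\<^sub>R u + b *\<^sub>R v"])
  have line: "((\<lambda>r. h (p + r *\<^sub>R w)) has_real_derivative dd h (p + r *\<^sub>R w) w) (at r)"
    if "h differentiable (at (p + r *\<^sub>R w))" for h :: "'a \<Rightarrow> real" and p w r
  proof -
    have "((\<lambda>r. p + r *\<^sub>R w) has_derivative (\<lambda>t. t *\<^sub>R w)) (at r)"
      by (auto intro!: derivative_eq_intros)
    then have "((\<lambda>r. h (p + r *\<^sub>R w)) has_derivative (\<lambda>t. dd h (p + r *\<^sub>R w) (t *\<^sub>R w))) (at r)"
      using has_derivative_compose[of "\<lambda>r. p + r *\<^sub>R w" "\<lambda>t. t *\<^sub>R w" r UNIV h "dd h (p + r *\<^sub>R w)"]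
        differentiable_has_dd[OF that] by simp
    then show ?thesis
      by (simp add: has_field_derivative_def dd_linear(2)[OF that] mult_commute_abs)
  qed
  have "\<exists>\<xi>. 0 < \<xi> \<and> \<xi> < s \<and> (f ((x + s *\<^sub>R v) + s *\<^sub>R u) - f (x + s *\<^sub>R u))
      - (f ((x + s *\<^sub>R v) + 0 *\<^sub>R u) - f (x + 0 *\<^sub>R u))
     = (s - 0) * (dd f ((x + s *\<^sub>R v) + \<xi> *\<^sub>R u) u - dd f (x + \<xi> *\<^sub>R u) u)"
  proof (rule MVT2[OF s(1)])
    fix r assume r: "0 \<le> r" "r \<le> s"
    show "((\<lambda>r. f ((x + s *\<^sub>R v) + r *\<^sub>R u) - f (x + r *\<^sub>R u)) has_real_derivative
        dd f ((x + s *\<^sub>R v) + r *\<^sub>R u) u - dd f (x + r *\<^sub>R u) u) (at r)"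
      using inb[of r s] inb[of r 0] r s(1)
      by (intro DERIV_diff line smooth_on_differentiable[OF f]) (simp_all add: algebra_simps)
  qed
  then obtain \<xi> where \<xi>: "0 < \<xi>" "\<xi> < s" and e1: "(f ((x + s *\<^sub>R v) + s *\<^sub>R u) - f (x + s *\<^sub>R u))
      - (f ((x + s *\<^sub>R v) + 0 *\<^sub>R u) - f (x + 0 *\<^sub>R u))
     = (s - 0) * (dd f ((x + s *\<^sub>R v) + \<xi> *\<^sub>R u) u - dd f (x + \<xi> *\<^sub>R u) u)" by blast
  have "\<exists>\<eta>. 0 < \<eta> \<and> \<eta> < s \<and> dd f ((x + \<xi> *\<^sub>R u) + s *\<^sub>R v) u - dd f ((x + \<xi> *\<^sub>R u) + 0 *\<^sub>R v) u
     = (s - 0) * dd (\<lambda>y. dd f y u) ((x + \<xi> *\<^sub>R u) + \<eta> *\<^sub>R v) v"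
  proof (rule MVT2[OF s(1)])
    fix r assume r: "0 \<le> r" "r \<le> s"
    show "((\<lambda>r. dd f ((x + \<xi> *\<^sub>R u) + r *\<^sub>R v) u) has_real_derivative
        dd (\<lambda>y. dd f y u) ((x + \<xi> *\<^sub>R u) + r *\<^sub>R v) v) (at r)"
      using inb[of \<xi> r] r s(1) \<xi>
      by (intro line smooth_on_differentiable[OF smooth_on_dd[OF f]]) (simp add: algebra_simps)
  qed
  then obtain \<eta> where \<eta>: "0 < \<eta>" "\<eta> < s" and e2: "dd f ((x + \<xi> *\<^sub>R u) + s *\<^sub>R v) u - dd f ((x + \<xi> *\<^sub>R u) + 0 *\<^sub>R v) u
     = (s - 0) * dd (\<lambda>y. dd f y u) ((x + \<xi> *\<^sub>R u) + \<eta> *\<^sub>R v) v" by blast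
  show thesis
  proof (rule that[of "(x + \<xi> *\<^sub>R u) + \<eta> *\<^sub>R v"])
    show "norm ((x + \<xi> *\<^sub>R u) + \<eta> *\<^sub>R v - x) \<le> s * (norm u + norm v)"
      using le[of \<xi> \<eta>] \<xi> \<eta> by (simp add: algebra_simps)
    show "f (x + s *\<^sub>R u + s *\<^sub>R v) - f (x + s *\<^sub>R u) - f (x + s *\<^sub>R v) + f x
      = s * (s * dd (\<lambda>y. dd f y u) ((x + \<xi> *\<^sub>R u) + \<eta> *\<^sub>R v) v)"
      using e1 e2 by (simp add: add.assoc add.commute add.left_commute)
  qed
qed

text \<open>The second difference is symmetric in \<open>u\<close> and \<open>v\<close>, so the two
  mixed derivatives agree at suitable points arbitrarily close to \<open>x\<close>; by continuity
  they cannot differ at \<open>x\<close>.\<close>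

lemma dd_commute_real:
  fixes f :: "'a::euclidean_space \<Rightarrow> real"
  assumes "open S" "x \<in> S" "smooth_on S f"
  shows "dd (\<lambda>y. dd f y v) x u = dd (\<lambda>y. dd f y u) x v"
proof (rule ccontr)
  define h1 where "h1 = (\<lambda>y. dd (\<lambda>y. dd f y v) y u)"
  define h2 where "h2 = (\<lambda>y. dd (\<lambda>y. dd f y u) y v)"
  assume "dd (\<lambda>y. dd f y v) x u \<noteq> dd (\<lambda>y. dd f y u) x v"
  then have ne: "\<bar>h1 x - h2 x\<bar> / 2 > 0" by (simp add: h1_def h2_def)
  have c: "isCont h1 x" "isCont h2 x"
    unfolding h1_def h2_def
    by (intro differentiable_imp_continuous_within smooth_on_differentiable[OF _ assms(2)]
        smooth_on_dd assms(3))+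
  obtain d0 where d0: "d0 > 0" "ball x d0 \<subseteq> S" using assms by (meson openE)
  obtain d1 where d1: "d1 > 0" "\<And>y. dist y x < d1 \<Longrightarrow> dist (h1 y) (h1 x) < \<bar>h1 x - h2 x\<bar> / 2"
    using c(1) ne unfolding continuous_at_eps_delta by (metis dist_norm)
  obtain d2 where d2: "d2 > 0" "\<And>y. dist y x < d2 \<Longrightarrow> dist (h2 y) (h2 x) < \<bar>h1 x - h2 x\<bar> / 2"
    using c(2) ne unfolding continuous_at_eps_delta by (metis dist_norm)
  define d where "d = min d0 (min d1 d2)"
  have d: "d > 0" "d \<le> d0" "d \<le> d1" "d \<le> d2" using d0 d1 d2 by (auto simp: d_def)
  \<comment> \<open>The summand 1 keeps the denominator positive when \<open>u\<close> and
    \<open>v\<close> vanish; the factor 2 makes the bound in \<open>second_difference\<close>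
    strict.\<close>
  define s where "s = d / (2 * (norm u + norm v + 1))"
  have s: "s > 0" using d by (simp add: s_def add_nonneg_pos)
  have "norm u + norm v + 1 > 0" by (simp add: add_nonneg_pos)
  moreover have "s * (norm u + norm v) \<le> s * (norm u + norm v + 1)"
    using s by (intro mult_left_mono) auto
  moreover have "s * (norm u + norm v + 1) = d / 2"
    using \<open>norm u + norm v + 1 > 0\<close> by (simp add: s_def field_simps)
  ultimately have sd: "s * (norm u + norm v) < d" using d(1) by linarith
  have f: "smooth_on (ball x d) f"
    using smooth_on_subset[OF assms(3)] d0(2) d(2) by (meson subset_ball subset_trans)
  obtain y where y: "norm (y - x) \<le> s * (norm u + norm v)"
    "f (x + s *\<^sub>R u + s *\<^sub>R v) - f (x + s *\<^sub>R u) - f (x + s *\<^sub>R v) + f x = s * (s * h2 y)"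
    using second_difference[OF f s sd] unfolding h2_def by blast
  have sd': "s * (norm v + norm u) < d" using sd by (simp add: add.commute)
  obtain z where z: "norm (z - x) \<le> s * (norm v + norm u)"
    "f (x + s *\<^sub>R v + s *\<^sub>R u) - f (x + s *\<^sub>R v) - f (x + s *\<^sub>R u) + f x = s * (s * h1 z)"
    using second_difference[OF f s sd'] unfolding h1_def by blast
  have "f (x + s *\<^sub>R u + s *\<^sub>R v) = f (x + s *\<^sub>R v + s *\<^sub>R u)" by (simp add: add_ac)
  then have "s * (s * h2 y) = s * (s * h1 z)" using y(2) z(2) by linarith
  then have "h2 y = h1 z" using s by simp
  moreover have "dist (h2 y) (h2 x) < \<bar>h1 x - h2 x\<bar> / 2"
    using d2(2) y(1) sd d by (simp add: dist_norm)
  moreover have "dist (h1 z) (h1 x) < \<bar>h1 x - h2 x\<bar> / 2"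
    using d1(2) z(1) sd' d by (simp add: dist_norm)
  ultimately show False by (auto simp: dist_real_def abs_if split: if_splits)
qed

lemma dd_commute:
  fixes f :: "'a::euclidean_space \<Rightarrow> 'b::euclidean_space"
  assumes "open S" "x \<in> S" "smooth_on S f"
  shows "dd (\<lambda>y. dd f y v) x u = dd (\<lambda>y. dd f y u) x v"
proof (rule euclidean_eqI)
  fix b :: 'b
  have "dd (\<lambda>y. dd f y v) x u \<bullet> b = dd (\<lambda>y. dd (\<lambda>y. f y \<bullet> b) y v) x u" for u v
  proof -
    have "dd (\<lambda>y. f y \<bullet> b) y v = dd f y v \<bullet> b" if "y \<in> S" for y
      by (rule dd_bounded_linear[OF bounded_linear_inner_left smooth_on_differentiable[OF assms(3) that]])
    then have "dd (\<lambda>y. dd (\<lambda>y. f y \<bullet> b) y v) x u = dd (\<lambda>y. dd f y v \<bullet> b) x u"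
      by (rule dd_cong_open[OF assms(1,2)])
    also have "\<dots> = dd (\<lambda>y. dd f y v) x u \<bullet> b"
      by (rule dd_bounded_linear[OF bounded_linear_inner_left
            smooth_on_differentiable[OF smooth_on_dd[OF assms(3)] assms(2)]])
    finally show ?thesis ..
  qed
  moreover have "smooth_on S (\<lambda>y. f y \<bullet> b)"
    by (rule smooth_on_bounded_linear[OF assms(1) bounded_linear_inner_left assms(3)])
  ultimately show "dd (\<lambda>y. dd f y v) x u \<bullet> b = dd (\<lambda>y. dd f y u) x v \<bullet> b"
    using dd_commute_real[OF assms(1,2)] by metis
qed

section \<open>Product rules for tensor fields applied to vector fields\<close>

text \<open>Expanding the argument in a basis reduces everything to derivatives of \<open>T\<close>
  with constant arguments. This suits tensors that are given as functions of their arguments and not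
  as elements of a normed space of operators.\<close>

lemma
  fixes T :: "'a::euclidean_space \<Rightarrow> 'b::euclidean_space \<Rightarrow> 'c::real_normed_vector"
  assumes "open W" "x \<in> W" "\<And>y. y \<in> W \<Longrightarrow> linear (T y)"
    and "\<And>b. (\<lambda>y. T y b) differentiable (at x)" "a differentiable (at x)"
  shows differentiable_linear_app: "(\<lambda>y. T y (a y)) differentiable (at x)"
    and dd_linear_app: "dd (\<lambda>y. T y (a y)) x u = dd (\<lambda>y. T y (a x)) x u + T x (dd a x u)"
proof -
  have ex: "T y (c y) = (\<Sum>b\<in>Basis. (c y \<bullet> b) *\<^sub>R T y b)" if "y \<in> W" for y and c :: "'a \<Rightarrow> 'b"
  proof -
    have "T y (c y) = T y (\<Sum>b\<in>Basis. (c y \<bullet> b) *\<^sub>R b)" by (simp add: euclidean_representation)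
    then show ?thesis using assms(3)[OF that] by (simp add: linear_sum linear_cmul)
  qed
  have di: "(\<lambda>y. c y \<bullet> b) differentiable (at x)" if "c differentiable (at x)" for b and c :: "'a \<Rightarrow> 'b"
    by (rule differentiable_bounded_linear[OF bounded_linear_inner_left that])
  have ds: "(\<lambda>y. (c y \<bullet> b) *\<^sub>R T y b) differentiable (at x)" if "c differentiable (at x)"
    for b and c :: "'a \<Rightarrow> 'b"
    by (rule differentiable_bounded_bilinear[OF bounded_bilinear_scaleR di[OF that] assms(4)])
  have "(\<lambda>y. \<Sum>b\<in>Basis. (a y \<bullet> b) *\<^sub>R T y b) differentiable (at x)"
    using ds[OF assms(5)] by simp
  then show "(\<lambda>y. T y (a y)) differentiable (at x)"
    by (simp only: differentiable_cong_open[OF assms(1,2) ex[where c=a]])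
  have main: "dd (\<lambda>y. T y (c y)) x u
      = (\<Sum>b\<in>Basis. (c x \<bullet> b) *\<^sub>R dd (\<lambda>y. T y b) x u + (dd c x u \<bullet> b) *\<^sub>R T x b)"
    if "c differentiable (at x)" for c :: "'a \<Rightarrow> 'b"
  proof -
    have "dd (\<lambda>y. T y (c y)) x u = dd (\<lambda>y. \<Sum>b\<in>Basis. (c y \<bullet> b) *\<^sub>R T y b) x u"
      by (rule dd_cong_open[OF assms(1,2) ex])
    also have "\<dots> = (\<Sum>b\<in>Basis. dd (\<lambda>y. (c y \<bullet> b) *\<^sub>R T y b) x u)"
      by (rule dd_sum[OF ds[OF that]])
    also have "\<dots> = (\<Sum>b\<in>Basis. (c x \<bullet> b) *\<^sub>R dd (\<lambda>y. T y b) x u + (dd c x u \<bullet> b) *\<^sub>R T x b)"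
      by (intro sum.cong refl)
        (simp add: dd_scaleR[OF di[OF that] assms(4)] dd_bounded_linear[OF bounded_linear_inner_left that])
    finally show ?thesis .
  qed
  show "dd (\<lambda>y. T y (a y)) x u = dd (\<lambda>y. T y (a x)) x u + T x (dd a x u)"
    using main[OF assms(5)] main[of "\<lambda>_. a x"] ex[OF assms(2), of "\<lambda>y. dd a y u"]
    by (simp add: sum.distrib)
qed

lemma smooth_on_linear_app:
  fixes T :: "'a::euclidean_space \<Rightarrow> 'b::euclidean_space \<Rightarrow> 'c::real_normed_vector"
  assumes "open W" "\<And>y. y \<in> W \<Longrightarrow> linear (T y)"
    and "\<And>b. smooth_on W (\<lambda>y. T y b)" "smooth_on W a"
  shows "smooth_on W (\<lambda>y. T y (a y))"
proof -
  have ex: "T y (a y) = (\<Sum>b\<in>Basis. (a y \<bullet> b) *\<^sub>R T y b)" if "y \<in> W" for y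
  proof -
    have "T y (a y) = T y (\<Sum>b\<in>Basis. (a y \<bullet> b) *\<^sub>R b)" by (simp add: euclidean_representation)
    then show ?thesis using assms(2)[OF that] by (simp add: linear_sum linear_cmul)
  qed
  show ?thesis
    by (simp only: smooth_on_cong[OF assms(1) ex])
      (intro smooth_on_sum smooth_on_scaleR smooth_on_inner smooth_on_const assms)
qed

lemma
  fixes T :: "'a::euclidean_space \<Rightarrow> 'b::euclidean_space \<Rightarrow> 'd::euclidean_space \<Rightarrow> 'c::real_normed_vector"
  assumes "open W" "x \<in> W" "\<And>y. y \<in> W \<Longrightarrow> bilinear (T y)"
    and "\<And>b d. (\<lambda>y. T y b d) differentiable (at x)" "a differentiable (at x)" "e differentiable (at x)"
  shows differentiable_bilinear_app: "(\<lambda>y. T y (a y) (e y)) differentiable (at x)"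
    and dd_bilinear_app: "dd (\<lambda>y. T y (a y) (e y)) x u
      = dd (\<lambda>y. T y (a x) (e x)) x u + T x (dd a x u) (e x) + T x (a x) (dd e x u)"
proof -
  have l1: "linear (\<lambda>b. T y b d)" and l2: "linear (T y b)" if "y \<in> W" for y b d
    using assms(3)[OF that] by (simp_all add: bilinear_def)
  have da: "(\<lambda>y. T y (a y) d) differentiable (at x)" for d
    by (rule differentiable_linear_app[OF assms(1,2) l1 assms(4,5)])
  show "(\<lambda>y. T y (a y) (e y)) differentiable (at x)"
    by (rule differentiable_linear_app[OF assms(1,2) l2 da assms(6)])
  have "dd (\<lambda>y. T y (a y) (e y)) x u = dd (\<lambda>y. T y (a y) (e x)) x u + T x (a x) (dd e x u)"
    by (rule dd_linear_app[OF assms(1,2) l2 da assms(6)])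
  moreover have "dd (\<lambda>y. T y (a y) (e x)) x u = dd (\<lambda>y. T y (a x) (e x)) x u + T x (dd a x u) (e x)"
    by (rule dd_linear_app[OF assms(1,2) l1 assms(4,5)])
  ultimately show "dd (\<lambda>y. T y (a y) (e y)) x u
      = dd (\<lambda>y. T y (a x) (e x)) x u + T x (dd a x u) (e x) + T x (a x) (dd e x u)" by simp
qed

lemma smooth_on_bilinear_app:
  fixes T :: "'a::euclidean_space \<Rightarrow> 'b::euclidean_space \<Rightarrow> 'd::euclidean_space \<Rightarrow> 'c::real_normed_vector"
  assumes "open W" "\<And>y. y \<in> W \<Longrightarrow> bilinear (T y)"
    and "\<And>b d. smooth_on W (\<lambda>y. T y b d)" "smooth_on W a" "smooth_on W e"
  shows "smooth_on W (\<lambda>y. T y (a y) (e y))"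
proof -
  have l1: "linear (\<lambda>b. T y b d)" and l2: "linear (T y b)" if "y \<in> W" for y b d
    using assms(2)[OF that] by (simp_all add: bilinear_def)
  have "smooth_on W (\<lambda>y. T y (a y) d)" for d
    by (rule smooth_on_linear_app[OF assms(1) l1 assms(3,4)])
  from smooth_on_linear_app[OF assms(1) l2 this assms(5)] show ?thesis .
qed

section \<open>Levi-Civita connections in a moving frame\<close>

text \<open>A bundle isomorphism \<open>\<psi>\<close> from the tangent bundle to a trivial bundle carrying a metric \<open>m\<close>
  and a metric connection \<open>d + \<omega>\<close>; the vanishing of the torsion \<open>(d + \<omega>)\<psi>\<close> says that \<open>\<psi>\<close> carries
  the Levi-Civita connection of the pulled back metric \<open>G\<close> to \<open>d + \<omega>\<close>. The inverse of \<open>\<psi>\<close> is \<open>\<theta>\<close>.\<close>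

locale moving_frame =
  fixes W :: "'a::euclidean_space set"
    and \<psi> :: "'a \<Rightarrow> 'a \<Rightarrow> 'b::euclidean_space" and \<theta> :: "'a \<Rightarrow> 'b \<Rightarrow> 'a"
    and m :: "'a \<Rightarrow> 'b \<Rightarrow> 'b \<Rightarrow> real" and \<omega> :: "'a \<Rightarrow> 'a \<Rightarrow> 'b \<Rightarrow> 'b"
    and G :: "'a \<Rightarrow> 'a \<Rightarrow> 'a \<Rightarrow> real"
  assumes open_W: "open W"
    and lin_psi: "x \<in> W \<Longrightarrow> linear (\<psi> x)"
    and psi_theta: "x \<in> W \<Longrightarrow> \<psi> x (\<theta> x b) = b"
    and theta_psi: "x \<in> W \<Longrightarrow> \<theta> x (\<psi> x v) = v"
    and psi_differentiable: "x \<in> W \<Longrightarrow> (\<lambda>y. \<psi> y v) differentiable (at x)"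
    and bil_m: "x \<in> W \<Longrightarrow> bilinear (m x)"
    and m_sym: "x \<in> W \<Longrightarrow> m x a b = m x b a"
    and m_pos: "x \<in> W \<Longrightarrow> a \<noteq> 0 \<Longrightarrow> m x a a > 0"
    and m_differentiable: "x \<in> W \<Longrightarrow> (\<lambda>y. m y a b) differentiable (at x)"
    and bil_omega: "x \<in> W \<Longrightarrow> bilinear (\<omega> x)"
    and compat: "x \<in> W \<Longrightarrow> dd (\<lambda>y. m y a b) x u = m x (\<omega> x u a) b + m x a (\<omega> x u b)"
    and torsion_free: "x \<in> W \<Longrightarrow>
      dd (\<lambda>y. \<psi> y v) x u + \<omega> x u (\<psi> x v) = dd (\<lambda>y. \<psi> y u) x v + \<omega> x v (\<psi> x u)"
    and G_eq: "x \<in> W \<Longrightarrow> G x u v = m x (\<psi> x u) (\<psi> x v)"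
begin

text \<open>The connection d + \<omega> transported to the tangent bundle by \<psi>, evaluated on
  constant fields.\<close>

definition nab :: "'a \<Rightarrow> 'a \<Rightarrow> 'a \<Rightarrow> 'a" where
  "nab x u v = \<theta> x (dd (\<lambda>y. \<psi> y v) x u + \<omega> x u (\<psi> x v))"

text \<open>The curvature form d\<omega> + \<omega> \<and> \<omega> on constant fields
  \<open>u\<close>, \<open>v\<close>.\<close>

definition frame_curv :: "'a \<Rightarrow> 'a \<Rightarrow> 'a \<Rightarrow> 'b \<Rightarrow> 'b" where
  "frame_curv x u v a = dd (\<lambda>y. \<omega> y v a) x u - dd (\<lambda>y. \<omega> y u a) x v
     + \<omega> x u (\<omega> x v a) - \<omega> x v (\<omega> x u a)"

lemma psi_nab: "x \<in> W \<Longrightarrow> \<psi> x (nab x u v) = dd (\<lambda>y. \<psi> y v) x u + \<omega> x u (\<psi> x v)"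
  by (simp add: nab_def psi_theta)

lemma psi_inj: "x \<in> W \<Longrightarrow> \<psi> x u = \<psi> x v \<Longrightarrow> u = v"
  by (metis theta_psi)

lemma nab_sym: "x \<in> W \<Longrightarrow> nab x u v = nab x v u"
  by (simp add: nab_def torsion_free)

lemma lin_theta: "x \<in> W \<Longrightarrow> linear (\<theta> x)"
proof (rule linearI)
  fix a b r assume x: "x \<in> W"
  show "\<theta> x (a + b) = \<theta> x a + \<theta> x b" "\<theta> x (r *\<^sub>R a) = r *\<^sub>R \<theta> x a"
    using linear_add[OF lin_psi[OF x]] linear_cmul[OF lin_psi[OF x]] psi_theta[OF x]
    by (metis psi_inj x)+
qed

lemma nab_linear: "x \<in> W \<Longrightarrow> linear (nab x u)"
proof -
  assume x: "x \<in> W"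
  have e: "dd (\<lambda>y. \<psi> y (v + w)) x u = dd (\<lambda>y. \<psi> y v) x u + dd (\<lambda>y. \<psi> y w) x u" for v w
  proof -
    have "dd (\<lambda>y. \<psi> y (v + w)) x u = dd (\<lambda>y. \<psi> y v + \<psi> y w) x u"
      by (rule dd_cong_open[OF open_W x]) (simp add: linear_add[OF lin_psi])
    then show ?thesis by (simp add: dd_add psi_differentiable x)
  qed
  have s: "dd (\<lambda>y. \<psi> y (r *\<^sub>R v)) x u = r *\<^sub>R dd (\<lambda>y. \<psi> y v) x u" for v r
  proof -
    have "dd (\<lambda>y. \<psi> y (r *\<^sub>R v)) x u = dd (\<lambda>y. r *\<^sub>R \<psi> y v) x u"
      by (rule dd_cong_open[OF open_W x]) (simp add: linear_cmul[OF lin_psi])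
    then show ?thesis
      using dd_bounded_linear[OF bounded_linear_scaleR_right psi_differentiable[OF x]] by simp
  qed
  show "linear (nab x u)"
  proof (rule linearI)
    fix v w r
    show "nab x u (v + w) = nab x u v + nab x u w"
      unfolding nab_def e linear_add[OF lin_psi[OF x]] bilinear_radd[OF bil_omega[OF x]]
        linear_add[OF lin_theta[OF x]] by (simp add: algebra_simps)
    show "nab x u (r *\<^sub>R v) = r *\<^sub>R nab x u v"
      unfolding nab_def s linear_cmul[OF lin_psi[OF x]] bilinear_rmul[OF bil_omega[OF x]]
        linear_cmul[OF lin_theta[OF x], symmetric] by (simp add: scaleR_add_right)
  qed
qed

lemma bilinear_G: "x \<in> W \<Longrightarrow> bilinear (G x)"
  using bil_m[of x] lin_psi[of x]
  unfolding bilinear_def by (simp add: G_eq linear_iff)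

lemma G_sym: "x \<in> W \<Longrightarrow> G x u v = G x v u"
  by (simp add: G_eq m_sym)

lemma G_pos: "x \<in> W \<Longrightarrow> u \<noteq> 0 \<Longrightarrow> G x u u > 0"
  by (metis G_eq m_pos psi_inj lin_psi linear_0)

lemma G_differentiable: "x \<in> W \<Longrightarrow> (\<lambda>y. G y v w) differentiable (at x)"
proof -
  assume x: "x \<in> W"
  have "(\<lambda>y. m y (\<psi> y v) (\<psi> y w)) differentiable (at x)"
    by (rule differentiable_bilinear_app[OF open_W x bil_m m_differentiable[OF x]
          psi_differentiable[OF x] psi_differentiable[OF x]])
  then show ?thesis by (simp only: differentiable_cong_open[OF open_W x G_eq])
qed

lemma dd_G:
  assumes x: "x \<in> W"
  shows "dd (\<lambda>y. G y v w) x u = G x (nab x u v) w + G x v (nab x u w)"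
proof -
  have "dd (\<lambda>y. G y v w) x u = dd (\<lambda>y. m y (\<psi> y v) (\<psi> y w)) x u"
    by (rule dd_cong_open[OF open_W x G_eq])
  also have "\<dots> = dd (\<lambda>y. m y (\<psi> x v) (\<psi> x w)) x u
      + m x (dd (\<lambda>y. \<psi> y v) x u) (\<psi> x w) + m x (\<psi> x v) (dd (\<lambda>y. \<psi> y w) x u)"
    by (rule dd_bilinear_app[OF open_W x bil_m m_differentiable psi_differentiable psi_differentiable])
      (simp_all add: x)
  also have "\<dots> = G x (nab x u v) w + G x v (nab x u w)"
    using bil_m[OF x] x by (simp add: compat G_eq psi_nab bilinear_ladd bilinear_radd)
  finally show ?thesis .
qed

text \<open>Being symmetric and metric, \<open>nab\<close> satisfies the Koszul formula; since
  \<open>G\<close> is definite, the solution is unique, and the \<open>THE\<close> in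
  \<open>christoffel\<close> denotes it.\<close>

lemma christoffel_eq:
  assumes x: "x \<in> W"
  shows "christoffel G x u v = nab x u v"
proof -
  have b: "bilinear (G x)" by (rule bilinear_G[OF x])
  have k: "2 * G x (nab x u v) w = dd (\<lambda>y. G y v w) x u + dd (\<lambda>y. G y u w) x v - dd (\<lambda>y. G y u v) x w" for w
    using nab_sym[OF x, of v u] nab_sym[OF x, of w v] nab_sym[OF x, of w u]
      G_sym[OF x, of "nab x u w" v]
    by (simp add: dd_G[OF x])
  show ?thesis unfolding christoffel_def
  proof (rule the_equality)
    show "\<forall>w. 2 * G x (nab x u v) w = dd (\<lambda>y. G y v w) x u + dd (\<lambda>y. G y u w) x v - dd (\<lambda>y. G y u v) x w"
      using k by blast
  next
    fix z assume "\<forall>w. 2 * G x z w = dd (\<lambda>y. G y v w) x u + dd (\<lambda>y. G y u w) x v - dd (\<lambda>y. G y u v) x w"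
    then have "2 * G x z w = 2 * G x (nab x u v) w" for w using k[of w] by metis
    then have "G x z w = G x (nab x u v) w" for w by simp
    then have "G x (z - nab x u v) (z - nab x u v) = 0" by (simp add: bilinear_lsub[OF b])
    then show "z = nab x u v" using G_pos[OF x, of "z - nab x u v"] by force
  qed
qed

end

locale smooth_moving_frame = moving_frame +
  assumes psi_smooth: "smooth_on W (\<lambda>y. \<psi> y v)"
    and omega_smooth: "smooth_on W (\<lambda>y. \<omega> y u a)"
    and theta_smooth: "smooth_on W (\<lambda>y. \<theta> y b)"
begin

lemma nab_smooth: "smooth_on W (\<lambda>y. nab y u v)"
proof -
  have lo: "linear (\<omega> y u)" if "y \<in> W" for y
    using bil_omega[OF that] by (simp add: bilinear_def)
  show ?thesis unfolding nab_def
    by (intro smooth_on_linear_app[OF open_W lin_theta theta_smooth] smooth_on_add open_W smooth_on_dd psi_smooth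
        smooth_on_linear_app[OF open_W lo omega_smooth])
qed

lemma dd_psi_app:
  assumes x: "x \<in> W" and a: "a differentiable (at x)"
  shows "dd (\<lambda>y. \<psi> y (a y)) x u = dd (\<lambda>y. \<psi> y (a x)) x u + \<psi> x (dd a x u)"
  by (rule dd_linear_app[OF open_W x lin_psi psi_differentiable a]) (simp_all add: x)

lemma psi_nab_nab:
  assumes x: "x \<in> W"
  shows "\<psi> x (dd (\<lambda>y. nab y v w) x u + nab x u (nab x v w))
    = dd (\<lambda>y. dd (\<lambda>y. \<psi> y w) y v) x u + dd (\<lambda>y. \<omega> y v (\<psi> x w)) x u
      + \<omega> x v (dd (\<lambda>y. \<psi> y w) x u) + \<omega> x u (dd (\<lambda>y. \<psi> y w) x v) + \<omega> x u (\<omega> x v (\<psi> x w))"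
proof -
  have lo: "linear (\<omega> y v)" if "y \<in> W" for y
    using bil_omega[OF that] by (simp add: bilinear_def)
  have om: "(\<lambda>y. \<omega> y v b) differentiable (at x)" for b
    by (rule smooth_on_differentiable[OF omega_smooth x])
  have ps: "(\<lambda>y. \<psi> y w) differentiable (at x)" by (rule psi_differentiable[OF x])
  have nd: "(\<lambda>y. nab y v w) differentiable (at x)"
    by (rule smooth_on_differentiable[OF nab_smooth x])
  have "dd (\<lambda>y. \<psi> y (nab x v w)) x u + \<psi> x (dd (\<lambda>y. nab y v w) x u) = dd (\<lambda>y. \<psi> y (nab y v w)) x u"
    by (rule dd_psi_app[OF x nd, symmetric])
  also have "\<dots> = dd (\<lambda>y. dd (\<lambda>y. \<psi> y w) y v + \<omega> y v (\<psi> y w)) x u"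
    by (rule dd_cong_open[OF open_W x psi_nab])
  also have "\<dots> = dd (\<lambda>y. dd (\<lambda>y. \<psi> y w) y v) x u + dd (\<lambda>y. \<omega> y v (\<psi> y w)) x u"
    by (intro dd_add smooth_on_differentiable[OF smooth_on_dd[OF psi_smooth] x]
        differentiable_linear_app[OF open_W x lo om ps])
  also have "dd (\<lambda>y. \<omega> y v (\<psi> y w)) x u = dd (\<lambda>y. \<omega> y v (\<psi> x w)) x u + \<omega> x v (dd (\<lambda>y. \<psi> y w) x u)"
    by (rule dd_linear_app[OF open_W x lo om ps])
  finally show ?thesis
    using linear_add[OF lin_psi[OF x]] psi_nab[OF x] bilinear_radd[OF bil_omega[OF x]]
    by (simp add: algebra_simps)
qed

text \<open>On antisymmetrizing \<open>psi_nab_nab\<close> in \<open>u\<close>, \<open>v\<close>,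
  the second derivative of \<psi> drops out by symmetry and the two terms with one factor \<omega>
  and one factor d\<psi> are exchanged, so only d\<omega> and \<omega>\<omega> survive. The bracket
  of constant fields is zero.\<close>

lemma psi_curvature:
  assumes x: "x \<in> W"
  shows "\<psi> x (curvature G x u v w) = frame_curv x u v (\<psi> x w)"
proof -
  have lc: "levi_civita G (\<lambda>_. a) (\<lambda>_. b) y = nab y a b" if "y \<in> W" for a b y
    by (simp add: levi_civita_def christoffel_eq[OF that])
  have lc2: "levi_civita G (\<lambda>_. a) (levi_civita G (\<lambda>_. b) (\<lambda>_. w)) x
      = dd (\<lambda>y. nab y b w) x a + nab x a (nab x b w)" for a b
    using dd_cong_open[OF open_W x lc] lc[OF x]
    by (simp add: levi_civita_def[of G "\<lambda>_. a" "levi_civita G (\<lambda>_. b) (\<lambda>_. w)"] christoffel_eq[OF x])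
  have n0: "nab x 0 w = 0"
    using linear_0[OF nab_linear[OF x]] nab_sym[OF x] by metis
  have "curvature G x u v w = (dd (\<lambda>y. nab y v w) x u + nab x u (nab x v w))
      - (dd (\<lambda>y. nab y u w) x v + nab x v (nab x u w))"
    by (simp add: curvature_def curvature_operator_def lc2 lie_bracket_def)
      (simp add: levi_civita_def christoffel_eq[OF x] n0)
  then have "\<psi> x (curvature G x u v w) = \<psi> x (dd (\<lambda>y. nab y v w) x u + nab x u (nab x v w))
      - \<psi> x (dd (\<lambda>y. nab y u w) x v + nab x v (nab x u w))"
    by (simp only: linear_diff[OF lin_psi[OF x]])
  also have "\<dots> = frame_curv x u v (\<psi> x w)"
    unfolding psi_nab_nab[OF x] frame_curv_def
    using dd_commute[OF open_W x psi_smooth, of w v u] by (simp add: algebra_simps)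
  finally show ?thesis .
qed

text \<open>Differentiate the compatibility of m and \<omega> once more and antisymmetrize: second
  derivatives of m commute, and the products of two first order terms form a symmetric sum.\<close>

lemma frame_curv_skew:
  assumes x: "x \<in> W" and m_smooth: "\<And>a b. smooth_on W (\<lambda>y. m y a b)"
  shows "m x (frame_curv x u v a) b + m x a (frame_curv x u v b) = 0"
proof -
  have sec: "dd (\<lambda>y. dd (\<lambda>y. m y a b) y v) x u
    = m x (\<omega> x u (\<omega> x v a)) b + m x (\<omega> x v a) (\<omega> x u b) + m x (dd (\<lambda>y. \<omega> y v a) x u) b
    + (m x (\<omega> x u a) (\<omega> x v b) + m x a (\<omega> x u (\<omega> x v b)) + m x a (dd (\<lambda>y. \<omega> y v b) x u))" for u v
  proof -
    have om: "(\<lambda>y. \<omega> y v b) differentiable (at x)" for b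
      by (rule smooth_on_differentiable[OF omega_smooth x])
    have mm: "\<And>b d. (\<lambda>y. m y b d) differentiable (at x)" by (rule m_differentiable[OF x])
    have "dd (\<lambda>y. dd (\<lambda>y. m y a b) y v) x u = dd (\<lambda>y. m y (\<omega> y v a) b + m y a (\<omega> y v b)) x u"
      by (rule dd_cong_open[OF open_W x compat])
    also have "\<dots> = dd (\<lambda>y. m y (\<omega> y v a) b) x u + dd (\<lambda>y. m y a (\<omega> y v b)) x u"
      by (intro dd_add differentiable_bilinear_app[OF open_W x bil_m mm] om differentiable_const)
    also have "dd (\<lambda>y. m y (\<omega> y v a) b) x u
        = dd (\<lambda>y. m y (\<omega> x v a) b) x u + m x (dd (\<lambda>y. \<omega> y v a) x u) b"
      using dd_bilinear_app[OF open_W x bil_m mm om differentiable_const] bilinear_rzero[OF bil_m[OF x]]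
      by simp
    also have "dd (\<lambda>y. m y a (\<omega> y v b)) x u
        = dd (\<lambda>y. m y a (\<omega> x v b)) x u + m x a (dd (\<lambda>y. \<omega> y v b) x u)"
      using dd_bilinear_app[OF open_W x bil_m mm differentiable_const om] bilinear_lzero[OF bil_m[OF x]]
      by simp
    finally show ?thesis by (simp add: compat[OF x])
  qed
  have "dd (\<lambda>y. dd (\<lambda>y. m y a b) y v) x u = dd (\<lambda>y. dd (\<lambda>y. m y a b) y u) x v"
    by (rule dd_commute[OF open_W x m_smooth])
  then show ?thesis
    unfolding sec frame_curv_def
    using bil_m[OF x] by (simp add: bilinear_ladd bilinear_radd bilinear_lsub bilinear_rsub)
qed

end

text \<open>As \<open>I\<close> is constant and commutes with \<open>\<omega>\<close>, the structure \<open>J\<close> is parallel.\<close>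

locale complex_moving_frame = smooth_moving_frame +
  fixes I :: "'b \<Rightarrow> 'b" and J :: "'a \<Rightarrow> 'a \<Rightarrow> 'a"
  assumes lin_I: "linear I" and I_I: "I (I b) = - b"
    and omega_I: "x \<in> W \<Longrightarrow> \<omega> x u (I b) = I (\<omega> x u b)"
    and m_I: "x \<in> W \<Longrightarrow> m x (I a) (I b) = m x a b"
    and psi_J: "x \<in> W \<Longrightarrow> \<psi> x (J x u) = I (\<psi> x u)"
begin

lemma J_J: "x \<in> W \<Longrightarrow> J x (J x u) = - u"
  by (rule psi_inj[of x]) (simp_all add: psi_J I_I linear_neg[OF lin_psi])

lemma lin_J: "x \<in> W \<Longrightarrow> linear (J x)"
proof (rule linearI)
  fix u v r assume x: "x \<in> W"
  show "J x (u + v) = J x u + J x v" "J x (r *\<^sub>R u) = r *\<^sub>R J x u"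
    by (rule psi_inj[OF x], simp add: psi_J[OF x] linear_add[OF lin_psi[OF x]] linear_cmul[OF lin_psi[OF x]]
        linear_add[OF lin_I] linear_cmul[OF lin_I])+
qed

lemma G_J: "x \<in> W \<Longrightarrow> G x (J x u) (J x v) = G x u v"
  by (simp add: G_eq psi_J m_I)

lemma J_eq: "x \<in> W \<Longrightarrow> J x u = \<theta> x (I (\<psi> x u))"
  by (metis psi_J theta_psi)

lemma J_smooth: "smooth_on W (\<lambda>y. J y u)"
  by (simp only: smooth_on_cong[OF open_W J_eq])
    (intro smooth_on_linear_app[OF open_W lin_theta theta_smooth] smooth_on_linear[OF open_W lin_I] psi_smooth)

text \<open>Differentiating \<psi> J = I \<psi>, with I passing through \<omega>, gives \<nabla>J =
  0, here solved for the coordinate derivative of J.\<close>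

lemma dd_J:
  assumes x: "x \<in> W"
  shows "dd (\<lambda>y. J y v) x u = J x (nab x u v) - nab x u (J x v)"
proof (rule psi_inj[OF x])
  have "dd (\<lambda>y. \<psi> y (J x v)) x u + \<psi> x (dd (\<lambda>y. J y v) x u) = dd (\<lambda>y. \<psi> y (J y v)) x u"
    by (rule dd_psi_app[OF x smooth_on_differentiable[OF J_smooth x], symmetric])
  also have "\<dots> = dd (\<lambda>y. I (\<psi> y v)) x u"
    by (rule dd_cong_open[OF open_W x psi_J])
  also have "\<dots> = I (dd (\<lambda>y. \<psi> y v) x u)"
    using lin_I by (intro dd_bounded_linear psi_differentiable[OF x]) (simp add: linear_conv_bounded_linear)
  finally show "\<psi> x (dd (\<lambda>y. J y v) x u) = \<psi> x (J x (nab x u v) - nab x u (J x v))"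
    by (simp add: linear_diff[OF lin_psi[OF x]] psi_J[OF x] psi_nab[OF x] linear_add[OF lin_I] omega_I[OF x]
        algebra_simps)
qed

text \<open>Once the derivatives of J are expressed by \<open>dd_J\<close>, every bracket becomes a
  difference of covariant derivatives; these cancel in pairs by symmetry of \<open>nab\<close> and J
  J = - 1.\<close>

lemma nijenhuis_zero:
  assumes x: "x \<in> W"
  shows "nijenhuis J x u v = 0"
proof -
  note l = linear_add[OF lin_J[OF x]] linear_diff[OF lin_J[OF x]] linear_neg[OF lin_J[OF x]]
  show ?thesis
    using nab_sym[OF x, of "J x v" u] nab_sym[OF x, of "J x u" v] nab_sym[OF x, of u v]
      nab_sym[OF x, of "J x u" "J x v"]
    by (simp add: nijenhuis_def lie_bracket_def dd_J[OF x] l J_J[OF x] linear_0[OF lin_J[OF x]])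
qed

text \<open>The form is parallel, so each derivative has its two terms with \<open>nab\<close> in
  one slot; in the cyclic sum they cancel because \<open>nab\<close> is symmetric.\<close>

lemma fundamental_form_closed:
  assumes x: "x \<in> W"
  shows "dd (\<lambda>y. G y v (J y w)) x u + dd (\<lambda>y. G y w (J y u)) x v + dd (\<lambda>y. G y u (J y v)) x w = 0"
proof -
  have sk: "G x a (J x b) = - G x (J x a) b" for a b
    using G_J[OF x, of a "J x b"] bilinear_rneg[OF bilinear_G[OF x]] by (simp add: J_J[OF x])
  have d: "dd (\<lambda>y. G y a (J y b)) x c = G x (nab x c a) (J x b) - G x (nab x c b) (J x a)" for a b c
  proof -
    have "dd (\<lambda>y. G y a (J y b)) x c
        = dd (\<lambda>y. G y a (J x b)) x c + G x 0 (J x b) + G x a (dd (\<lambda>y. J y b) x c)"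
      using dd_bilinear_app[OF open_W x bilinear_G G_differentiable[OF x] differentiable_const
        smooth_on_differentiable[OF J_smooth x], where u=c] by simp
    also have "\<dots> = G x (nab x c a) (J x b) + G x a (J x (nab x c b))"
      using bilinear_G[OF x] by (simp add: dd_G[OF x] dd_J[OF x] bilinear_rsub bilinear_lzero)
    finally show ?thesis using sk G_sym[OF x, of "J x a"] by simp
  qed
  show ?thesis unfolding d
    using nab_sym[OF x, of v u] nab_sym[OF x, of w v] nab_sym[OF x, of w u] by simp
qed

end

section \<open>The base manifold\<close>

text \<open>Polarizing \<open>sec\<close> in the inner and afterwards in the outer arguments makes
  \<open>Q\<close> skew also in the outer pair and, by pair symmetry, in the middle pair. The three
  terms of the Bianchi identity then coincide, so 3 Q = 0.\<close>

lemma curvature_like_zero: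
  fixes Q :: "'a::ab_group_add \<Rightarrow> 'a \<Rightarrow> 'a \<Rightarrow> 'a \<Rightarrow> real"
  assumes add2: "\<And>u v v' w z. Q u (v + v') w z = Q u v w z + Q u v' w z"
    and skew1: "\<And>u v w z. Q v u w z = - Q u v w z"
    and skew2: "\<And>u v w z. Q u v z w = - Q u v w z"
    and add3: "\<And>u v w w' z. Q u v (w + w') z = Q u v w z + Q u v w' z"
    and bianchi: "\<And>u v w z. Q u v w z + Q v w u z + Q w u v z = 0"
    and sec: "\<And>u v. Q u v v u = 0"
  shows "Q u v w z = 0"
proof -
  \<comment> \<open>The octahedron argument: combine the Bianchi identities for the four cyclic
    shifts of the arguments.\<close>
  have pair: "Q u v w z = Q w z u v" for u v w z
    using bianchi[of u v w z] bianchi[of v w z u] bianchi[of w z u v] bianchi[of z u v w]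
      skew2[of u v w z] skew2[of v w u z] skew1[of u w z v] skew2[of w u v z] skew2[of w z u v]
      skew1[of z v w u] skew2[of v z u w] skew2[of z u w v]
    by linarith
  have add1: "Q (u + u') v w z = Q u v w z + Q u' v w z" for u u' v w z
    using skew1[of "u + u'" v w z] add2[of v u u' w z] skew1[of u v w z] skew1[of u' v w z] by linarith
  have add4: "Q u v w (z + z') = Q u v w z + Q u v w z'" for u v w z z'
    using skew2[of u v w "z + z'"] add3[of u v z z' w] skew2[of u v w z] skew2[of u v w z'] by linarith
  have polar: "Q u v w u = 0" for u v w
  proof -
    have "Q u (v + w) (v + w) u = Q u v v u + Q u w v u + (Q u v w u + Q u w w u)"
      by (simp only: add2 add3)
    then have "Q u v w u + Q u w v u = 0"
      using sec[of u "v + w"] sec[of u v] sec[of u w] by linarith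
    moreover have "Q u w v u = Q u v w u"
      using pair[of u w v u] skew1[of u v u w] skew2[of u v w u] skew1[of v u u w] by linarith
    ultimately show ?thesis by linarith
  qed
  have tot: "Q z v w u = - Q u v w z" for u v w z
  proof -
    have "Q (u + z) v w (u + z) = Q u v w u + Q z v w u + (Q u v w z + Q z v w z)"
      by (simp only: add1 add4)
    then show ?thesis using polar[of "u + z" v w] polar[of u v w] polar[of z v w] by linarith
  qed
  have swap: "Q v w u z = - Q v u w z" for u v w z
    using tot[of v u w z] pair[of z u w v] skew1[of v w z u] skew2[of v w u z] by linarith
  show ?thesis
    using bianchi[of u v w z] swap[of v w u z] skew1[of v u w z] swap[of w u v z] skew1[of w v u z]
    by linarith
qed

lemma smooth_on_vec:
  fixes f :: "'a::euclidean_space \<Rightarrow> real^'n"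
  assumes "open S" "\<And>i. smooth_on S (\<lambda>x. f x $ i)"
  shows "smooth_on S f"
proof -
  have "f x = (\<Sum>i\<in>UNIV. f x $ i *\<^sub>R axis i 1)" for x
    by (simp add: basis_expansion flip: scalar_mult_eq_scaleR)
  then have "f = (\<lambda>x. \<Sum>i\<in>UNIV. f x $ i *\<^sub>R axis i 1)" by blast
  moreover have "smooth_on S (\<lambda>x. \<Sum>i\<in>UNIV. f x $ i *\<^sub>R (axis i 1 :: real^'n))"
    by (intro smooth_on_sum smooth_on_scaleR smooth_on_const assms)
  ultimately show ?thesis by metis
qed

lemma smooth_on_det:
  fixes A :: "'a::euclidean_space \<Rightarrow> real^'n^'n"
  assumes "open S" "\<And>i j. smooth_on S (\<lambda>x. A x $ i $ j)"
  shows "smooth_on S (\<lambda>x. det (A x))"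
  unfolding det_def
  by (intro smooth_on_sum smooth_on_mult smooth_on_prod smooth_on_const assms)

section \<open>A Riemannian metric in one chart and its Levi-Civita connection\<close>

locale metric_chart =
  fixes U :: "(real^'n) set" and g :: "real^'n \<Rightarrow> real^'n \<Rightarrow> real^'n \<Rightarrow> real"
  assumes open_U: "open U"
    and bil_g: "q \<in> U \<Longrightarrow> bilinear (g q)"
    and g_sym: "q \<in> U \<Longrightarrow> g q u v = g q v u"
    and g_pos: "q \<in> U \<Longrightarrow> u \<noteq> 0 \<Longrightarrow> g q u u > 0"
    and g_smooth: "smooth_on U (\<lambda>q. g q u v)"
begin

lemma g_simps:
  assumes "q \<in> U"
  shows "g q (u + v) w = g q u w + g q v w" "g q w (u + v) = g q w u + g q w v"
    "g q (u - v) w = g q u w - g q v w" "g q w (u - v) = g q w u - g q w v"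
    "g q (r *\<^sub>R u) w = r * g q u w" "g q w (r *\<^sub>R u) = r * g q w u"
    "g q (- u) w = - g q u w" "g q w (- u) = - g q w u"
    "g q 0 w = 0" "g q w 0 = 0"
  using bil_g[OF assms]
  by (simp_all add: bilinear_ladd bilinear_radd bilinear_lsub bilinear_rsub bilinear_lmul bilinear_rmul
      bilinear_lneg bilinear_rneg bilinear_lzero bilinear_rzero)

lemma g_eqI:
  assumes q: "q \<in> U" and "\<And>w. g q u w = g q v w"
  shows "u = v"
  using assms(2)[of "u - v"] g_pos[OF q, of "u - v"] by (force simp: g_simps[OF q])

lemma g_expand: "q \<in> U \<Longrightarrow> g q u v = (\<Sum>i\<in>UNIV. v $ i * g q u (axis i 1))"
proof -
  assume q: "q \<in> U"
  have l: "linear (g q u)" using bil_g[OF q] by (simp add: bilinear_def)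
  have "v = (\<Sum>i\<in>UNIV. v $ i *\<^sub>R axis i 1)"
    by (simp add: basis_expansion flip: scalar_mult_eq_scaleR)
  then have "g q u v = g q u (\<Sum>i\<in>UNIV. v $ i *\<^sub>R axis i 1)" by simp
  then show ?thesis by (simp add: linear_sum[OF l] linear_cmul[OF l])
qed

lemma metric_lower_mult: "q \<in> U \<Longrightarrow> (metric_lower g q *v v) \<bullet> w = g q v w"
proof -
  assume q: "q \<in> U"
  have "(metric_lower g q *v v) $ i = g q (axis i 1) v" for i
    using g_expand[OF q, of "axis i 1" v]
    by (simp add: metric_lower_def matrix_vector_mult_def mult.commute)
  then show ?thesis
    using g_expand[OF q, of v w] g_sym[OF q, of v] by (simp add: inner_vec_def mult.commute)
qed

lemma det_metric_lower: "q \<in> U \<Longrightarrow> det (metric_lower g q) \<noteq> 0"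
proof -
  assume q: "q \<in> U"
  have "v = 0" if "metric_lower g q *v v = 0" for v
    using metric_lower_mult[OF q, of v v] g_pos[OF q, of v] that by force
  then have "invertible (metric_lower g q)"
    using matrix_left_invertible_ker invertible_left_inverse by blast
  then show ?thesis using invertible_det_nz by blast
qed

definition sharp :: "real^'n \<Rightarrow> real^'n \<Rightarrow> real^'n" where
  "sharp q a = metric_upper g q *v a"

lemma metric_lower_sharp: "q \<in> U \<Longrightarrow> metric_lower g q *v sharp q a = a"
proof -
  assume "q \<in> U"
  then have "invertible (metric_lower g q)" using det_metric_lower invertible_det_nz by blast
  then have "metric_lower g q ** metric_upper g q = mat 1"
    unfolding invertible_def metric_upper_def matrix_inv_def by (rule someI2_ex) blast
  then show ?thesis by (simp add: sharp_def matrix_vector_mul_assoc)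
qed

lemma g_sharp: "q \<in> U \<Longrightarrow> g q (sharp q a) w = a \<bullet> w"
  using metric_lower_mult[of q "sharp q a" w] by (simp add: metric_lower_sharp)

lemma sharp_eqI: "q \<in> U \<Longrightarrow> (\<And>w. g q u w = a \<bullet> w) \<Longrightarrow> u = sharp q a"
  by (metis g_eqI g_sharp)

lemma linear_sharp: "linear (sharp q)"
  unfolding sharp_def by (rule matrix_vector_mul_linear)

text \<open>By Cramer's rule the components are quotients of determinants, hence rational in the
  coefficients of the metric.\<close>

lemma sharp_smooth: "smooth_on U (\<lambda>q. sharp q a)"
proof (rule smooth_on_vec[OF open_U])
  fix k
  have e: "sharp q a $ k = det (\<chi> i j. if j = k then a $ i else metric_lower g q $ i $ j) / det (metric_lower g q)"
    if "q \<in> U" for q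
    using cramer[OF det_metric_lower[OF that], of "sharp q a" a] metric_lower_sharp[OF that] by simp
  have "smooth_on U (\<lambda>q. (\<chi> i j. if j = k then a $ i else metric_lower g q $ i $ j) $ i $ j)" for i j
    by (cases "j = k") (simp_all add: smooth_on_const metric_lower_def g_smooth)
  moreover have "smooth_on U (\<lambda>q. metric_lower g q $ i $ j)" for i j
    by (simp add: metric_lower_def g_smooth)
  ultimately have "smooth_on U (\<lambda>q. det (\<chi> i j. if j = k then a $ i else metric_lower g q $ i $ j) / det (metric_lower g q))"
    by (intro smooth_on_divide smooth_on_det open_U det_metric_lower)
  then show "smooth_on U (\<lambda>q. sharp q a $ k)" by (simp only: smooth_on_cong[OF open_U e])
qed

lemma g_differentiable: "q \<in> U \<Longrightarrow> (\<lambda>y. g y u v) differentiable (at q)"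
  by (rule smooth_on_differentiable[OF g_smooth])

lemma dd_g_linear:
  assumes q: "q \<in> U"
  shows "dd (\<lambda>y. g y (u + u') v) q w = dd (\<lambda>y. g y u v) q w + dd (\<lambda>y. g y u' v) q w"
    "dd (\<lambda>y. g y v (u + u')) q w = dd (\<lambda>y. g y v u) q w + dd (\<lambda>y. g y v u') q w"
    "dd (\<lambda>y. g y (r *\<^sub>R u) v) q w = r * dd (\<lambda>y. g y u v) q w"
    "dd (\<lambda>y. g y v (r *\<^sub>R u)) q w = r * dd (\<lambda>y. g y v u) q w"
proof -
  have "dd (\<lambda>y. g y (u + u') v) q w = dd (\<lambda>y. g y u v + g y u' v) q w"
    "dd (\<lambda>y. g y v (u + u')) q w = dd (\<lambda>y. g y v u + g y v u') q w"
    "dd (\<lambda>y. g y (r *\<^sub>R u) v) q w = dd (\<lambda>y. r * g y u v) q w"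
    "dd (\<lambda>y. g y v (r *\<^sub>R u)) q w = dd (\<lambda>y. r * g y v u) q w"
    by (rule dd_cong_open[OF open_U q], simp add: g_simps)+
  then show "dd (\<lambda>y. g y (u + u') v) q w = dd (\<lambda>y. g y u v) q w + dd (\<lambda>y. g y u' v) q w"
    "dd (\<lambda>y. g y v (u + u')) q w = dd (\<lambda>y. g y v u) q w + dd (\<lambda>y. g y v u') q w"
    "dd (\<lambda>y. g y (r *\<^sub>R u) v) q w = r * dd (\<lambda>y. g y u v) q w"
    "dd (\<lambda>y. g y v (r *\<^sub>R u)) q w = r * dd (\<lambda>y. g y v u) q w"
    using dd_mult[OF differentiable_const g_differentiable[OF q]]
    by (simp_all add: dd_add g_differentiable[OF q])
qed

definition koszul :: "real^'n \<Rightarrow> real^'n \<Rightarrow> real^'n \<Rightarrow> real^'n \<Rightarrow> real" where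
  "koszul q u v w = dd (\<lambda>y. g y v w) q u + dd (\<lambda>y. g y u w) q v - dd (\<lambda>y. g y u v) q w"

lemma koszul_linear:
  assumes q: "q \<in> U"
  shows "koszul q u v (w + w') = koszul q u v w + koszul q u v w'"
    "koszul q u v (r *\<^sub>R w) = r * koszul q u v w"
    "koszul q u (v + v') w = koszul q u v w + koszul q u v' w"
    "koszul q u (r *\<^sub>R v) w = r * koszul q u v w"
  by (simp_all add: koszul_def dd_g_linear[OF q] dd_linear[OF g_differentiable[OF q]] algebra_simps)

lemma koszul_sym: "q \<in> U \<Longrightarrow> koszul q u v w = koszul q v u w"
  using dd_cong_open[OF open_U, of q "\<lambda>y. g y u v" "\<lambda>y. g y v u" w] g_sym by (simp add: koszul_def)

text \<open>The Koszul expression is linear in \<open>w\<close> and thus represented by a vector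
  through \<open>sharp\<close>. This shows that the \<open>THE\<close> in \<open>christoffel\<close>
  is attained and yields a formula from which smoothness can be read off.\<close>

lemma
  assumes q: "q \<in> U"
  shows christoffel_sharp: "christoffel g q u v = sharp q (\<chi> i. koszul q u v (axis i 1) / 2)"
    and g_christoffel: "2 * g q (christoffel g q u v) w = koszul q u v w"
proof -
  define Z where "Z = sharp q (\<chi> i. koszul q u v (axis i 1) / 2)"
  have lk: "linear (koszul q u v)" by (rule linearI) (simp_all add: koszul_linear[OF q])
  have Z: "2 * g q Z w = koszul q u v w" for w
  proof -
    have "koszul q u v w = koszul q u v (\<Sum>i\<in>UNIV. w $ i *\<^sub>R axis i 1)"
      by (simp add: basis_expansion flip: scalar_mult_eq_scaleR)
    also have "\<dots> = (\<Sum>i\<in>UNIV. w $ i * koszul q u v (axis i 1))"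
      by (simp add: linear_sum[OF lk] linear_cmul[OF lk])
    finally show ?thesis
      by (simp add: Z_def g_sharp[OF q] inner_vec_def sum_distrib_left mult.commute)
  qed
  have C: "christoffel g q u v = Z" unfolding christoffel_def
  proof (rule the_equality)
    show "\<forall>w. 2 * g q Z w = dd (\<lambda>y. g y v w) q u + dd (\<lambda>y. g y u w) q v - dd (\<lambda>y. g y u v) q w"
      using Z by (simp only: koszul_def) simp
    fix z assume "\<forall>w. 2 * g q z w = dd (\<lambda>y. g y v w) q u + dd (\<lambda>y. g y u w) q v - dd (\<lambda>y. g y u v) q w"
    then have "2 * g q z w = 2 * g q Z w" for w unfolding Z koszul_def by blast
    then show "z = Z" using g_eqI[OF q] by simp
  qed
  show "christoffel g q u v = sharp q (\<chi> i. koszul q u v (axis i 1) / 2)" using C by (simp only: Z_def)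
  show "2 * g q (christoffel g q u v) w = koszul q u v w" unfolding C by (rule Z)
qed

lemma christoffel_sym: "q \<in> U \<Longrightarrow> christoffel g q u v = christoffel g q v u"
  by (simp add: christoffel_sharp koszul_sym)

lemma bil_christoffel: "q \<in> U \<Longrightarrow> bilinear (christoffel g q)"
proof -
  assume q: "q \<in> U"
  have "linear (christoffel g q u)" for u
  proof (rule linearI)
    fix v v' r
    have "2 * g q (christoffel g q u (v + v')) w = 2 * g q (christoffel g q u v + christoffel g q u v') w" for w
      unfolding g_simps[OF q] distrib_left g_christoffel[OF q] koszul_linear[OF q] ..
    then show "christoffel g q u (v + v') = christoffel g q u v + christoffel g q u v'"
      by (intro g_eqI[OF q]) simp
    have "2 * g q (christoffel g q u (r *\<^sub>R v)) w = 2 * g q (r *\<^sub>R christoffel g q u v) w" for w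
      unfolding g_simps[OF q] mult.left_commute[of 2] g_christoffel[OF q] koszul_linear[OF q] ..
    then show "christoffel g q u (r *\<^sub>R v) = r *\<^sub>R christoffel g q u v"
      by (intro g_eqI[OF q]) simp
  qed
  then show ?thesis
    unfolding bilinear_def using christoffel_sym[OF q] by (simp add: linear_iff)
qed

lemma christoffel_smooth: "smooth_on U (\<lambda>q. christoffel g q u v)"
proof -
  have "smooth_on U (\<lambda>q. koszul q u v w / 2)" for w
    unfolding koszul_def
    by (intro smooth_on_divide smooth_on_add smooth_on_diff smooth_on_dd g_smooth smooth_on_const open_U) simp
  then have "smooth_on U (\<lambda>q. \<chi> i. koszul q u v (axis i 1) / 2)"
    by (intro smooth_on_vec[OF open_U]) simp
  then have "smooth_on U (\<lambda>q. sharp q (\<chi> i. koszul q u v (axis i 1) / 2))"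
    by (rule smooth_on_linear_app[OF open_U linear_sharp sharp_smooth])
  then show ?thesis by (simp only: smooth_on_cong[OF open_U christoffel_sharp])
qed

lemma dd_g: "q \<in> U \<Longrightarrow>
  dd (\<lambda>y. g y a b) q u = g q (christoffel g q u a) b + g q a (christoffel g q u b)"
proof -
  assume q: "q \<in> U"
  have "dd (\<lambda>y. g y b a) q u = dd (\<lambda>y. g y a b) q u"
    by (rule dd_cong_open[OF open_U q g_sym])
  then have "koszul q u a b + koszul q u b a = 2 * dd (\<lambda>y. g y a b) q u"
    by (simp add: koszul_def)
  then show ?thesis
    using g_christoffel[OF q, of u a b] g_christoffel[OF q, of u b a] g_sym[OF q, of a] by simp
qed

text \<open>The trivial frame \<psi> = id with the Christoffel symbols as connection form: the
  general results on \<open>frame_curv\<close> then speak about the curvature of the base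
  itself.\<close>

sublocale base: smooth_moving_frame U "\<lambda>_ v. v" "\<lambda>_ b. b" g "christoffel g" g
proof
  show "dd (\<lambda>y. v) x u + christoffel g x u v = dd (\<lambda>y. u) x v + christoffel g x v u"
    if "x \<in> U" for x u v
    by (simp add: christoffel_sym[OF that])
qed (auto simp: open_U bil_g g_pos g_sym g_differentiable bil_christoffel dd_g smooth_on_const
    christoffel_smooth linear_ident)

lemma bianchi: "q \<in> U \<Longrightarrow> base.frame_curv q u v w + base.frame_curv q v w u + base.frame_curv q w u v = 0"
proof -
  assume q: "q \<in> U"
  have "dd (\<lambda>y. christoffel g y a b) q e = dd (\<lambda>y. christoffel g y b a) q e" for a b e
    by (rule dd_cong_open[OF open_U q christoffel_sym])
  note d = this[of u v w] this[of v w u] this[of w u v]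
  have "christoffel g q a b = christoffel g q b a" for a b
    by (rule christoffel_sym[OF q])
  note s = this[of u v] this[of v w] this[of w u]
  show ?thesis unfolding base.frame_curv_def d s by simp
qed

lemma frame_curv_add:
  assumes q: "q \<in> U"
  shows "base.frame_curv q u (v + v') w = base.frame_curv q u v w + base.frame_curv q u v' w"
    "base.frame_curv q u v (w + w') = base.frame_curv q u v w + base.frame_curv q u v w'"
proof -
  have cd: "(\<lambda>y. christoffel g y a b) differentiable (at q)" for a b
    by (rule smooth_on_differentiable[OF christoffel_smooth q])
  have "dd (\<lambda>y. christoffel g y (a + b) e) q u = dd (\<lambda>y. christoffel g y a e + christoffel g y b e) q u" for a b e u
    by (rule dd_cong_open[OF open_U q]) (simp add: bilinear_ladd[OF bil_christoffel])
  then have 1: "dd (\<lambda>y. christoffel g y (a + b) e) q u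
      = dd (\<lambda>y. christoffel g y a e) q u + dd (\<lambda>y. christoffel g y b e) q u" for a b e u
    by (simp add: dd_add cd)
  have "dd (\<lambda>y. christoffel g y e (a + b)) q u = dd (\<lambda>y. christoffel g y e a + christoffel g y e b) q u" for a b e u
    by (rule dd_cong_open[OF open_U q]) (simp add: bilinear_radd[OF bil_christoffel])
  then have 2: "dd (\<lambda>y. christoffel g y e (a + b)) q u
      = dd (\<lambda>y. christoffel g y e a) q u + dd (\<lambda>y. christoffel g y e b) q u" for a b e u
    by (simp add: dd_add cd)
  note l = bilinear_ladd[OF bil_christoffel[OF q]] bilinear_radd[OF bil_christoffel[OF q]]
  show "base.frame_curv q u (v + v') w = base.frame_curv q u v w + base.frame_curv q u v' w"
    by (simp add: base.frame_curv_def 1 l dd_linear[OF cd])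
  show "base.frame_curv q u v (w + w') = base.frame_curv q u v w + base.frame_curv q u v w'"
    by (simp add: base.frame_curv_def 2 l)
qed

text \<open>The Gram determinant is |v|^2 times the squared length of the component \<open>w\<close>
  of \<open>u\<close> orthogonal to \<open>v\<close>. It is the denominator of the sectional
  curvature.\<close>

lemma gram_pos:
  assumes q: "q \<in> U" and uv: "u \<noteq> v" "independent {u, v}"
  shows "g q u u * g q v v - (g q u v)\<^sup>2 > 0"
proof -
  have v: "v \<noteq> 0" using uv dependent_zero by (metis insertCI)
  have nu: "u \<notin> span {v}" using uv by (simp add: independent_insert)
  have vv: "g q v v > 0" using g_pos[OF q v] .
  define w where "w = u - (g q u v / g q v v) *\<^sub>R v"
  have "w \<noteq> 0"
  proof
    assume "w = 0"
    then have "u = (g q u v / g q v v) *\<^sub>R v" by (simp add: w_def)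
    then show False using nu span_mul[OF span_base, of v "{v}"] by (metis singletonI)
  qed
  then have "g q w w > 0" by (rule g_pos[OF q])
  also have "g q w w = (g q u u * g q v v - (g q u v)\<^sup>2) / g q v v"
    using vv g_sym[OF q, of v u] by (simp add: w_def g_simps[OF q] field_simps power2_eq_square)
  finally show ?thesis using vv by (simp add: zero_less_divide_iff)
qed

end

section \<open>The curvature tensor of a metric of constant curvature\<close>

locale constant_curvature_chart = metric_chart +
  fixes c :: real
  assumes sectional: "q \<in> U \<Longrightarrow> u \<noteq> v \<Longrightarrow> independent {u, v} \<Longrightarrow> sectional_curvature g q u v = c"
begin

text \<open>The difference \<open>Q\<close> from the model tensor has all symmetries of a curvature
  tensor. It vanishes on independent pairs by the hypothesis on sectional curvatures and on
  dependent pairs by skewness, so \<open>curvature_like_zero\<close> applies.\<close>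

lemma frame_curv_eq:
  assumes q: "q \<in> U"
  shows "base.frame_curv q u v w = c *\<^sub>R (g q v w *\<^sub>R u - g q u w *\<^sub>R v)"
proof -
  define Q where "Q = (\<lambda>u v w z. g q (base.frame_curv q u v w) z - c * (g q v w * g q u z - g q u w * g q v z))"
  have curv: "base.frame_curv q u v w = curvature g q u v w" for u v w
    using base.psi_curvature[OF q] by simp
  have sk1: "base.frame_curv q v u w = - base.frame_curv q u v w" for u v w
    by (simp add: base.frame_curv_def)
  have sk2: "g q (base.frame_curv q u v w) z = - g q (base.frame_curv q u v z) w" for u v w z
    using base.frame_curv_skew[OF q g_smooth, of u v w z] g_sym[OF q, of w] by simp
  have "Q u v w z = 0" for w z
  proof (rule curvature_like_zero[of Q])
    fix u v
    show "Q u v v u = 0"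
    proof (cases "u \<noteq> v \<and> independent {u, v}")
      case True
      then show ?thesis
        using sectional[OF q, of u v] gram_pos[OF q, of u v] g_sym[OF q, of v u]
        by (simp add: Q_def sectional_curvature_def curv[symmetric] field_simps power2_eq_square)
    next
      case False
      have sym0: "base.frame_curv q u u w = 0" for u w by (simp add: base.frame_curv_def)
      \<comment> \<open>The value r = 1 covers \<open>u = v\<close>, where \<open>{u, v}\<close> is
        a singleton that may well be independent.\<close>
      consider "v = 0" | r where "u = r *\<^sub>R v"
        using False that(2)[of 1] by (cases "u = v") (auto simp: independent_insert span_singleton)
      then show ?thesis
      proof cases
        case 1
        then have "base.frame_curv q u v v = 0"
          using frame_curv_add(1)[OF q, of u v v v] by simp
        then show ?thesis using 1 by (simp add: Q_def g_simps[OF q])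
      next
        case 2
        have "g q (base.frame_curv q u v v) u = r * g q (base.frame_curv q u v v) v"
          by (simp add: 2 g_simps[OF q])
        also have "g q (base.frame_curv q u v v) v = 0" using sk2[of u v v v] by simp
        finally show ?thesis by (simp add: Q_def 2 g_simps[OF q])
      qed
    qed
  next
    fix u v w z
    show "Q u v w z + Q v w u z + Q w u v z = 0"
    proof -
      have "g q (base.frame_curv q u v w + base.frame_curv q v w u + base.frame_curv q w u v) z = 0"
        by (simp add: bianchi[OF q] g_simps[OF q])
      then show ?thesis
        using g_sym[OF q, of v u] g_sym[OF q, of w u] g_sym[OF q, of w v]
        by (simp add: Q_def g_simps[OF q] algebra_simps)
    qed
    show "Q u v z w = - Q u v w z"
      using sk2[of u v z w] by (simp add: Q_def algebra_simps)
    show "Q v u w z = - Q u v w z"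
      unfolding Q_def sk1[of v u w] g_simps[OF q] by (simp add: algebra_simps)
  qed (simp_all add: Q_def frame_curv_add[OF q] g_simps[OF q] algebra_simps)
  then show ?thesis
    by (intro g_eqI[OF q]) (simp add: Q_def g_simps[OF q])
qed

end

section \<open>The quadric gauge\<close>

context metric_chart
begin

text \<open>The torsion of \<alpha> with all derivatives replaced by letters: \<open>x\<close>,
  \<open>t\<close> stand for the projection and \<tau> of one vector, \<open>y\<close>,
  \<open>r\<close> for those of the other, \<open>H\<close> for the Christoffel term of
  \<open>x\<close> and \<open>y\<close>, \<open>n\<close> for 1/N and \<open>dn\<close> for its
  derivative. Tested against \<open>w\<close>, it is a polynomial identity modulo the relation for
  \<open>n\<close>.\<close>

lemma torsion_algebra:
  assumes q: "q \<in> U" and n: "n * (1 + c * g q S S) = 1" and K: "K = 2 * c * n"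
  assumes "al = (\<lambda>x. x - (K * g q S x) *\<^sub>R S)"
    and "dn = (\<lambda>t. - (n * n * (2 * c * g q S t)))"
    and "E = (\<lambda>x t y r. H - ((2 * c * dn t * g q S y + K * (g q t y + g q S H)) *\<^sub>R S + (K * g q S y) *\<^sub>R t)
      + K *\<^sub>R (g q t (al y) *\<^sub>R S - g q S (al y) *\<^sub>R t) - (K * g q S x) *\<^sub>R ((2 * n) *\<^sub>R r))"
  shows "E x t y r = E y r x t"
proof (rule g_eqI[OF q])
  fix w
  have s: "g q t S = g q S t" "g q r S = g q S r" by (rule g_sym[OF q])+
  show "g q (E x t y r) w = g q (E y r x t) w"
    unfolding assms(4-6) g_simps[OF q] s K using n by algebra
qed

text \<open>The same device for the curvature acting on a pair \<open>a\<close>, \<open>b\<close>.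
  \<open>R\<close> and \<open>T\<close> are the second covariant derivative of \<open>a\<close> and
  the derivative of \<tau>, known only up to antisymmetrization; \<open>A\<close>, \<open>B\<close>
  and \<open>A'\<close>, \<open>B'\<close> are the Christoffel terms of \<open>a\<close>,
  \<open>b\<close> in the two directions, which must cancel.\<close>

lemma curvature_algebra:
  assumes q: "q \<in> U" and n: "n * (1 + c * g q S S) = 1" and K: "K = 2 * c * n"
  assumes "al = (\<lambda>x. x - (K * g q S x) *\<^sub>R S)"
    and "dn = (\<lambda>t. - (n * n * (2 * c * g q S t)))"
    and "Om = (\<lambda>t w. K *\<^sub>R (g q t w *\<^sub>R S - g q S w *\<^sub>R t))"
    and "E = (\<lambda>x t y r R T A B A' B'. R
      + (((2 * c * dn t * g q r a + K * (g q T a + g q r A)) *\<^sub>R S + (K * g q r a) *\<^sub>R t)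
         - ((2 * c * dn t * g q S a + K * (g q t a + g q S A)) *\<^sub>R r + (K * g q S a) *\<^sub>R T))
      - ((2 * c * dn t * g q S y + K * (g q t y + g q S H)) *\<^sub>R b + (K * g q S y) *\<^sub>R B)
      + Om t (A' + Om r a - (K * g q S y) *\<^sub>R b)
      - (K * g q S x) *\<^sub>R (B' + Om r b + (K * g q S y) *\<^sub>R a))"
    and R: "R1 - R2 = c *\<^sub>R (g q y a *\<^sub>R x - g q x a *\<^sub>R y)"
    and T: "T1 - T2 = c *\<^sub>R (g q y S *\<^sub>R x - g q x S *\<^sub>R y)"
  shows "E x t y r R1 T1 A1 B1 A2 B2 - E y r x t R2 T2 A2 B2 A1 B1
    = c *\<^sub>R (g q (al y) a *\<^sub>R al x - g q (al x) a *\<^sub>R al y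
        + g q ((2 * n) *\<^sub>R r) a *\<^sub>R ((2 * n) *\<^sub>R t) - g q ((2 * n) *\<^sub>R t) a *\<^sub>R ((2 * n) *\<^sub>R r))
      + (c * (g q (al x) ((2 * n) *\<^sub>R r) - g q (al y) ((2 * n) *\<^sub>R t))) *\<^sub>R b"
proof (rule g_eqI[OF q])
  fix w
  have s: "g q t S = g q S t" "g q r S = g q S r" "g q x S = g q S x" "g q y S = g q S y"
    "g q r t = g q t r" "g q t x = g q x t" "g q t y = g q y t" "g q r x = g q x r" "g q r y = g q y r"
    by (rule g_sym[OF q])+
  have R': "R1 = R2 + c *\<^sub>R (g q y a *\<^sub>R x - g q x a *\<^sub>R y)" using R by (simp add: algebra_simps)
  have T': "T1 = T2 + c *\<^sub>R (g q y S *\<^sub>R x - g q x S *\<^sub>R y)" using T by (simp add: algebra_simps)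
  show "g q (E x t y r R1 T1 A1 B1 A2 B2 - E y r x t R2 T2 A2 B2 A1 B1) w
    = g q (c *\<^sub>R (g q (al y) a *\<^sub>R al x - g q (al x) a *\<^sub>R al y
        + g q ((2 * n) *\<^sub>R r) a *\<^sub>R ((2 * n) *\<^sub>R t) - g q ((2 * n) *\<^sub>R t) a *\<^sub>R ((2 * n) *\<^sub>R r))
      + (c * (g q (al x) ((2 * n) *\<^sub>R r) - g q (al y) ((2 * n) *\<^sub>R t))) *\<^sub>R b) w"
    unfolding assms(4-7) g_simps[OF q] R' T' s K using n by algebra
qed

section \<open>Vector fields of the base along the projection\<close>

abbreviation W :: "((real^'n) \<times> (real^'n)) set" where "W \<equiv> U \<times> UNIV"

lemma open_W: "open W"
  by (simp add: open_Times open_U)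

lemma fst_W: "z \<in> W \<Longrightarrow> fst z \<in> U"
  by auto

lemma gW_smooth: "smooth_on W (\<lambda>z. g (fst z) a b)"
  by (rule smooth_on_compose_fst[OF open_U g_smooth])

lemma christoffelW_smooth: "smooth_on W (\<lambda>z. christoffel g (fst z) a b)"
  by (rule smooth_on_compose_fst[OF open_U christoffel_smooth])

lemma dd_compose_fst:
  assumes "f differentiable (at (fst z))"
  shows "dd (\<lambda>z. f (fst z)) z u = dd f (fst z) (fst u)"
proof -
  have "(fst has_derivative fst) (at z)" by (intro bounded_linear_imp_has_derivative bounded_linear_fst)
  then show ?thesis
    using dd_compose[of f fst z u, OF assms] by (metis dd_eqI differentiableI)
qed

lemma g_app_smooth: "smooth_on W a \<Longrightarrow> smooth_on W b \<Longrightarrow> smooth_on W (\<lambda>z. g (fst z) (a z) (b z))"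
  by (rule smooth_on_bilinear_app[OF open_W bil_g[OF fst_W] gW_smooth])

lemma christoffel_app_smooth:
  "smooth_on W a \<Longrightarrow> smooth_on W b \<Longrightarrow> smooth_on W (\<lambda>z. christoffel g (fst z) (a z) (b z))"
  by (rule smooth_on_bilinear_app[OF open_W bil_christoffel[OF fst_W] christoffelW_smooth])

text \<open>Covariant derivative of vector fields on the base along the projection of the cotangent
  bundle.\<close>

definition Dv :: "((real^'n) \<times> (real^'n) \<Rightarrow> real^'n) \<Rightarrow> (real^'n) \<times> (real^'n) \<Rightarrow> (real^'n) \<times> (real^'n) \<Rightarrow> real^'n" where
  "Dv a z u = dd a z u + christoffel g (fst z) (fst u) (a z)"

lemma Dv_smooth: "smooth_on W a \<Longrightarrow> smooth_on W (\<lambda>z. Dv a z u)"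
  unfolding Dv_def
  by (intro smooth_on_add open_W smooth_on_dd christoffel_app_smooth smooth_on_const)

lemma Dv_linear:
  assumes z: "z \<in> W" and a: "a differentiable (at z)"
  shows "Dv a z (u + v) = Dv a z u + Dv a z v" "Dv a z (r *\<^sub>R u) = r *\<^sub>R Dv a z u"
  using bil_christoffel[OF fst_W[OF z]]
  by (simp_all add: Dv_def dd_linear[OF a] bilinear_ladd bilinear_lmul scaleR_add_right)

lemma Dv_const: "Dv (\<lambda>_. a) z u = christoffel g (fst z) (fst u) a"
  by (simp add: Dv_def)

lemma Dv_add:
  assumes z: "z \<in> W" and "a differentiable (at z)" "b differentiable (at z)"
  shows "Dv (\<lambda>y. a y + b y) z u = Dv a z u + Dv b z u"
  using bil_christoffel[OF fst_W[OF z]] by (simp add: Dv_def dd_add assms bilinear_radd)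

lemma Dv_diff:
  assumes z: "z \<in> W" and "a differentiable (at z)" "b differentiable (at z)"
  shows "Dv (\<lambda>y. a y - b y) z u = Dv a z u - Dv b z u"
  using bil_christoffel[OF fst_W[OF z]] by (simp add: Dv_def dd_diff assms bilinear_rsub)

lemma Dv_scaleR:
  assumes z: "z \<in> W" and "r differentiable (at z)" "a differentiable (at z)"
  shows "Dv (\<lambda>y. r y *\<^sub>R a y) z u = dd r z u *\<^sub>R a z + r z *\<^sub>R Dv a z u"
  using bil_christoffel[OF fst_W[OF z]]
  by (simp add: Dv_def dd_scaleR[OF assms(2,3)] bilinear_rmul scaleR_add_right)

lemma dd_gW: "z \<in> W \<Longrightarrow> dd (\<lambda>y. g (fst y) a b) z u
    = g (fst z) (christoffel g (fst z) (fst u) a) b + g (fst z) a (christoffel g (fst z) (fst u) b)"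
  using dd_compose_fst[OF g_differentiable[OF fst_W]] by (simp add: dd_g fst_W)

lemma dd_g_app:
  assumes z: "z \<in> W" and a: "a differentiable (at z)" and b: "b differentiable (at z)"
  shows "dd (\<lambda>y. g (fst y) (a y) (b y)) z u = g (fst z) (Dv a z u) (b z) + g (fst z) (a z) (Dv b z u)"
proof -
  have "dd (\<lambda>y. g (fst y) (a y) (b y)) z u = dd (\<lambda>y. g (fst y) (a z) (b z)) z u
      + g (fst z) (dd a z u) (b z) + g (fst z) (a z) (dd b z u)"
    by (rule dd_bilinear_app[OF open_W z bil_g[OF fst_W] smooth_on_differentiable[OF gW_smooth z] a b])
  then show ?thesis
    by (simp add: dd_gW[OF z] Dv_def g_simps[OF fst_W[OF z]])
qed

text \<open>The Ricci identity for the pulled back connection. The Christoffel symbols depend on the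
  base point only, so the curvature sees nothing but the projections of \<open>u\<close> and
  \<open>v\<close>.\<close>

lemma Dv_Dv:
  assumes z: "z \<in> W" and a: "smooth_on W a"
  shows "Dv (\<lambda>y. Dv a y v) z u - Dv (\<lambda>y. Dv a y u) z v = base.frame_curv (fst z) (fst u) (fst v) (a z)"
proof -
  have da: "a differentiable (at z)" by (rule smooth_on_differentiable[OF a z])
  have lo: "linear (christoffel g (fst y) v)" if "y \<in> W" for y v
    using bil_christoffel[OF fst_W[OF that]] by (simp add: bilinear_def)
  have cd: "(\<lambda>y. christoffel g (fst y) v b) differentiable (at z)" for v b
    by (rule smooth_on_differentiable[OF christoffelW_smooth z])
  have "Dv (\<lambda>y. Dv a y v) z u = dd (\<lambda>y. dd a y v) z u + dd (\<lambda>q. christoffel g q (fst v) (a z)) (fst z) (fst u)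
      + christoffel g (fst z) (fst v) (dd a z u)
      + christoffel g (fst z) (fst u) (dd a z v + christoffel g (fst z) (fst v) (a z))" for u v
  proof -
    have "dd (\<lambda>y. Dv a y v) z u = dd (\<lambda>y. dd a y v) z u + dd (\<lambda>y. christoffel g (fst y) (fst v) (a y)) z u"
      unfolding Dv_def
      by (intro dd_add smooth_on_differentiable[OF smooth_on_dd[OF a] z]
          differentiable_linear_app[OF open_W z lo cd da])
    also have "dd (\<lambda>y. christoffel g (fst y) (fst v) (a y)) z u
      = dd (\<lambda>y. christoffel g (fst y) (fst v) (a z)) z u + christoffel g (fst z) (fst v) (dd a z u)"
      by (rule dd_linear_app[OF open_W z lo cd da])
    also have "dd (\<lambda>y. christoffel g (fst y) (fst v) (a z)) z u
      = dd (\<lambda>q. christoffel g q (fst v) (a z)) (fst z) (fst u)"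
      by (rule dd_compose_fst[OF smooth_on_differentiable[OF christoffel_smooth fst_W[OF z]]])
    finally show ?thesis
      unfolding Dv_def[of "\<lambda>y. Dv a y v" z u] by (simp add: Dv_def[of a z v])
  qed
  note this[of v u] this[of u v]
  then show ?thesis
    using dd_commute[OF open_W z a, of v u] bilinear_radd[OF bil_christoffel[OF fst_W[OF z]]]
    by (simp add: base.frame_curv_def)
qed

end

section \<open>The metric connection defined by a field S\<close>

locale quadric_field = constant_curvature_chart U g c
  for U :: "(real^'n) set" and g and c +
  fixes S :: "(real^'n) \<times> (real^'n) \<Rightarrow> real^'n"
  assumes S_smooth: "smooth_on (U \<times> UNIV) S"
    and N_nz: "z \<in> U \<times> UNIV \<Longrightarrow> 1 + c * g (fst z) (S z) (S z) \<noteq> 0"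
begin

text \<open>\<open>nn\<close> is 1/N and \<open>kap\<close> is 2c/N. As scalars tied to S by the
  single relation \<open>nn_N\<close> they keep the later identities polynomial.\<close>

definition nn where "nn z = inverse (1 + c * g (fst z) (S z) (S z))"
definition kap where "kap z = 2 * c * nn z"
definition tau where "tau z v = Dv S z v"
definition alpha where "alpha z v = fst v - (kap z * g (fst z) (S z) (fst v)) *\<^sub>R S z"
definition beta where "beta z v = (2 * nn z) *\<^sub>R tau z v"
definition Om where
  "Om z v a = kap z *\<^sub>R (g (fst z) (tau z v) a *\<^sub>R S z - g (fst z) (S z) a *\<^sub>R tau z v)"
definition th where "th z v = kap z * g (fst z) (S z) (fst v)"
definition conn where
  "conn z v ab =
    (christoffel g (fst z) (fst v) (fst ab) + Om z v (fst ab) - th z v *\<^sub>R snd ab,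
     christoffel g (fst z) (fst v) (snd ab) + Om z v (snd ab) + th z v *\<^sub>R fst ab)"
definition psi where "psi z v = (alpha z v, beta z v)"
definition mm where
  "mm k z ab ab' = k * (g (fst z) (fst ab) (fst ab') + g (fst z) (snd ab) (snd ab'))"

lemma nn_N: "z \<in> W \<Longrightarrow> nn z * (1 + c * g (fst z) (S z) (S z)) = 1"
  using N_nz[of z] by (simp add: nn_def)

lemma nn_smooth: "smooth_on W nn"
  unfolding nn_def
  by (intro smooth_on_inverse smooth_on_add smooth_on_mult smooth_on_const g_app_smooth S_smooth open_W N_nz)

lemma kap_smooth: "smooth_on W kap"
  unfolding kap_def by (intro smooth_on_mult smooth_on_const nn_smooth open_W)

lemma tau_smooth: "smooth_on W (\<lambda>z. tau z v)"
  unfolding tau_def by (rule Dv_smooth[OF S_smooth])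

lemma alpha_smooth: "smooth_on W (\<lambda>z. alpha z v)"
  unfolding alpha_def
  by (intro smooth_on_diff smooth_on_scaleR smooth_on_mult smooth_on_const g_app_smooth S_smooth open_W kap_smooth)

lemma beta_smooth: "smooth_on W (\<lambda>z. beta z v)"
  unfolding beta_def
  by (intro smooth_on_scaleR smooth_on_mult smooth_on_const nn_smooth tau_smooth open_W)

lemma Om_smooth: "smooth_on W (\<lambda>z. Om z v a)"
  unfolding Om_def
  by (intro smooth_on_diff smooth_on_scaleR smooth_on_const g_app_smooth S_smooth open_W kap_smooth tau_smooth)

lemma th_smooth: "smooth_on W (\<lambda>z. th z v)"
  unfolding th_def
  by (intro smooth_on_mult smooth_on_const g_app_smooth S_smooth open_W kap_smooth)

lemma psi_smooth: "smooth_on W (\<lambda>z. psi z v)"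
  unfolding psi_def by (intro smooth_on_Pair alpha_smooth beta_smooth open_W)

lemma conn_smooth: "smooth_on W (\<lambda>z. conn z v ab)"
  unfolding conn_def
  by (intro smooth_on_Pair smooth_on_add smooth_on_diff christoffelW_smooth Om_smooth smooth_on_scaleR
      th_smooth smooth_on_const open_W)

lemmas sd = smooth_on_differentiable

lemma tau_linear:
  assumes z: "z \<in> W"
  shows "tau z (u + v) = tau z u + tau z v" "tau z (r *\<^sub>R u) = r *\<^sub>R tau z u"
  by (simp_all add: tau_def Dv_linear[OF z sd[OF S_smooth z]])

lemma psi_linear: "z \<in> W \<Longrightarrow> linear (psi z)"
proof -
  assume z: "z \<in> W"
  show ?thesis
    by (rule linearI)
      (simp_all add: psi_def alpha_def beta_def tau_linear[OF z] g_simps[OF fst_W[OF z]] algebra_simps)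
qed

lemma Om_linear:
  assumes z: "z \<in> W"
  shows "Om z (u + v) a = Om z u a + Om z v a" "Om z (r *\<^sub>R u) a = r *\<^sub>R Om z u a"
    "Om z u (a + b) = Om z u a + Om z u b" "Om z u (r *\<^sub>R a) = r *\<^sub>R Om z u a" "Om z u (- a) = - Om z u a"
  by (simp_all add: Om_def tau_linear[OF z] g_simps[OF fst_W[OF z]] algebra_simps)

lemma th_linear:
  assumes z: "z \<in> W"
  shows "th z (u + v) = th z u + th z v" "th z (r *\<^sub>R u) = r * th z u"
  by (simp_all add: th_def g_simps[OF fst_W[OF z]] algebra_simps)

lemma conn_bilinear: "z \<in> W \<Longrightarrow> bilinear (conn z)"
proof -
  assume z: "z \<in> W"
  note l = bil_christoffel[OF fst_W[OF z]]
  note simps = bilinear_ladd[OF l] bilinear_radd[OF l] bilinear_lmul[OF l] bilinear_rmul[OF l] Om_linear[OF z] th_linear[OF z]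
  show ?thesis
    unfolding bilinear_def
    by (intro conjI allI linearI) (simp_all add: conn_def simps algebra_simps)
qed

lemma mm_bilinear: "z \<in> W \<Longrightarrow> bilinear (mm k z)"
proof -
  assume z: "z \<in> W"
  show ?thesis
    unfolding bilinear_def
    by (intro conjI allI linearI) (simp_all add: mm_def g_simps[OF fst_W[OF z]] algebra_simps)
qed

lemma mm_smooth: "smooth_on W (\<lambda>z. mm k z a b)"
  unfolding mm_def by (intro smooth_on_mult smooth_on_add smooth_on_const gW_smooth open_W)

text \<open>\<open>Om\<close> is skew as a multiple of a wedge product, and the terms with
  \<open>th\<close> rotate the pair, so both leave the fibre metric unchanged; the derivative of
  \<open>g\<close> is absorbed by the Christoffel symbols.\<close>

lemma mm_compat:
  assumes z: "z \<in> W"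
  shows "dd (\<lambda>y. mm k y a b) z u = mm k z (conn z u a) b + mm k z a (conn z u b)"
proof -
  note gd = sd[OF gW_smooth z]
  have "dd (\<lambda>y. mm k y a b) z u
      = k * (dd (\<lambda>y. g (fst y) (fst a) (fst b)) z u + dd (\<lambda>y. g (fst y) (snd a) (snd b)) z u)"
    unfolding mm_def
    using dd_mult[OF differentiable_const differentiable_add[OF gd gd]] dd_add[OF gd gd]
    by simp
  moreover have "g (fst z) (Om z u v) w = - g (fst z) v (Om z u w)" for v w
    using g_sym[OF fst_W[OF z], of "S z" w] g_sym[OF fst_W[OF z], of "tau z u" w]
      g_sym[OF fst_W[OF z], of "S z" v] g_sym[OF fst_W[OF z], of "tau z u" v]
    by (simp add: Om_def g_simps[OF fst_W[OF z]] algebra_simps)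
  ultimately show ?thesis
    by (simp add: mm_def conn_def dd_gW[OF z] g_simps[OF fst_W[OF z]] algebra_simps)
qed

lemma dd_nn:
  assumes z: "z \<in> W"
  shows "dd nn z u = - (nn z * nn z * (2 * c * g (fst z) (S z) (tau z u)))"
proof -
  have Sd: "S differentiable (at z)" by (rule sd[OF S_smooth z])
  have gd: "(\<lambda>y. g (fst y) (S y) (S y)) differentiable (at z)"
    by (rule sd[OF g_app_smooth[OF S_smooth S_smooth] z])
  have Nd: "(\<lambda>y. 1 + c * g (fst y) (S y) (S y)) differentiable (at z)"
    by (intro differentiable_add differentiable_mult differentiable_const gd)
  have "dd (\<lambda>y. 1 + c * g (fst y) (S y) (S y)) z u = c * dd (\<lambda>y. g (fst y) (S y) (S y)) z u"
    using dd_add[OF differentiable_const differentiable_mult[OF differentiable_const gd]]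
      dd_mult[OF differentiable_const gd] by simp
  also have "\<dots> = 2 * c * g (fst z) (S z) (tau z u)"
    using g_sym[OF fst_W[OF z], of "tau z u"] by (simp add: dd_g_app[OF z Sd Sd] flip: tau_def)
  finally have N: "dd (\<lambda>y. 1 + c * g (fst y) (S y) (S y)) z u = 2 * c * g (fst z) (S z) (tau z u)" .
  have "dd nn z u = - (nn z * dd (\<lambda>y. 1 + c * g (fst y) (S y) (S y)) z u * nn z)"
    unfolding nn_def
    by (rule dd_eqI[OF Deriv.has_derivative_inverse[OF N_nz[OF z] differentiable_has_dd[OF Nd]]])
  then show ?thesis by (simp add: N)
qed

lemma dd_kap: "z \<in> W \<Longrightarrow> dd kap z u = 2 * c * dd nn z u"
  unfolding kap_def using dd_mult[OF differentiable_const sd[OF nn_smooth]] by simp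

text \<open>As \<tau> = DS, the antisymmetrized second derivative is the base curvature applied to
  S. This is how the value of the curvature reaches the torsion of \<beta>.\<close>

lemma Dv_tau:
  assumes z: "z \<in> W"
  shows "Dv (\<lambda>y. tau y v) z u - Dv (\<lambda>y. tau y u) z v
    = c *\<^sub>R (g (fst z) (fst v) (S z) *\<^sub>R fst u - g (fst z) (fst u) (S z) *\<^sub>R fst v)"
  unfolding tau_def Dv_Dv[OF z S_smooth] by (rule frame_curv_eq[OF fst_W[OF z]])

lemma dd_th:
  assumes z: "z \<in> W"
  shows "dd (\<lambda>y. th y v) z u = dd kap z u * g (fst z) (S z) (fst v)
    + kap z * (g (fst z) (tau z u) (fst v) + g (fst z) (S z) (christoffel g (fst z) (fst u) (fst v)))"
proof -
  have "dd (\<lambda>y. th y v) z u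
      = kap z * dd (\<lambda>y. g (fst y) (S y) (fst v)) z u + dd kap z u * g (fst z) (S z) (fst v)"
    unfolding th_def
    by (rule dd_mult[OF sd[OF kap_smooth z] sd[OF g_app_smooth[OF S_smooth smooth_on_const] z]])
  then show ?thesis
    by (simp add: dd_g_app[OF z sd[OF S_smooth z] differentiable_const] Dv_const tau_def)
qed

lemma torsion_alpha:
  assumes z: "z \<in> W"
  shows "Dv (\<lambda>y. alpha y v) z u + Om z u (alpha z v) - th z u *\<^sub>R beta z v
    = Dv (\<lambda>y. alpha y u) z v + Om z v (alpha z u) - th z v *\<^sub>R beta z u"
proof -
  have D: "Dv (\<lambda>y. alpha y v) z u = christoffel g (fst z) (fst u) (fst v)
      - ((dd kap z u * g (fst z) (S z) (fst v) + kap z * (g (fst z) (tau z u) (fst v)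
          + g (fst z) (S z) (christoffel g (fst z) (fst u) (fst v)))) *\<^sub>R S z
        + (kap z * g (fst z) (S z) (fst v)) *\<^sub>R tau z u)" for u v
  proof -
    have "(\<lambda>y. alpha y v) = (\<lambda>y. fst v - th y v *\<^sub>R S y)" by (simp add: alpha_def th_def)
    then have "Dv (\<lambda>y. alpha y v) z u = Dv (\<lambda>_. fst v) z u - Dv (\<lambda>y. th y v *\<^sub>R S y) z u"
      using Dv_diff[OF z differentiable_const sd[OF smooth_on_scaleR[OF open_W th_smooth S_smooth] z]]
      by simp
    also have "Dv (\<lambda>y. th y v *\<^sub>R S y) z u = dd (\<lambda>y. th y v) z u *\<^sub>R S z + th z v *\<^sub>R tau z u"
      unfolding tau_def by (rule Dv_scaleR[OF z sd[OF th_smooth z] sd[OF S_smooth z]])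
    finally show ?thesis unfolding Dv_const dd_th[OF z] by (simp only: th_def)
  qed
  have H: "christoffel g (fst z) (fst v) (fst u) = christoffel g (fst z) (fst u) (fst v)"
    by (rule christoffel_sym[OF fst_W[OF z]])
  show ?thesis
    unfolding D H dd_kap[OF z] dd_nn[OF z]
    unfolding Om_def alpha_def beta_def th_def
    using torsion_algebra[OF fst_W[OF z] nn_N[OF z] kap_def refl refl refl,
        where H="christoffel g (fst z) (fst u) (fst v)" and x="fst u" and t="tau z u"
          and y="fst v" and r="tau z v"]
    by (simp only: )
qed

text \<open>The curvature of the base contributes (2c/N) (\<langle>S, v\<rangle> u - \<langle>S,
  u\<rangle> v), written with projections. It cancels against \<theta>(u) \<alpha>(v) - \<theta>(v)
  \<alpha>(u), whose S components cancel among themselves; this fixes the factor 2c/N in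
  \<theta>.\<close>

lemma torsion_beta:
  assumes z: "z \<in> W"
  shows "Dv (\<lambda>y. beta y v) z u + Om z u (beta z v) + th z u *\<^sub>R alpha z v
    = Dv (\<lambda>y. beta y u) z v + Om z v (beta z u) + th z v *\<^sub>R alpha z u"
proof -
  have D: "Dv (\<lambda>y. beta y v) z u = (2 * dd nn z u) *\<^sub>R tau z v + (2 * nn z) *\<^sub>R Dv (\<lambda>y. tau y v) z u" for u v
  proof -
    have "dd (\<lambda>y. 2 * nn y) z u = 2 * dd nn z u"
      using dd_mult[OF differentiable_const sd[OF nn_smooth z]] by simp
    then show ?thesis
      unfolding beta_def
      using Dv_scaleR[OF z sd[OF smooth_on_mult[OF open_W smooth_on_const nn_smooth] z] sd[OF tau_smooth z]]
      by simp
  qed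
  have T: "Dv (\<lambda>y. tau y v) z u = Dv (\<lambda>y. tau y u) z v
      + c *\<^sub>R (g (fst z) (fst v) (S z) *\<^sub>R fst u - g (fst z) (fst u) (S z) *\<^sub>R fst v)"
    using Dv_tau[OF z, of v u] by (simp add: algebra_simps)
  show ?thesis
  proof (rule g_eqI[OF fst_W[OF z]])
    fix w
    have s: "g (fst z) (tau z u) (S z) = g (fst z) (S z) (tau z u)"
      "g (fst z) (tau z v) (S z) = g (fst z) (S z) (tau z v)"
      "g (fst z) (fst u) (S z) = g (fst z) (S z) (fst u)"
      "g (fst z) (fst v) (S z) = g (fst z) (S z) (fst v)"
      "g (fst z) (tau z v) (tau z u) = g (fst z) (tau z u) (tau z v)"
      by (rule g_sym[OF fst_W[OF z]])+
    show "g (fst z) (Dv (\<lambda>y. beta y v) z u + Om z u (beta z v) + th z u *\<^sub>R alpha z v) w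
      = g (fst z) (Dv (\<lambda>y. beta y u) z v + Om z v (beta z u) + th z v *\<^sub>R alpha z u) w"
      unfolding D T dd_nn[OF z]
      unfolding Om_def alpha_def beta_def th_def kap_def g_simps[OF fst_W[OF z]] s
      by (simp add: algebra_simps)
  qed
qed

lemma dd_psi: "z \<in> W \<Longrightarrow> dd (\<lambda>y. psi y v) z u = (dd (\<lambda>y. alpha y v) z u, dd (\<lambda>y. beta y v) z u)"
  unfolding psi_def by (rule dd_Pair) (simp_all add: sd[OF alpha_smooth] sd[OF beta_smooth])

lemma torsion_psi:
  assumes z: "z \<in> W"
  shows "dd (\<lambda>y. psi y v) z u + conn z u (psi z v) = dd (\<lambda>y. psi y u) z v + conn z v (psi z u)"
  unfolding dd_psi[OF z]
  using torsion_alpha[OF z, of v u] torsion_beta[OF z, of v u]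
  by (simp add: conn_def psi_def Dv_def algebra_simps)

section \<open>Curvature of this connection\<close>

text \<open>The skew endomorphism x \<and> y, with the sign for which the base has curvature
  \<open>c\<close> times \<open>wdg\<close>.\<close>

definition wdg where "wdg z x y a = g (fst z) y a *\<^sub>R x - g (fst z) x a *\<^sub>R y"

lemma conn_curvature_fst:
  assumes z: "z \<in> W"
  shows "fst (dd (\<lambda>y. conn y v (a, b)) z u + conn z u (conn z v (a, b))
      - (dd (\<lambda>y. conn y u (a, b)) z v + conn z v (conn z u (a, b))))
    = c *\<^sub>R (wdg z (alpha z u) (alpha z v) a + wdg z (beta z u) (beta z v) a)
      + (c * (g (fst z) (alpha z u) (beta z v) - g (fst z) (alpha z v) (beta z u))) *\<^sub>R b"
proof -
  have D: "fst (dd (\<lambda>y. conn y v (a, b)) z u + conn z u (conn z v (a, b)))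
    = Dv (\<lambda>y. Dv (\<lambda>_. a) y v) z u
      + (((2 * c * dd nn z u * g (fst z) (tau z v) a
            + kap z * (g (fst z) (Dv (\<lambda>y. tau y v) z u) a
              + g (fst z) (tau z v) (christoffel g (fst z) (fst u) a))) *\<^sub>R S z
          + (kap z * g (fst z) (tau z v) a) *\<^sub>R tau z u)
         - ((2 * c * dd nn z u * g (fst z) (S z) a
            + kap z * (g (fst z) (tau z u) a + g (fst z) (S z) (christoffel g (fst z) (fst u) a))) *\<^sub>R tau z v
          + (kap z * g (fst z) (S z) a) *\<^sub>R Dv (\<lambda>y. tau y v) z u))
      - ((2 * c * dd nn z u * g (fst z) (S z) (fst v) + kap z * (g (fst z) (tau z u) (fst v)
            + g (fst z) (S z) (christoffel g (fst z) (fst u) (fst v)))) *\<^sub>R b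
         + (kap z * g (fst z) (S z) (fst v)) *\<^sub>R christoffel g (fst z) (fst u) b)
      + Om z u (christoffel g (fst z) (fst v) a + Om z v a - (kap z * g (fst z) (S z) (fst v)) *\<^sub>R b)
      - (kap z * g (fst z) (S z) (fst u)) *\<^sub>R (christoffel g (fst z) (fst v) b + Om z v b
          + (kap z * g (fst z) (S z) (fst v)) *\<^sub>R a)" for u v
  proof -
    \<comment> \<open>\<open>P\<close> is the real part of the connection form applied to (a, b),
      seen as a field along the projection. Differentiating it with \<open>Dv\<close> absorbs the
      Christoffel term of the outer application of \<open>conn\<close>.\<close>
    define P where "P = (\<lambda>y. Dv (\<lambda>_. a) y v + Om y v a - th y v *\<^sub>R b)"
    have P: "P y = fst (conn y v (a, b))" for y by (simp add: P_def conn_def Dv_const)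
    have "fst (dd (\<lambda>y. conn y v (a, b)) z u) = dd (\<lambda>y. fst (conn y v (a, b))) z u"
      by (rule dd_bounded_linear[OF bounded_linear_fst sd[OF conn_smooth z], symmetric])
    then have 1: "fst (dd (\<lambda>y. conn y v (a, b)) z u + conn z u (conn z v (a, b)))
      = Dv P z u + Om z u (P z) - th z u *\<^sub>R (christoffel g (fst z) (fst v) b + Om z v b + th z v *\<^sub>R a)"
      unfolding Dv_def P by (simp add: conn_def)
    note cs = Dv_smooth[OF smooth_on_const]
    have "Dv P z u = Dv (\<lambda>y. Dv (\<lambda>_. a) y v) z u + Dv (\<lambda>y. Om y v a) z u - Dv (\<lambda>y. th y v *\<^sub>R b) z u"
      unfolding P_def
      using Dv_diff[OF z sd[OF smooth_on_add[OF open_W cs Om_smooth] z]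
          sd[OF smooth_on_scaleR[OF open_W th_smooth smooth_on_const] z]]
        Dv_add[OF z sd[OF cs z] sd[OF Om_smooth z]]
      by simp
    also have "Dv (\<lambda>y. th y v *\<^sub>R b) z u = dd (\<lambda>y. th y v) z u *\<^sub>R b + th z v *\<^sub>R christoffel g (fst z) (fst u) b"
      using Dv_scaleR[OF z sd[OF th_smooth z] differentiable_const] by (simp add: Dv_const)
    also have "Dv (\<lambda>y. Om y v a) z u = Dv (\<lambda>y. (kap y * g (fst y) (tau y v) a) *\<^sub>R S y
        - (kap y * g (fst y) (S y) a) *\<^sub>R tau y v) z u"
      unfolding Om_def by (simp only: scaleR_diff_right scaleR_scaleR)
    also have "\<dots> = Dv (\<lambda>y. (kap y * g (fst y) (tau y v) a) *\<^sub>R S y) z u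
        - Dv (\<lambda>y. (kap y * g (fst y) (S y) a) *\<^sub>R tau y v) z u"
      by (intro Dv_diff z sd[OF _ z] smooth_on_scaleR smooth_on_mult open_W kap_smooth g_app_smooth
          tau_smooth S_smooth smooth_on_const)
    also have "Dv (\<lambda>y. (kap y * g (fst y) (tau y v) a) *\<^sub>R S y) z u
       = dd (\<lambda>y. kap y * g (fst y) (tau y v) a) z u *\<^sub>R S z + (kap z * g (fst z) (tau z v) a) *\<^sub>R tau z u"
      unfolding tau_def[of z u]
      by (intro Dv_scaleR z sd[OF _ z] smooth_on_mult open_W kap_smooth g_app_smooth
          tau_smooth S_smooth smooth_on_const)
    also have "Dv (\<lambda>y. (kap y * g (fst y) (S y) a) *\<^sub>R tau y v) z u
       = dd (\<lambda>y. kap y * g (fst y) (S y) a) z u *\<^sub>R tau z v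
         + (kap z * g (fst z) (S z) a) *\<^sub>R Dv (\<lambda>y. tau y v) z u"
      by (intro Dv_scaleR z sd[OF _ z] smooth_on_mult open_W kap_smooth g_app_smooth
          tau_smooth S_smooth smooth_on_const)
    also have "dd (\<lambda>y. kap y * g (fst y) (tau y v) a) z u = dd kap z u * g (fst z) (tau z v) a
        + kap z * (g (fst z) (Dv (\<lambda>y. tau y v) z u) a + g (fst z) (tau z v) (christoffel g (fst z) (fst u) a))"
      using dd_mult[OF sd[OF kap_smooth z] sd[OF g_app_smooth[OF tau_smooth smooth_on_const] z]]
      by (simp add: dd_g_app[OF z sd[OF tau_smooth z] differentiable_const] Dv_const)
    also have "dd (\<lambda>y. kap y * g (fst y) (S y) a) z u = dd kap z u * g (fst z) (S z) a
        + kap z * (g (fst z) (tau z u) a + g (fst z) (S z) (christoffel g (fst z) (fst u) a))"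
      using dd_mult[OF sd[OF kap_smooth z] sd[OF g_app_smooth[OF S_smooth smooth_on_const] z]]
      by (simp add: dd_g_app[OF z sd[OF S_smooth z] differentiable_const] Dv_const tau_def)
    also note 2 = calculation
    show ?thesis
      unfolding 1 2 dd_th[OF z] dd_kap[OF z] unfolding th_def P_def Dv_const by simp
  qed
  have R: "Dv (\<lambda>y. Dv (\<lambda>_. a) y v) z u - Dv (\<lambda>y. Dv (\<lambda>_. a) y u) z v
    = c *\<^sub>R (g (fst z) (fst v) a *\<^sub>R fst u - g (fst z) (fst u) a *\<^sub>R fst v)"
    using Dv_Dv[OF z smooth_on_const[of W a]] frame_curv_eq[OF fst_W[OF z]] by simp
  have H: "christoffel g (fst z) (fst v) (fst u) = christoffel g (fst z) (fst u) (fst v)"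
    by (rule christoffel_sym[OF fst_W[OF z]])
  have alg: "fst (x - y) = fst x - fst y" for x y :: "(real^'n) \<times> (real^'n)" by simp
  show ?thesis
    unfolding alg D H dd_nn[OF z]
    unfolding Om_def alpha_def beta_def wdg_def
    using curvature_algebra[OF fst_W[OF z] nn_N[OF z] kap_def refl refl refl refl R Dv_tau[OF z],
        where H="christoffel g (fst z) (fst u) (fst v)" and b=b and t="tau z u" and r="tau z v"
          and ?A1.0="christoffel g (fst z) (fst u) a" and ?B1.0="christoffel g (fst z) (fst u) b"
          and ?A2.0="christoffel g (fst z) (fst v) a" and ?B2.0="christoffel g (fst z) (fst v) b"]
    by (simp only: add.assoc add_diff_eq)
qed

end

section \<open>Ricci tensor and holomorphic sectional curvature in the gauge\<close>

text \<open>The identity tr (h f) = tr (f h) moves the Ricci trace from the tangent space to the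
  pairs (a, b), where the curvature is explicit.\<close>

lemma trace_swap:
  fixes f :: "'a::euclidean_space \<Rightarrow> 'b::euclidean_space" and h :: "'b \<Rightarrow> 'a"
  assumes "linear f" "linear h"
  shows "(\<Sum>b\<in>Basis. h (f b) \<bullet> b) = (\<Sum>d\<in>Basis. f (h d) \<bullet> d)"
proof -
  have h: "h y \<bullet> b = (\<Sum>d\<in>Basis. (y \<bullet> d) * (h d \<bullet> b))" for y b
  proof -
    have "h y = h (\<Sum>d\<in>Basis. (y \<bullet> d) *\<^sub>R d)" by (simp add: euclidean_representation)
    then show ?thesis
      by (simp add: linear_sum[OF assms(2)] linear_cmul[OF assms(2)] inner_sum_left)
  qed
  have f: "f x \<bullet> d = (\<Sum>b\<in>Basis. (x \<bullet> b) * (f b \<bullet> d))" for x d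
  proof -
    have "f x = f (\<Sum>b\<in>Basis. (x \<bullet> b) *\<^sub>R b)" by (simp add: euclidean_representation)
    then show ?thesis
      by (simp add: linear_sum[OF assms(1)] linear_cmul[OF assms(1)] inner_sum_left)
  qed
  have "(\<Sum>b\<in>Basis. h (f b) \<bullet> b) = (\<Sum>b\<in>Basis. \<Sum>d\<in>Basis. (f b \<bullet> d) * (h d \<bullet> b))"
    by (intro sum.cong refl h)
  also have "\<dots> = (\<Sum>d\<in>Basis. \<Sum>b\<in>Basis. (h d \<bullet> b) * (f b \<bullet> d))"
    by (subst sum.swap) (simp add: mult.commute)
  also have "\<dots> = (\<Sum>d\<in>Basis. f (h d) \<bullet> d)"
    by (intro sum.cong refl f[symmetric])
  finally show ?thesis .
qed

lemma sum_Basis_Pair: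
  fixes f :: "'a::euclidean_space \<times> 'b::euclidean_space \<Rightarrow> real"
  shows "sum f Basis = (\<Sum>i\<in>Basis. f (i, 0)) + (\<Sum>i\<in>Basis. f (0, i))"
proof -
  have "inj_on (\<lambda>u. (u::'a, 0::'b)) Basis" "inj_on (\<lambda>u. (0::'a, u::'b)) Basis"
    by (auto intro!: inj_onI)
  then show ?thesis
    unfolding Basis_prod_def by (subst sum.union_disjoint) (auto simp: sum.reindex)
qed

text \<open>Multiplication by i on a + i b.\<close>

definition rot :: "'a::real_vector \<times> 'a \<Rightarrow> 'a \<times> 'a" where
  "rot ab = (- snd ab, fst ab)"

locale quadric_gauge = quadric_field U g c S
  for U :: "(real^'n) set" and g and c and S +
  fixes theta :: "(real^'n) \<times> (real^'n) \<Rightarrow> (real^'n) \<times> (real^'n) \<Rightarrow> (real^'n) \<times> (real^'n)"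
    and k :: real and G and J
  assumes k_pos: "k > 0"
    and psi_theta: "z \<in> U \<times> UNIV \<Longrightarrow> psi z (theta z ab) = ab"
    and theta_psi: "z \<in> U \<times> UNIV \<Longrightarrow> theta z (psi z v) = v"
    and theta_smooth: "smooth_on (U \<times> UNIV) (\<lambda>z. theta z ab)"
    and G_mm: "z \<in> U \<times> UNIV \<Longrightarrow> G z u v = mm k z (psi z u) (psi z v)"
    and psi_J: "z \<in> U \<times> UNIV \<Longrightarrow> psi z (J z u) = rot (psi z u)"
begin

sublocale T: complex_moving_frame W psi theta "mm k" conn G rot J
proof (intro complex_moving_frame.intro smooth_moving_frame.intro moving_frame.intro
    smooth_moving_frame_axioms.intro complex_moving_frame_axioms.intro)
  fix z a b u v assume z: "z \<in> W"
  show "mm k z a a > 0" if "a \<noteq> 0"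
  proof -
    have "g (fst z) x x \<ge> 0" for x
      using g_pos[OF fst_W[OF z], of x] g_simps(9)[OF fst_W[OF z]] by (cases "x = 0") (auto simp: less_imp_le)
    moreover have "fst a \<noteq> 0 \<or> snd a \<noteq> 0" using that by (metis prod_eqI fst_zero snd_zero)
    ultimately show ?thesis
      unfolding mm_def using k_pos g_pos[OF fst_W[OF z]]
      by (intro mult_pos_pos) (auto intro: add_pos_nonneg add_nonneg_pos)
  qed
  show "mm k z a b = mm k z b a"
    using g_sym[OF fst_W[OF z]] by (simp add: mm_def)
  show "mm k z (rot a) (rot b) = mm k z a b"
    by (simp add: mm_def rot_def g_simps[OF fst_W[OF z]])
  show "conn z u (rot b) = rot (conn z u b)"
    using bil_christoffel[OF fst_W[OF z]] by (simp add: conn_def rot_def Om_linear[OF z] bilinear_rneg)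
  show "linear (psi z)" by (rule psi_linear[OF z])
  show "bilinear (mm k z)" by (rule mm_bilinear[OF z])
  show "bilinear (conn z)" by (rule conn_bilinear[OF z])
  show "psi z (theta z b) = b" by (rule psi_theta[OF z])
  show "theta z (psi z v) = v" by (rule theta_psi[OF z])
  show "G z u v = mm k z (psi z u) (psi z v)" by (rule G_mm[OF z])
  show "psi z (J z u) = rot (psi z u)" by (rule psi_J[OF z])
  show "(\<lambda>y. psi y v) differentiable at z" "(\<lambda>y. mm k y a b) differentiable at z"
    by (rule sd[OF psi_smooth z] sd[OF mm_smooth z])+
  show "dd (\<lambda>y. mm k y a b) z u = mm k z (conn z u a) b + mm k z a (conn z u b)"
    "dd (\<lambda>y. psi y v) z u + conn z u (psi z v) = dd (\<lambda>y. psi y u) z v + conn z v (psi z u)"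
    by (rule mm_compat[OF z] torsion_psi[OF z])+
next
  show "linear (rot :: (real^'n) \<times> (real^'n) \<Rightarrow> _)" by (rule linearI) (simp_all add: rot_def)
  show "rot (rot b) = - b" for b :: "(real^'n) \<times> (real^'n)" by (simp add: rot_def prod_eq_iff)
  show "open W" "smooth_on W (\<lambda>y. psi y v)" "smooth_on W (\<lambda>y. conn y u b)"
    "smooth_on W (\<lambda>y. theta y b)" for u v b
    by (rule open_W psi_smooth conn_smooth theta_smooth)+
qed

definition Theta where
  "Theta z au bu av bv = c * (g (fst z) au bv - g (fst z) av bu)"

text \<open>The complex linear endomorphism
  \<open>c (x1 \<and> y1 + x2 \<and> y2) - i Theta\<close>, for \<open>uu = (x1, x2)\<close> and
  \<open>vv = (y1, y2)\<close>, applied to a + i b.\<close>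

definition curvature_form where
  "curvature_form z uu vv ab =
    (c *\<^sub>R (wdg z (fst uu) (fst vv) (fst ab) + wdg z (snd uu) (snd vv) (fst ab))
       + Theta z (fst uu) (snd uu) (fst vv) (snd vv) *\<^sub>R snd ab,
     c *\<^sub>R (wdg z (fst uu) (fst vv) (snd ab) + wdg z (snd uu) (snd vv) (snd ab))
       - Theta z (fst uu) (snd uu) (fst vv) (snd vv) *\<^sub>R fst ab)"

text \<open>The curvature commutes with i because the connection does. The pair (b, -a) is -i times
  (a, b), so the imaginary part of the value at (a, b) is the real part at (b, -a), and
  \<open>conn_curvature_fst\<close> covers both.\<close>

lemma psi_curvature:
  assumes z: "z \<in> W"
  shows "psi z (curvature G z u v w) = curvature_form z (psi z u) (psi z v) (psi z w)"
proof -
  define X where "X = (\<lambda>ab. dd (\<lambda>y. conn y v ab) z u + conn z u (conn z v ab)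
      - (dd (\<lambda>y. conn y u ab) z v + conn z v (conn z u ab)))"
  have F: "T.frame_curv z u v ab = X ab" for ab by (simp add: T.frame_curv_def X_def)
  have rr: "conn y v (b, - a) = - rot (conn y v (a, b))" if "y \<in> W" for y v a b
    using bil_christoffel[OF fst_W[OF that]] by (simp add: conn_def rot_def Om_linear[OF that] bilinear_rneg)
  have dr: "dd (\<lambda>y. conn y v (b, - a)) z u = - rot (dd (\<lambda>y. conn y v (a, b)) z u)" for u v a b
  proof -
    have "dd (\<lambda>y. conn y v (b, - a)) z u = dd (\<lambda>y. - rot (conn y v (a, b))) z u"
      by (rule dd_cong_open[OF open_W z rr])
    also have "linear (\<lambda>ab :: (real^'n) \<times> (real^'n). - rot ab)"
      by (rule linearI) (simp_all add: rot_def)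
    then have "bounded_linear (\<lambda>ab :: (real^'n) \<times> (real^'n). - rot ab)"
      by (simp add: linear_conv_bounded_linear)
    from dd_bounded_linear[OF this sd[OF conn_smooth z]]
    have "dd (\<lambda>y. - rot (conn y v (a, b))) z u = - rot (dd (\<lambda>y. conn y v (a, b)) z u)" .
    finally show ?thesis .
  qed
  have cr: "conn z u (- rot x) = - rot (conn z u x)" for u x
    using bilinear_rneg[OF conn_bilinear[OF z]] T.omega_I[OF z] by simp
  have sn: "snd (X (a, b)) = fst (X (b, - a))" for a b
    unfolding X_def dr rr[OF z] cr by (simp add: rot_def)
  have ff: "fst (X (a, b)) = c *\<^sub>R (wdg z (alpha z u) (alpha z v) a + wdg z (beta z u) (beta z v) a)
      + (c * (g (fst z) (alpha z u) (beta z v) - g (fst z) (alpha z v) (beta z u))) *\<^sub>R b" for a b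
    unfolding X_def by (rule conn_curvature_fst[OF z])
  have "X (a, b) = curvature_form z (psi z u) (psi z v) (a, b)" for a b
    by (rule prod_eqI) (simp_all add: sn ff curvature_form_def Theta_def psi_def)
  then show ?thesis
    using T.psi_curvature[OF z, of u v w] F[of "psi z w"] by (cases "psi z w") simp
qed

lemma theta_linear: "z \<in> W \<Longrightarrow> linear (theta z)"
  by (rule T.lin_theta)

lemma sum_g_Basis: "q \<in> U \<Longrightarrow> (\<Sum>i\<in>Basis. g q i a * (y \<bullet> i)) = g q y a"
proof -
  assume q: "q \<in> U"
  have l: "linear (\<lambda>y. g q y a)" using bil_g[OF q] by (simp add: bilinear_def)
  have "g q y a = g q (\<Sum>i\<in>Basis. (y \<bullet> i) *\<^sub>R i) a" by (simp add: euclidean_representation)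
  then show ?thesis by (simp add: linear_sum[OF l] linear_cmul[OF l] g_simps[OF q] mult.commute)
qed

text \<open>For \<psi>(v) = (y1, y2) and \<psi>(w) = (a, b), the wedge terms over the first half of
  the basis give (n - 1) c \<langle>y1, a\<rangle>, and the \<open>Theta\<close> term over the
  second half supplies the missing c \<langle>y1, a\<rangle>. With the roles exchanged the same
  holds for \<langle>y2, b\<rangle>; the sum is nc/k times G.\<close>

lemma ricci_eq:
  assumes z: "z \<in> W"
  shows "ricci G z v w = (of_nat CARD('n) * c / k) * G z v w"
proof -
  obtain y1 y2 where y: "psi z v = (y1, y2)" by (cases "psi z v")
  obtain a b where ab: "psi z w = (a, b)" by (cases "psi z w")
  define L where "L = (\<lambda>x. curvature_form z x (y1, y2) (a, b))"
  note gs = g_simps[OF fst_W[OF z]]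
  have "linear L"
    by (rule linearI) (simp_all add: L_def curvature_form_def Theta_def wdg_def gs algebra_simps)
  then have "linear (\<lambda>x. theta z (L x))"
    using linear_compose[OF _ theta_linear[OF z]] by (simp add: o_def)
  have "curvature G z e v w = theta z (L (psi z e))" for e
    using theta_psi[OF z] psi_curvature[OF z] by (metis L_def y ab)
  then have "ricci G z v w = (\<Sum>e\<in>Basis. theta z (L (psi z e)) \<bullet> e)"
    by (simp add: ricci_def)
  also have "\<dots> = (\<Sum>d\<in>Basis. L d \<bullet> d)"
    using trace_swap[OF psi_linear[OF z] \<open>linear (\<lambda>x. theta z (L x))\<close>] by (simp add: psi_theta[OF z])
  also have "\<dots> = (\<Sum>i\<in>Basis. fst (L (i, 0)) \<bullet> i) + (\<Sum>i\<in>Basis. snd (L (0, i)) \<bullet> i)"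
    by (simp add: sum_Basis_Pair inner_Pair_0)
  also have "(\<Sum>i\<in>Basis. fst (L (i, 0)) \<bullet> i)
      = (\<Sum>i\<in>Basis. c * g (fst z) y1 a * (i \<bullet> i) - c * (g (fst z) i a * (y1 \<bullet> i)) + c * (g (fst z) i y2 * (b \<bullet> i)))"
    by (intro sum.cong refl)
      (simp add: L_def curvature_form_def Theta_def wdg_def gs inner_diff_left inner_add_left algebra_simps)
  also have "\<dots> = c * g (fst z) y1 a * CARD('n) - c * g (fst z) y1 a + c * g (fst z) b y2"
    by (simp add: sum.distrib sum_subtractf sum_g_Basis[OF fst_W[OF z]] flip: sum_distrib_left)
  also have "(\<Sum>i\<in>Basis. snd (L (0, i)) \<bullet> i)
      = (\<Sum>i\<in>Basis. c * g (fst z) y2 b * (i \<bullet> i) - c * (g (fst z) i b * (y2 \<bullet> i)) + c * (g (fst z) i y1 * (a \<bullet> i)))"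
    by (intro sum.cong refl)
      (simp add: L_def curvature_form_def Theta_def wdg_def gs inner_diff_left inner_add_left algebra_simps
        g_sym[OF fst_W[OF z], of y1])
  also have "\<dots> = c * g (fst z) y2 b * CARD('n) - c * g (fst z) y2 b + c * g (fst z) a y1"
    by (simp add: sum.distrib sum_subtractf sum_g_Basis[OF fst_W[OF z]] flip: sum_distrib_left)
  finally show ?thesis
    using k_pos g_sym[OF fst_W[OF z], of b y2] g_sym[OF fst_W[OF z], of a y1]
    by (simp add: G_mm[OF z] mm_def y ab algebra_simps)
qed

text \<open>The holomorphic plane of X, JX and the totally real plane of X, Y have the same
  sectional curvature c/k here, one coming from \<open>Theta\<close> and the other from the wedge
  terms. In a space of constant holomorphic sectional curvature \<kappa> they would be \<kappa> and
  \<kappa>/4.\<close>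

lemma constant_holomorphic_imp_flat:
  assumes z: "z \<in> W" and card: "CARD('n) \<ge> 2"
    and H: "\<And>X Y Z. curvature G z X Y Z = (\<kappa> / 4) *\<^sub>R
          (G z Z Y *\<^sub>R X - G z Z X *\<^sub>R Y
           + G z Z (J z Y) *\<^sub>R J z X - G z Z (J z X) *\<^sub>R J z Y
           + (2 * G z X (J z Y)) *\<^sub>R J z Z)"
  shows "c = 0 \<and> \<kappa> = 0"
proof -
  note gs = g_simps[OF fst_W[OF z]]
  obtain i j :: 'n where ij: "i \<noteq> j"
    using card card_le_Suc0_iff_eq[of "UNIV :: 'n set"] by fastforce
  define u :: "real^'n" where "u = axis i 1"
  \<comment> \<open>One Gram-Schmidt step; a second index \<open>j\<close> exists because the
    dimension is at least 2.\<close>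
  define v where "v = axis j 1 - (g (fst z) u (axis j 1) / g (fst z) u u) *\<^sub>R u"
  have u0: "u \<noteq> 0" by (simp add: u_def axis_eq_0_iff)
  have "v $ j = 1" using ij by (simp add: v_def u_def axis_def)
  then have v0: "v \<noteq> 0" by force
  have guu: "g (fst z) u u > 0" and gvv: "g (fst z) v v > 0" using g_pos[OF fst_W[OF z]] u0 v0 by auto
  have guv: "g (fst z) u v = 0" using guu by (simp add: v_def gs)
  then have gvu: "g (fst z) v u = 0" using g_sym[OF fst_W[OF z]] by simp
  define X where "X = theta z (u, 0)"
  define Y where "Y = theta z (v, 0)"
  have pX: "psi z X = (u, 0)" and pY: "psi z Y = (v, 0)"
    and pJX: "psi z (J z X) = (0, u)" and pJY: "psi z (J z Y) = (0, v)"
    and pJJX: "psi z (J z (J z X)) = (- u, 0)"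
    by (simp_all add: X_def Y_def psi_theta[OF z] psi_J[OF z] rot_def)
  note pl = linear_add[OF psi_linear[OF z]] linear_diff[OF psi_linear[OF z]] linear_cmul[OF psi_linear[OF z]]
  \<comment> \<open>For \<psi>-images (u, 0) and (0, u) the wedge terms vanish on the third
    argument, so this value tests \<open>Theta\<close> alone.\<close>
  have "psi z (curvature G z X (J z X) (J z X)) = ((c * g (fst z) u u) *\<^sub>R u, 0)"
    by (simp add: psi_curvature[OF z] pX pJX curvature_form_def Theta_def wdg_def gs)
  moreover have "psi z (curvature G z X (J z X) (J z X)) = ((\<kappa> * k * g (fst z) u u) *\<^sub>R u, 0)"
    unfolding H pl
    by (simp add: pX pJX pJJX G_mm[OF z] mm_def gs algebra_simps flip: scaleR_add_left scaleR_scaleR)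
      (simp add: algebra_simps flip: scaleR_add_left)
  ultimately have "(c * g (fst z) u u) *\<^sub>R u = (\<kappa> * k * g (fst z) u u) *\<^sub>R u" by (metis prod.inject)
  then have 1: "c = \<kappa> * k" using u0 guu by (metis less_irrefl mult_right_cancel scaleR_right_imp_eq)
  \<comment> \<open>Both images are real, so \<open>Theta\<close> vanishes and only the first wedge
    term is left.\<close>
  have "psi z (curvature G z X Y Y) = ((c * g (fst z) v v) *\<^sub>R u, 0)"
    by (simp add: psi_curvature[OF z] pX pY curvature_form_def Theta_def wdg_def gs guv gvu)
  moreover have "psi z (curvature G z X Y Y) = ((\<kappa> / 4 * k * g (fst z) v v) *\<^sub>R u, 0)"
    unfolding H pl
    by (simp add: pX pY pJX pJY G_mm[OF z] mm_def gs guv gvu)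
  ultimately have "(c * g (fst z) v v) *\<^sub>R u = (\<kappa> / 4 * k * g (fst z) v v) *\<^sub>R u" by (metis prod.inject)
  then have "c = \<kappa> / 4 * k" using u0 gvv by (metis less_irrefl mult_right_cancel scaleR_right_imp_eq)
  then have "\<kappa> * k = 0" using 1 by simp
  then show ?thesis using k_pos 1 by auto
qed

end

section \<open>Natural structures of diagonal type in a chart\<close>

context metric_chart
begin

definition ps :: "(real^'n) \<times> (real^'n) \<Rightarrow> real^'n" where
  "ps z = sharp (fst z) (snd z)"

definition en :: "(real^'n) \<times> (real^'n) \<Rightarrow> real" where
  "en z = g (fst z) (ps z) (ps z) / 2"

text \<open>The covector with components \<open>\<Gamma>\<^sup>0\<^sub>i\<^sub>h x\<^sup>i\<close>:
  the pair \<open>(x, gam0 z x)\<close> is the horizontal lift of x.\<close>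

definition gam0 :: "(real^'n) \<times> (real^'n) \<Rightarrow> real^'n \<Rightarrow> real^'n" where
  "gam0 z x = (\<chi> h. snd z \<bullet> christoffel g (fst z) x (axis h 1))"

text \<open>The tangent vector of the cotangent bundle with given horizontal part \<open>x\<close> and given raised
  vertical part \<open>h\<close>; conversely \<open>Dv ps z v\<close> is the raised vertical part of \<open>v\<close>.\<close>

definition mk :: "(real^'n) \<times> (real^'n) \<Rightarrow> real^'n \<Rightarrow> real^'n \<Rightarrow> (real^'n) \<times> (real^'n)" where
  "mk z x h = (x, gam0 z x + metric_lower g (fst z) *v h)"

lemma ps_smooth: "smooth_on W ps"
proof -
  have "smooth_on W (\<lambda>z. sharp (fst z) (snd z))"
    by (rule smooth_on_linear_app[where T="\<lambda>z. sharp (fst z)", OF open_W linear_sharp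
          smooth_on_compose_fst[OF open_U sharp_smooth]
          smooth_on_bounded_linear[OF open_W bounded_linear_snd smooth_on_id]])
  then show ?thesis by (simp add: ps_def[abs_def])
qed

lemma en_smooth: "smooth_on W en"
  unfolding en_def[abs_def] by (intro smooth_on_divide g_app_smooth ps_smooth smooth_on_const open_W) simp

lemma en_nonneg: "z \<in> W \<Longrightarrow> en z \<ge> 0"
  unfolding en_def using g_pos[OF fst_W, of z "ps z"] g_simps(9)[OF fst_W, of z] by (cases "ps z = 0") auto

lemma g_ps: "z \<in> W \<Longrightarrow> g (fst z) (ps z) w = snd z \<bullet> w"
  by (simp add: ps_def g_sharp[OF fst_W])

lemma gam0_inner: "z \<in> W \<Longrightarrow> gam0 z x \<bullet> w = snd z \<bullet> christoffel g (fst z) x w"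
proof -
  assume z: "z \<in> W"
  have l: "linear (\<lambda>w. snd z \<bullet> christoffel g (fst z) x w)"
    using bil_christoffel[OF fst_W[OF z]] by (auto simp: bilinear_def linear_iff inner_add_right)
  have "snd z \<bullet> christoffel g (fst z) x w
      = snd z \<bullet> christoffel g (fst z) x (\<Sum>i\<in>UNIV. w $ i *\<^sub>R axis i 1)"
    by (simp add: basis_expansion flip: scalar_mult_eq_scaleR)
  also have "\<dots> = (\<Sum>i\<in>UNIV. w $ i * (snd z \<bullet> christoffel g (fst z) x (axis i 1)))"
    unfolding linear_sum[OF l] linear_cmul[OF l] real_scaleR_def ..
  finally show ?thesis by (simp add: gam0_def inner_vec_def[of "vec_lambda _"] mult.commute)
qed

text \<open>Differentiate \<open>g_ps\<close> for constant \<open>w\<close>. It follows that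
  \<open>Dv ps z\<close> vanishes exactly on the horizontal vectors, so the splitting by \<delta>
  and \<partial> can be handled without indices.\<close>

lemma g_Dv_ps:
  assumes z: "z \<in> W"
  shows "g (fst z) (Dv ps z v) w = snd v \<bullet> w - gam0 z (fst v) \<bullet> w"
proof -
  have pd: "ps differentiable (at z)" by (rule smooth_on_differentiable[OF ps_smooth z])
  have "dd (\<lambda>y. g (fst y) (ps y) w) z v = dd (\<lambda>y. snd y \<bullet> w) z v"
    by (rule dd_cong_open[OF open_W z g_ps])
  also have "\<dots> = snd v \<bullet> w"
    by (rule dd_eqI[OF bounded_linear_imp_has_derivative])
      (intro bounded_linear_compose[OF bounded_linear_inner_left bounded_linear_snd])
  finally have "snd v \<bullet> w = g (fst z) (Dv ps z v) w + g (fst z) (ps z) (Dv (\<lambda>_. w) z v)"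
    using dd_g_app[OF z pd differentiable_const] by simp
  then show ?thesis by (simp add: Dv_const g_ps[OF z] gam0_inner[OF z])
qed

lemma Dv_ps_mk: "z \<in> W \<Longrightarrow> Dv ps z (mk z x h) = h"
proof -
  assume z: "z \<in> W"
  show ?thesis
    by (rule g_eqI[OF fst_W[OF z]], unfold g_Dv_ps[OF z])
      (simp add: mk_def inner_add_left metric_lower_mult[OF fst_W[OF z]])
qed

lemma fst_mk [simp]: "fst (mk z x h) = x"
  by (simp add: mk_def)

lemma metric_lower_eqI: "q \<in> U \<Longrightarrow> (\<And>w. g q h w = a \<bullet> w) \<Longrightarrow> metric_lower g q *v h = a"
  using metric_lower_mult[of q h] by (metis vector_eq_rdot)

lemma mk_Dv_ps: "z \<in> W \<Longrightarrow> mk z (fst v) (Dv ps z v) = v"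
proof -
  assume z: "z \<in> W"
  have "metric_lower g (fst z) *v Dv ps z v = snd v - gam0 z (fst v)"
    by (rule metric_lower_eqI[OF fst_W[OF z]]) (simp add: g_Dv_ps[OF z] inner_diff_left)
  then show ?thesis by (simp add: mk_def prod_eq_iff)
qed

lemma linear_gam0: "z \<in> W \<Longrightarrow> linear (gam0 z)"
proof -
  assume z: "z \<in> W"
  note b = bil_christoffel[OF fst_W[OF z]]
  show ?thesis
    by (rule linearI) (simp_all add: vector_eq_rdot[symmetric, of "gam0 z _"] gam0_inner[OF z] inner_add_left
        bilinear_ladd[OF b] bilinear_lmul[OF b] inner_add_right)
qed

lemma mk_linear:
  assumes z: "z \<in> W"
  shows "mk z (x + x') (h + h') = mk z x h + mk z x' h'" "mk z (r *\<^sub>R x) (r *\<^sub>R h) = r *\<^sub>R mk z x h"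
  using linear_gam0[OF z]
  by (simp_all add: mk_def linear_add linear_cmul matrix_vector_right_distrib scaleR_add_right
      linear_cmul[OF matrix_vector_mul_linear])

lemma mk_smooth:
  assumes "smooth_on W x" "smooth_on W h"
  shows "smooth_on W (\<lambda>z. mk z (x z) (h z))"
proof -
  have "smooth_on W (\<lambda>z. gam0 z (x z))"
    unfolding gam0_def
    by (rule smooth_on_vec[OF open_W])
      (auto intro!: smooth_on_inner open_W christoffel_app_smooth assms smooth_on_const
        smooth_on_bounded_linear[OF open_W bounded_linear_snd smooth_on_id])
  moreover have "smooth_on W (\<lambda>z. metric_lower g (fst z) *v h z)"
  proof (rule smooth_on_vec[OF open_W])
    fix i
    have "(metric_lower g (fst z) *v h z) $ i = g (fst z) (h z) (axis i 1)" if "z \<in> W" for z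
      using metric_lower_mult[OF fst_W[OF that], of "h z" "axis i 1"] by (simp add: inner_axis)
    then show "smooth_on W (\<lambda>z. (metric_lower g (fst z) *v h z) $ i)"
      using smooth_on_cong[OF open_W, of "\<lambda>z. (metric_lower g (fst z) *v h z) $ i" "\<lambda>z. g (fst z) (h z) (axis i 1)"]
        g_app_smooth[OF assms(2) smooth_on_const] by blast
  qed
  ultimately show ?thesis
    unfolding mk_def by (intro smooth_on_Pair smooth_on_add assms open_W)
qed

lemma dd_en:
  assumes z: "z \<in> W"
  shows "dd en z v = g (fst z) (ps z) (Dv ps z v)"
proof -
  have pd: "ps differentiable (at z)" by (rule smooth_on_differentiable[OF ps_smooth z])
  have gd: "(\<lambda>y. g (fst y) (ps y) (ps y)) differentiable (at z)"
    by (rule smooth_on_differentiable[OF g_app_smooth[OF ps_smooth ps_smooth] z])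
  have "dd en z v = dd (\<lambda>y. g (fst y) (ps y) (ps y)) z v / 2"
    unfolding en_def[abs_def] using dd_divide[OF gd differentiable_const, of 2] by simp
  then show ?thesis
    using g_sym[OF fst_W[OF z], of "ps z" "Dv ps z v"] by (simp add: dd_g_app[OF z pd pd])
qed

end

text \<open>Here \<open>A\<close> is \<open>a\<^sub>1(t)\<close>, \<open>A'\<close> its derivative, \<open>b\<close> and \<open>b2\<close> are \<open>b\<^sub>1(t)\<close> and \<open>b\<^sub>2(t)\<close>, and \<open>r\<close> turns out to be
  \<open>\<rho>'/\<rho>\<close>.\<close>

lemma gauge_scalars:
  fixes A A' t c w k :: real
  assumes A: "A > 0" and w: "w > 0" "w * w = A * A - 2 * t * c" and D: "A - 2 * t * A' > 0"
  defines "D \<equiv> A - 2 * t * A'" and "\<rho> \<equiv> 1 / (A + w)"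
  defines "b \<equiv> (A * A' - c) / D" and "r \<equiv> - (\<rho> * (A' + (A * A' - c) / w))"
  defines "b2 \<equiv> - b / (A * (A + 2 * t * b))"
  shows "A + 2 * t * b = w * w / D"
    and "1 + c * (\<rho> * \<rho> * (2 * t)) = 2 * A * \<rho>"
    and "b2 - (c * \<rho> / A) * (1 / A + 2 * t * b2) = r / A"
    and "b + r * (A + 2 * t * b) = - (c * \<rho>)"
    and "(k / A) * b + (- k * A' / (A * A)) * (A + 2 * t * b)
      = k * (- 2 * (c * \<rho> / A) + (c * \<rho> / A) * (c * \<rho> / A) * (2 * t))"
    and "(k / A) * b2 + (- k * A' / (A * A)) * (1 / A + 2 * t * b2) = k * (2 * r + 2 * t * r * r) / (A * A)"
    and "1 - (c * \<rho> / A) * (2 * t) = w / A"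
proof -
  have nz: "A \<noteq> 0" "w \<noteq> 0" "D \<noteq> 0" "A + w \<noteq> 0" using A w D by (auto simp: D_def)
  show s: "A + 2 * t * b = w * w / D"
    using nz w(2) by (simp add: b_def field_simps) (simp add: D_def algebra_simps)
  have b2: "b2 = - (A * A' - c) / (A * (w * w))"
    unfolding b2_def s using nz by (simp add: b_def)
  have s2: "1 / A + 2 * t * b2 = D / (w * w)"
    using nz w(2) by (simp add: b2 field_simps) (simp add: D_def algebra_simps)
  have r: "r = - (A' * (A + w) - c) / (w * (A + w))"
    using nz by (simp add: r_def \<rho>_def divide_simps) (simp add: algebra_simps)
  show "1 + c * (\<rho> * \<rho> * (2 * t)) = 2 * A * \<rho>"
  proof -
    \<comment> \<open>This is N = 2A / (A + w) cleared of denominators.\<close>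
    have "(A + w) * (A + w) + c * (2 * t) = 2 * A * (A + w)" using w(2) by algebra
    moreover have "1 + c * (\<rho> * \<rho> * (2 * t)) = ((A + w) * (A + w) + c * (2 * t)) / ((A + w) * (A + w))"
      using nz by (simp add: \<rho>_def divide_simps)
    ultimately show ?thesis using nz by (simp add: \<rho>_def)
  qed
  have ct: "c * (2 * t) = (A - w) * (A + w)" using w(2) by (simp add: algebra_simps)
  then have rct: "\<rho> * (c * (2 * t)) = A - w" using nz by (simp add: \<rho>_def)
  then show "1 - (c * \<rho> / A) * (2 * t) = w / A"
    using nz by (simp add: divide_simps) (simp add: algebra_simps)
  \<comment> \<open>The relation behind the third and fourth claims, that is, behind the complex
    linearity of \<psi>. It follows from w^2 = A^2 - 2tc alone.\<close>
  have e1: "(A * A' - c) * (A + w) + c * D = w * (A' * (A + w) - c)"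
    using w(2) unfolding D_def by algebra
  have "b2 - (c * \<rho> / A) * (1 / A + 2 * t * b2) = - ((A * A' - c) * (A + w) + c * D) / (A * (w * w) * (A + w))"
    unfolding s2 using nz by (simp add: b2 \<rho>_def divide_simps) (simp add: algebra_simps)
  then show "b2 - (c * \<rho> / A) * (1 / A + 2 * t * b2) = r / A"
    unfolding e1 using nz by (simp add: r divide_simps)
  have "b + r * (A + 2 * t * b) = ((A * A' - c) * (A + w) - w * (A' * (A + w) - c)) / (D * (A + w))"
    unfolding s using nz by (simp add: b_def r divide_simps) (simp add: algebra_simps)
  also have "(A * A' - c) * (A + w) - w * (A' * (A + w) - c) = - (c * D)"
    using e1 by simp
  finally show "b + r * (A + 2 * t * b) = - (c * \<rho>)"
    using nz by (simp add: \<rho>_def)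
  have "(k / A) * b + (- k * A' / (A * A)) * (A + 2 * t * b)
      = k * (A * (A * A' - c) - A' * (w * w)) / (A * A * D)"
    unfolding s using nz by (simp add: b_def divide_simps) (simp add: algebra_simps)
  also have "A * (A * A' - c) - A' * (w * w) = - (c * D)"
    unfolding w(2) D_def by (simp add: algebra_simps)
  finally have d1: "(k / A) * b + (- k * A' / (A * A)) * (A + 2 * t * b) = - (k * c) / (A * A)"
    using nz by simp
  have "(c * \<rho> / A) * (c * \<rho> / A) * (2 * t) = c * \<rho> * (\<rho> * (c * (2 * t))) / (A * A)"
    by simp
  then have e2: "(c * \<rho> / A) * (c * \<rho> / A) * (2 * t) = c * \<rho> * (A - w) / (A * A)"
    by (simp only: rct)
  have e3: "- 2 * (c * \<rho> / A) + c * \<rho> * (A - w) / (A * A) = - c / (A * A)"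
    using nz by (simp add: \<rho>_def divide_simps) (simp add: algebra_simps)
  show "(k / A) * b + (- k * A' / (A * A)) * (A + 2 * t * b)
      = k * (- 2 * (c * \<rho> / A) + (c * \<rho> / A) * (c * \<rho> / A) * (2 * t))"
    unfolding d1 e2 e3 by simp
  have l: "(k / A) * b2 + (- k * A' / (A * A)) * (1 / A + 2 * t * b2)
      = - k * (A * A' - c + A' * D) / (A * A * (w * w))"
    unfolding s2 using nz by (simp add: b2 divide_simps) (simp add: algebra_simps)
  \<comment> \<open>With q = A'(A + w) - c one has r = - q / (w (A + w)); the left side is the
    numerator of - (2r + 2tr^2) over the denominator w^2 (A + w)^2.\<close>
  have "2 * w * (A + w) * (A' * (A + w) - c) - 2 * t * (A' * (A + w) - c) * (A' * (A + w) - c)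
      = (A * A' - c + A' * D) * ((A + w) * (A + w))"
    using w(2) unfolding D_def by algebra
  moreover have "2 * r + 2 * t * r * r = - (2 * w * (A + w) * (A' * (A + w) - c)
      - 2 * t * (A' * (A + w) - c) * (A' * (A + w) - c)) / ((w * w) * ((A + w) * (A + w)))"
    using nz by (simp add: r divide_simps) (simp add: algebra_simps)
  ultimately have rr: "2 * r + 2 * t * r * r = - ((A * A' - c + A' * D) / (w * w))"
    using nz by simp
  show "(k / A) * b2 + (- k * A' / (A * A)) * (1 / A + 2 * t * b2) = k * (2 * r + 2 * t * r * r) / (A * A)"
    unfolding l rr by simp
qed

section \<open>Signs of the scalar functions\<close>

locale natural_functions =
  fixes c k :: real and a1 b1 lam mu :: "real \<Rightarrow> real"
  assumes a1_smooth: "smooth_halfline a1"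
    and a1_denom: "t \<ge> 0 \<Longrightarrow> a1 t - 2 * t * halfline_deriv a1 t \<noteq> 0"
    and b1_eq: "t \<ge> 0 \<Longrightarrow> b1 t = (a1 t * halfline_deriv a1 t - c) / (a1 t - 2 * t * halfline_deriv a1 t)"
    and lam_eq: "t \<ge> 0 \<Longrightarrow> lam t = k / a1 t"
    and mu_eq: "t \<ge> 0 \<Longrightarrow> mu t = halfline_deriv lam t"
    and a1_pos: "t \<ge> 0 \<Longrightarrow> a1 t > 0"
    and ab_pos: "t \<ge> 0 \<Longrightarrow> a1 t + 2 * t * b1 t > 0"
    and lam_pos: "t \<ge> 0 \<Longrightarrow> lam t > 0"
    and lam_mu_pos: "t \<ge> 0 \<Longrightarrow> lam t + 2 * t * halfline_deriv lam t > 0"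
begin

lemma k_gt_0: "k > 0"
  using lam_pos[of 0] lam_eq[of 0] a1_pos[of 0] by (simp add: zero_less_divide_iff)

lemma halfline_deriv_lam:
  assumes t: "t \<ge> 0"
  shows "halfline_deriv lam t = - k * halfline_deriv a1 t / (a1 t * a1 t)"
proof -
  have "(a1 has_derivative (\<lambda>r. r * halfline_deriv a1 t)) (at t within {0..})"
    by (rule halfline_has_derivative[OF smooth_halfline_D(1)[OF a1_smooth t] t])
  then have "((\<lambda>s. k / a1 s) has_derivative
      (\<lambda>r. (0 * a1 t - k * (r * halfline_deriv a1 t)) / (a1 t * a1 t))) (at t within {0..})"
    using a1_pos[OF t] by (intro has_derivative_divide' has_derivative_const) auto
  then have "((\<lambda>s. k / a1 s) has_vector_derivative - k * halfline_deriv a1 t / (a1 t * a1 t)) (at t within {0..})"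
    unfolding has_vector_derivative_def by (rule has_derivative_eq_rhs) (auto simp: fun_eq_iff)
  then have "(lam has_vector_derivative - k * halfline_deriv a1 t / (a1 t * a1 t)) (at t within {0..})"
    by (rule has_vector_derivative_transform[rotated 2]) (use t lam_eq in auto)
  \<comment> \<open>Uniqueness of the one-sided derivative: every t \<ge> 0, including 0, is a limit
    point of the half-line.\<close>
  moreover have "at t within {0..} \<noteq> bot"
  proof -
    have "{t<..<t + 1} \<subseteq> {0..}" using t by auto
    then have "t islimpt {0..}" using islimpt_subset[OF islimpt_greaterThanLessThan1[of t "t + 1"]] by simp
    then show ?thesis by (simp add: trivial_limit_within)
  qed
  ultimately show ?thesis unfolding halfline_deriv_def by (intro vector_derivative_within)
qed

text \<open>Up to the positive factor \<open>k / (a1 t)^2\<close> this is \<lambda> + 2t\<lambda>',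
  which turns the nonvanishing denominator into a positive one.\<close>

lemma denom_pos:
  assumes t: "t \<ge> 0"
  shows "a1 t - 2 * t * halfline_deriv a1 t > 0"
proof -
  have "lam t + 2 * t * halfline_deriv lam t = k * (a1 t - 2 * t * halfline_deriv a1 t) / (a1 t * a1 t)"
    using a1_pos[OF t] by (simp add: lam_eq[OF t] halfline_deriv_lam[OF t] field_simps)
  then show ?thesis
    using lam_mu_pos[OF t] k_gt_0 a1_pos[OF t] by (simp add: zero_less_divide_iff zero_less_mult_iff)
qed

text \<open>The quotient of this radicand by the positive denominator is
  \<open>a1 t + 2 * t * b1 t\<close>. Hence w is a smooth positive function.\<close>

lemma radicand_pos:
  assumes t: "t \<ge> 0"
  shows "a1 t * a1 t - 2 * t * c > 0"
proof -
  have "a1 t + 2 * t * b1 t = (a1 t * a1 t - 2 * t * c) / (a1 t - 2 * t * halfline_deriv a1 t)"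
    using a1_denom[OF t] by (simp add: b1_eq[OF t] divide_simps) (simp add: algebra_simps)
  then show ?thesis
    using ab_pos[OF t] denom_pos[OF t] by (simp add: zero_less_divide_iff)
qed

end

section \<open>The field S of a natural structure\<close>

text \<open>The frame formulas restated for arbitrary vectors, in terms of the projection
  \<open>fst u\<close> and the raised vertical part \<open>Dv ps z u\<close>. The variables t, a2,
  b2 tied by equations let the formulas be used with or without abbreviations.\<close>

locale natural_chart = constant_curvature_chart U g c + natural_functions c k a1 b1 lam mu
  for U :: "(real^'n) set" and g and c and k and a1 b1 lam mu +
  fixes G :: "(real^'n) \<times> (real^'n) \<Rightarrow> (real^'n) \<times> (real^'n) \<Rightarrow> (real^'n) \<times> (real^'n) \<Rightarrow> real"
    and J :: "(real^'n) \<times> (real^'n) \<Rightarrow> (real^'n) \<times> (real^'n) \<Rightarrow> (real^'n) \<times> (real^'n)"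
  assumes G_natural: "\<And>z t a2 b2 u v. z \<in> U \<times> UNIV \<Longrightarrow> t = en z \<Longrightarrow> a2 = 1 / a1 t \<Longrightarrow>
      b2 = - b1 t / (a1 t * (a1 t + 2 * t * b1 t)) \<Longrightarrow> G z u v =
      lam t * a1 t * g (fst z) (fst u) (fst v)
      + (lam t * b1 t + mu t * (a1 t + 2 * t * b1 t)) * g (fst z) (ps z) (fst u) * g (fst z) (ps z) (fst v)
      + (lam t * a2 * g (fst z) (Dv ps z u) (Dv ps z v)
      + (lam t * b2 + mu t * (a2 + 2 * t * b2)) * g (fst z) (ps z) (Dv ps z u) * g (fst z) (ps z) (Dv ps z v))"
    and J_natural: "\<And>z t a2 b2 v. z \<in> U \<times> UNIV \<Longrightarrow> t = en z \<Longrightarrow> a2 = 1 / a1 t \<Longrightarrow>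
      b2 = - b1 t / (a1 t * (a1 t + 2 * t * b1 t)) \<Longrightarrow> J z v =
      mk z (- (a2 *\<^sub>R Dv ps z v) - (b2 * g (fst z) (ps z) (Dv ps z v)) *\<^sub>R ps z)
        (a1 t *\<^sub>R fst v + (b1 t * g (fst z) (ps z) (fst v)) *\<^sub>R ps z)"
begin

definition ww where "ww z = sqrt (a1 (en z) * a1 (en z) - 2 * en z * c)"
definition rho where "rho z = 1 / (a1 (en z) + ww z)"
definition rr where
  "rr z = - (rho z * (halfline_deriv a1 (en z) + (a1 (en z) * halfline_deriv a1 (en z) - c) / ww z))"
definition S where "S z = rho z *\<^sub>R ps z"

lemma ww: "z \<in> W \<Longrightarrow> ww z > 0" "z \<in> W \<Longrightarrow> ww z * ww z = a1 (en z) * a1 (en z) - 2 * en z * c"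
  using radicand_pos[OF en_nonneg[of z]] by (simp_all add: ww_def)

lemma a1W: "z \<in> W \<Longrightarrow> a1 (en z) > 0"
  by (rule a1_pos[OF en_nonneg])

lemma a1_en_smooth: "smooth_on W (\<lambda>z. a1 (en z))"
  by (rule smooth_on_halfline_compose[OF a1_smooth open_W en_smooth en_nonneg])

lemma da1_en_smooth: "smooth_on W (\<lambda>z. halfline_deriv a1 (en z))"
  by (rule smooth_on_halfline_compose[OF smooth_halfline_D(2)[OF a1_smooth] open_W en_smooth en_nonneg])

lemma rad_smooth: "smooth_on W (\<lambda>z. a1 (en z) * a1 (en z) - 2 * en z * c)"
  by (intro smooth_on_diff smooth_on_mult a1_en_smooth en_smooth smooth_on_const open_W)

lemma ww_smooth: "smooth_on W ww"
  unfolding ww_def[abs_def]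
  by (intro smooth_on_sqrt rad_smooth open_W radicand_pos en_nonneg)

lemma rho_pos: "z \<in> W \<Longrightarrow> rho z > 0"
  using ww(1)[of z] a1W[of z] by (simp add: rho_def)

lemma rho_smooth: "smooth_on W rho"
proof -
  have "a1 (en z) + ww z \<noteq> 0" if "z \<in> W" for z using ww(1)[OF that] a1W[OF that] by simp
  then show ?thesis
    unfolding rho_def[abs_def]
    by (intro smooth_on_divide smooth_on_add smooth_on_const a1_en_smooth ww_smooth open_W)
qed

text \<open>From dw/dt = (a1 a1' - c) / w one sees that \<open>rr\<close> is the logarithmic
  derivative of \<open>rho\<close> in t; the derivative of the energy is \<langle>p, h\<rangle> for
  the raised vertical part h.\<close>

lemma dd_rho:
  assumes z: "z \<in> W"
  shows "dd rho z v = rho z * rr z * g (fst z) (ps z) (Dv ps z v)"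
proof -
  let ?A' = "halfline_deriv a1 (en z)" and ?e = "dd en z v"
  note sd = smooth_on_differentiable[OF _ z]
  have A: "dd (\<lambda>y. a1 (en y)) z v = ?e * ?A'"
    by (rule dd_halfline_compose[OF a1_smooth open_W z en_smooth en_nonneg])
  have 1: "dd (\<lambda>y. a1 (en y) * a1 (en y)) z v = 2 * a1 (en z) * (?e * ?A')"
    using dd_mult[OF sd[OF a1_en_smooth] sd[OF a1_en_smooth], of v] by (simp add: A)
  have 2: "dd (\<lambda>y. 2 * en y * c) z v = 2 * ?e * c"
  proof -
    have "dd (\<lambda>y. 2 * en y) z v = 2 * ?e"
      using dd_mult[OF differentiable_const sd[OF en_smooth]] by simp
    then show ?thesis
      using dd_mult[OF sd[OF smooth_on_mult[OF open_W smooth_on_const en_smooth]] differentiable_const]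
      by simp
  qed
  have "dd (\<lambda>y. a1 (en y) * a1 (en y) - 2 * en y * c) z v = 2 * a1 (en z) * (?e * ?A') - 2 * ?e * c"
  proof -
    have "smooth_on W (\<lambda>y. a1 (en y) * a1 (en y))" "smooth_on W (\<lambda>y. 2 * en y * c)"
      by (intro smooth_on_mult a1_en_smooth en_smooth smooth_on_const open_W)+
    from dd_diff[OF sd[OF this(1)] sd[OF this(2)], of v] show ?thesis by (simp only: 1 2)
  qed
  then have "dd ww z v = (2 * a1 (en z) * (?e * ?A') - 2 * ?e * c) / (2 * ww z)"
    unfolding ww_def[abs_def]
    using dd_sqrt[OF sd[OF rad_smooth] radicand_pos[OF en_nonneg[OF z]]] by simp
  then have w: "dd ww z v = ?e * ((a1 (en z) * ?A' - c) / ww z)"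
    using ww(1)[OF z] by (simp add: field_simps)
  have nz: "a1 (en z) + ww z \<noteq> 0" using ww(1)[OF z] a1W[OF z] by simp
  have "dd rho z v = - (dd (\<lambda>y. a1 (en y)) z v + dd ww z v) / ((a1 (en z) + ww z) * (a1 (en z) + ww z))"
    unfolding rho_def[abs_def]
    using dd_divide[OF differentiable_const sd[OF smooth_on_add[OF open_W a1_en_smooth ww_smooth]] nz, of 1 v]
      dd_add[OF sd[OF a1_en_smooth] sd[OF ww_smooth], of v] by simp
  also have "\<dots> = rho z * rr z * ?e"
    unfolding A w by (simp add: rr_def rho_def algebra_simps divide_simps)
  finally show ?thesis by (simp add: dd_en[OF z])
qed

lemma g_S_S: "z \<in> W \<Longrightarrow> g (fst z) (S z) (S z) = rho z * rho z * (2 * en z)"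
  by (simp add: S_def g_simps[OF fst_W] en_def)

definition b2 where "b2 z = - b1 (en z) / (a1 (en z) * (a1 (en z) + 2 * en z * b1 (en z)))"

lemma scalars:
  assumes z: "z \<in> W"
  shows "1 + c * (rho z * rho z * (2 * en z)) = 2 * a1 (en z) * rho z"
    and "b2 z - (c * rho z / a1 (en z)) * (1 / a1 (en z) + 2 * en z * b2 z) = rr z / a1 (en z)"
    and "b1 (en z) + rr z * (a1 (en z) + 2 * en z * b1 (en z)) = - (c * rho z)"
    and "lam (en z) * b1 (en z) + mu (en z) * (a1 (en z) + 2 * en z * b1 (en z))
      = k * (- 2 * (c * rho z / a1 (en z)) + (c * rho z / a1 (en z)) * (c * rho z / a1 (en z)) * (2 * en z))"
    and "lam (en z) * b2 z + mu (en z) * (1 / a1 (en z) + 2 * en z * b2 z)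
      = k * (2 * rr z + 2 * en z * rr z * rr z) / (a1 (en z) * a1 (en z))"
    and "1 - (c * rho z / a1 (en z)) * (2 * en z) = ww z / a1 (en z)"
proof -
  note t = en_nonneg[OF z]
  note s = gauge_scalars[OF a1W[OF z] ww[OF z] denom_pos[OF t], folded b1_eq[OF t] rho_def, folded rr_def, folded b2_def]
  note m = lam_eq[OF t] mu_eq[OF t] halfline_deriv_lam[OF t]
  show "1 + c * (rho z * rho z * (2 * en z)) = 2 * a1 (en z) * rho z" by (rule s(2))
  show "b2 z - (c * rho z / a1 (en z)) * (1 / a1 (en z) + 2 * en z * b2 z) = rr z / a1 (en z)" by (rule s(3))
  show "b1 (en z) + rr z * (a1 (en z) + 2 * en z * b1 (en z)) = - (c * rho z)" by (rule s(4))
  show "lam (en z) * b1 (en z) + mu (en z) * (a1 (en z) + 2 * en z * b1 (en z))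
      = k * (- 2 * (c * rho z / a1 (en z)) + (c * rho z / a1 (en z)) * (c * rho z / a1 (en z)) * (2 * en z))"
    unfolding m by (rule s(5))
  show "lam (en z) * b2 z + mu (en z) * (1 / a1 (en z) + 2 * en z * b2 z)
      = k * (2 * rr z + 2 * en z * rr z * rr z) / (a1 (en z) * a1 (en z))"
    unfolding m by (rule s(6))
  show "1 - (c * rho z / a1 (en z)) * (2 * en z) = ww z / a1 (en z)" by (rule s(7))
qed

text \<open>N = 2 a1 \<rho> is positive for either sign of c.\<close>

sublocale quadric_field U g c S
proof
  show "smooth_on W S"
    unfolding S_def[abs_def] by (rule smooth_on_scaleR[OF open_W rho_smooth ps_smooth])
  show "1 + c * g (fst z) (S z) (S z) \<noteq> 0" if "z \<in> W" for z
    unfolding g_S_S[OF that] scalars(1)[OF that] using a1W[OF that] rho_pos[OF that] by simp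
qed

lemma nn_eq: "z \<in> W \<Longrightarrow> nn z = 1 / (2 * a1 (en z) * rho z)"
  unfolding nn_def by (simp only: g_S_S scalars(1) inverse_eq_divide)

lemma alpha_eq: "z \<in> W \<Longrightarrow>
    alpha z v = fst v - (c * rho z / a1 (en z) * g (fst z) (ps z) (fst v)) *\<^sub>R ps z"
  using rho_pos[of z] a1W[of z] by (simp add: alpha_def kap_def nn_eq S_def g_simps[OF fst_W])

text \<open>The factor 2\<rho>/N equals 1/a1, and the derivative of \<rho> contributes the term with
  \<open>rr\<close>.\<close>

lemma beta_eq: "z \<in> W \<Longrightarrow> beta z v =
    (1 / a1 (en z)) *\<^sub>R (Dv ps z v + (rr z * g (fst z) (ps z) (Dv ps z v)) *\<^sub>R ps z)"
proof -
  assume z: "z \<in> W"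
  have "S = (\<lambda>y. rho y *\<^sub>R ps y)" by (simp add: S_def fun_eq_iff)
  then have "Dv S z v = (rho z * rr z * g (fst z) (ps z) (Dv ps z v)) *\<^sub>R ps z + rho z *\<^sub>R Dv ps z v"
    using Dv_scaleR[OF z smooth_on_differentiable[OF rho_smooth z] smooth_on_differentiable[OF ps_smooth z]]
    by (simp only: dd_rho[OF z])
  then have "tau z v = (rho z * rr z * g (fst z) (ps z) (Dv ps z v)) *\<^sub>R ps z + rho z *\<^sub>R Dv ps z v"
    by (simp only: tau_def)
  then show ?thesis
    using rho_pos[OF z] a1W[OF z] by (simp add: beta_def nn_eq[OF z] algebra_simps)
qed

lemma g_ps_ps: "g (fst z) (ps z) (ps z) = 2 * en z"
  by (simp add: en_def)

lemma J_eq: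
  assumes z: "z \<in> W"
  shows "J z v = mk z (- ((1 / a1 (en z)) *\<^sub>R Dv ps z v) - (b2 z * g (fst z) (ps z) (Dv ps z v)) *\<^sub>R ps z)
        (a1 (en z) *\<^sub>R fst v + (b1 (en z) * g (fst z) (ps z) (fst v)) *\<^sub>R ps z)"
  by (rule J_natural[OF z refl refl b2_def])

lemma J_parts:
  assumes z: "z \<in> W"
  shows "fst (J z v) = - ((1 / a1 (en z)) *\<^sub>R Dv ps z v) - (b2 z * g (fst z) (ps z) (Dv ps z v)) *\<^sub>R ps z"
    and "Dv ps z (J z v) = a1 (en z) *\<^sub>R fst v + (b1 (en z) * g (fst z) (ps z) (fst v)) *\<^sub>R ps z"
  by (simp_all add: J_eq[OF z] Dv_ps_mk[OF z])

text \<open>Writing \<psi> = \<alpha> + i\<beta>, the claim is \<alpha> J = - \<beta> and \<beta> J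
  = \<alpha>. Orthogonally to p both are immediate; along p they are the second and third identities
  of \<open>scalars\<close>.\<close>

lemma psi_J:
  assumes z: "z \<in> W"
  shows "psi z (J z v) = rot (psi z v)"
proof -
  note gs = g_simps[OF fst_W[OF z]]
  let ?A = "a1 (en z)" and ?P = "ps z" and ?h = "Dv ps z v" and ?x = "fst v"
  let ?Ph = "g (fst z) ?P ?h" and ?Px = "g (fst z) ?P ?x"
  define Y where "Y = g (fst z) ?P (fst (J z v))"
  have Y: "Y = - (1 / ?A * ?Ph) - b2 z * ?Ph * (2 * en z)"
    unfolding Y_def J_parts[OF z] gs g_ps_ps ..
  have "alpha z (J z v) = - ((1 / ?A) *\<^sub>R ?h) - (b2 z * ?Ph) *\<^sub>R ?P - (c * rho z / ?A * Y) *\<^sub>R ?P"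
    unfolding alpha_eq[OF z] Y_def by (simp only: J_parts(1)[OF z])
  also have "\<dots> = - ((1 / ?A) *\<^sub>R ?h) - (b2 z * ?Ph + c * rho z / ?A * Y) *\<^sub>R ?P"
    by (simp only: scaleR_add_left diff_diff_eq)
  also have "b2 z * ?Ph + c * rho z / ?A * Y = (b2 z - (c * rho z / ?A) * (1 / ?A + 2 * en z * b2 z)) * ?Ph"
    unfolding Y by (simp only: algebra_simps minus_mult_right)
  finally have "alpha z (J z v) = - ((1 / ?A) *\<^sub>R ?h)
      - ((b2 z - (c * rho z / ?A) * (1 / ?A + 2 * en z * b2 z)) * ?Ph) *\<^sub>R ?P" .
  then have 1: "alpha z (J z v) = - beta z v"
    unfolding scalars(2)[OF z] beta_eq[OF z] by (simp add: algebra_simps)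
  have "beta z (J z v) = (1 / ?A) *\<^sub>R (?A *\<^sub>R ?x
      + ((b1 (en z) + rr z * (?A + 2 * en z * b1 (en z))) * ?Px) *\<^sub>R ?P)"
    unfolding beta_eq[OF z] J_parts[OF z]
    by (simp add: gs g_ps_ps) (simp add: algebra_simps)
  then have 2: "beta z (J z v) = alpha z v"
    unfolding scalars(3)[OF z] alpha_eq[OF z] using a1W[OF z] by (simp add: algebra_simps)
  show ?thesis using 1 2 by (simp add: psi_def rot_def)
qed

text \<open>Away from the direction of p both sides agree since \<lambda> = k/a1; the coefficients
  d1 and d2 are the fourth and fifth identities of \<open>scalars\<close>.\<close>

lemma G_mm:
  assumes z: "z \<in> W"
  shows "G z u v = mm k z (psi z u) (psi z v)"
proof -
  note gs = g_simps[OF fst_W[OF z]]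
  let ?A = "a1 (en z)" and ?P = "ps z" and ?h = "Dv ps z u" and ?x = "fst u" and ?h' = "Dv ps z v" and ?x' = "fst v"
  let ?Ph = "g (fst z) ?P ?h" and ?Px = "g (fst z) ?P ?x" and ?Ph' = "g (fst z) ?P ?h'" and ?Px' = "g (fst z) ?P ?x'"
  have s: "g (fst z) ?x ?P = ?Px" "g (fst z) ?h ?P = ?Ph" by (rule g_sym[OF fst_W[OF z]])+
  have "g (fst z) (alpha z u) (alpha z v) = g (fst z) ?x ?x'
     + (- 2 * (c * rho z / ?A) + (c * rho z / ?A) * (c * rho z / ?A) * (2 * en z)) * ?Px * ?Px'"
    unfolding alpha_eq[OF z] gs s g_ps_ps by (simp only: algebra_simps)
  moreover have "g (fst z) (beta z u) (beta z v) = (1 / ?A) * ((1 / ?A) * (g (fst z) ?h ?h'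
     + (2 * rr z + 2 * en z * rr z * rr z) * ?Ph * ?Ph'))"
    unfolding beta_eq[OF z] gs s g_ps_ps by (simp add: algebra_simps)
  moreover have "lam (en z) = k / ?A" by (rule lam_eq[OF en_nonneg[OF z]])
  ultimately show ?thesis
    unfolding G_natural[OF z refl refl b2_def] scalars(4,5)[OF z] mm_def psi_def
    using a1W[OF z] by (simp add: distrib_left mult.assoc)
qed

text \<open>The inverse of \<alpha> on horizontal vectors, a rank one correction of the identity:
  \<alpha> scales p by w/a1, and \<open>xx\<close> by a1/w. In \<open>theta\<close> the imaginary
  part is reached through J, because \<psi> J = i \<psi>.\<close>

definition xx where "xx z a = a + (c * rho z / ww z * g (fst z) (ps z) a) *\<^sub>R ps z"
definition theta where "theta z ab = mk z (xx z (fst ab)) 0 + J z (mk z (xx z (snd ab)) 0)"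

lemma psi_hor: "z \<in> W \<Longrightarrow> psi z (mk z (xx z a) 0) = (a, 0)"
proof -
  assume z: "z \<in> W"
  note gs = g_simps[OF fst_W[OF z]]
  let ?A = "a1 (en z)" and ?w = "ww z" and ?Pa = "g (fst z) (ps z) a"
  have "alpha z (mk z (xx z a) 0) = a + (c * rho z / ?w - c * rho z / ?A * (1 + c * rho z / ?w * (2 * en z))) *\<^sub>R ?Pa *\<^sub>R ps z"
    unfolding alpha_eq[OF z] fst_mk xx_def gs g_ps_ps by (simp add: algebra_simps)
  also have "c * rho z / ?w - c * rho z / ?A * (1 + c * rho z / ?w * (2 * en z))
      = c * rho z / ?w * (1 - c * rho z / ?A * (2 * en z)) - c * rho z / ?A"
    by (simp add: algebra_simps)
  also have "\<dots> = 0" unfolding scalars(6)[OF z] using ww(1)[OF z] by simp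
  finally have "alpha z (mk z (xx z a) 0) = a" by simp
  moreover have "beta z (mk z (xx z a) 0) = 0"
    by (simp add: beta_eq[OF z] Dv_ps_mk[OF z] gs)
  ultimately show ?thesis by (simp add: psi_def)
qed

lemma psi_theta: "z \<in> W \<Longrightarrow> psi z (theta z ab) = ab"
  by (simp add: theta_def linear_add[OF psi_linear] psi_J psi_hor rot_def)

lemma linear_theta:
  assumes z: "z \<in> W"
  shows "linear (theta z)"
proof -
  note gs = g_simps[OF fst_W[OF z]]
  have inj: "u = v" if "psi z u = psi z v" for u v
  proof -
    have "linear (psi z)" by (rule psi_linear[OF z])
    moreover have "surj (psi z)" using psi_theta[OF z] by (metis surjI)
    ultimately have "inj (psi z)" using linear_surjective_imp_injective by blast
    then show ?thesis using that by (simp add: inj_eq)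
  qed
  show ?thesis
    by (rule linearI; rule inj) (simp_all add: linear_add[OF psi_linear[OF z]] linear_cmul[OF psi_linear[OF z]] psi_theta[OF z])
qed

text \<open>\<open>theta\<close> is a right inverse of a linear endomorphism of a finite dimensional
  space, hence also a left inverse.\<close>

lemma theta_psi:
  assumes z: "z \<in> W"
  shows "theta z (psi z v) = v"
proof -
  have "psi z \<circ> theta z = id" using psi_theta[OF z] by (simp add: fun_eq_iff)
  then have "theta z \<circ> psi z = id"
    using linear_inverse_left[OF psi_linear[OF z] linear_theta[OF z]] by blast
  then show ?thesis by (metis comp_apply id_apply)
qed

lemma b1_smooth: "smooth_on W (\<lambda>z. b1 (en z))"
proof -
  have e: "b1 (en z) = (a1 (en z) * halfline_deriv a1 (en z) - c) / (a1 (en z) - 2 * en z * halfline_deriv a1 (en z))"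
    if "z \<in> W" for z
    by (rule b1_eq[OF en_nonneg[OF that]])
  have "smooth_on W (\<lambda>z. (a1 (en z) * halfline_deriv a1 (en z) - c) / (a1 (en z) - 2 * en z * halfline_deriv a1 (en z)))"
    by (intro smooth_on_divide smooth_on_diff smooth_on_mult smooth_on_const a1_en_smooth da1_en_smooth en_smooth
        open_W a1_denom en_nonneg)
  then show ?thesis by (simp only: smooth_on_cong[OF open_W e])
qed

lemma b2_smooth: "smooth_on W b2"
proof -
  have "a1 (en z) * (a1 (en z) + 2 * en z * b1 (en z)) \<noteq> 0" if "z \<in> W" for z
    using a1W[OF that] ab_pos[OF en_nonneg[OF that]] by simp
  then show ?thesis
    unfolding b2_def[abs_def]
    by (intro smooth_on_divide smooth_on_minus smooth_on_add smooth_on_mult smooth_on_const a1_en_smooth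
        b1_smooth en_smooth open_W)
qed

lemma ia_smooth: "smooth_on W (\<lambda>z. 1 / a1 (en z))"
  using a1W by (intro smooth_on_divide smooth_on_const a1_en_smooth open_W) fastforce

lemma J_app_smooth:
  assumes x: "smooth_on W x" and h: "smooth_on W h"
  shows "smooth_on W (\<lambda>z. J z (mk z (x z) (h z)))"
proof -
  have e: "J z (mk z (x z) (h z)) = mk z (- ((1 / a1 (en z)) *\<^sub>R h z) - (b2 z * g (fst z) (ps z) (h z)) *\<^sub>R ps z)
        (a1 (en z) *\<^sub>R x z + (b1 (en z) * g (fst z) (ps z) (x z)) *\<^sub>R ps z)" if "z \<in> W" for z
    by (simp add: J_eq[OF that] Dv_ps_mk[OF that])
  have "smooth_on W (\<lambda>z. mk z (- ((1 / a1 (en z)) *\<^sub>R h z) - (b2 z * g (fst z) (ps z) (h z)) *\<^sub>R ps z)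
        (a1 (en z) *\<^sub>R x z + (b1 (en z) * g (fst z) (ps z) (x z)) *\<^sub>R ps z))"
    by (intro mk_smooth smooth_on_diff smooth_on_minus smooth_on_add smooth_on_scaleR smooth_on_mult g_app_smooth
        x h ps_smooth ia_smooth b2_smooth b1_smooth a1_en_smooth open_W)
  then show ?thesis by (simp only: smooth_on_cong[OF open_W e])
qed

lemma xx_smooth: "smooth_on W (\<lambda>z. xx z a)"
proof -
  have "ww z \<noteq> 0" if "z \<in> W" for z using ww(1)[OF that] by simp
  then show ?thesis
    unfolding xx_def
    by (intro smooth_on_add smooth_on_scaleR smooth_on_divide smooth_on_mult smooth_on_const g_app_smooth
        ps_smooth rho_smooth ww_smooth open_W)
qed

lemma theta_smooth: "smooth_on W (\<lambda>z. theta z ab)"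
  unfolding theta_def
  by (intro smooth_on_add open_W mk_smooth J_app_smooth xx_smooth smooth_on_const)

sublocale quadric_gauge U g c S theta k G J
  by unfold_locales (rule k_gt_0 psi_theta theta_psi theta_smooth G_mm psi_J; assumption)+

end

section \<open>From values on the frame to arbitrary vectors\<close>

lemma linear_eq_axis:
  fixes f f' :: "real^'n \<Rightarrow> 'b::real_vector"
  assumes "linear f" "linear f'" "\<And>i. f (axis i 1) = f' (axis i 1)"
  shows "f x = f' x"
proof -
  have "f x = f (\<Sum>i\<in>UNIV. x $ i *\<^sub>R axis i 1)" "f' x = f' (\<Sum>i\<in>UNIV. x $ i *\<^sub>R axis i 1)"
    by (simp_all add: basis_expansion flip: scalar_mult_eq_scaleR)
  then show ?thesis
    by (simp only: linear_sum[OF assms(1)] linear_sum[OF assms(2)] linear_cmul[OF assms(1)]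
        linear_cmul[OF assms(2)] assms(3))
qed

lemma bilinear_eq_axis:
  fixes f f' :: "real^'n \<Rightarrow> real^'m \<Rightarrow> real"
  assumes "bilinear f" "bilinear f'" "\<And>i j. f (axis i 1) (axis j 1) = f' (axis i 1) (axis j 1)"
  shows "f x y = f' x y"
proof -
  have l: "linear (f x)" "linear (f' x)" "linear (\<lambda>x. f x y)" "linear (\<lambda>x. f' x y)" for x y
    using assms(1,2) by (simp_all add: bilinear_def)
  have "f (axis i 1) y = f' (axis i 1) y" for i
    by (rule linear_eq_axis[OF l(1,2) assms(3)])
  from linear_eq_axis[OF l(3,4) this] show ?thesis .
qed

lemma axis_expansion: "(\<Sum>i\<in>UNIV. x $ i *\<^sub>R axis i 1) = (x :: real^'n)"
  by (simp add: basis_expansion flip: scalar_mult_eq_scaleR)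

context metric_chart
begin

lemma sum_sharp: "(\<Sum>j\<in>UNIV. a $ j *\<^sub>R sharp q (axis j 1)) = sharp q a"
proof -
  have "sharp q a = sharp q (\<Sum>j\<in>UNIV. a $ j *\<^sub>R axis j 1)" by (simp only: axis_expansion)
  then show ?thesis by (simp only: linear_sum[OF linear_sharp] linear_cmul[OF linear_sharp])
qed

lemma metric_upper_nth: "q \<in> U \<Longrightarrow> metric_upper g q $ i $ j = g q (sharp q (axis i 1)) (sharp q (axis j 1))"
proof -
  assume q: "q \<in> U"
  have "metric_upper g q $ i $ j = sharp q (axis j 1) $ i"
    by (simp add: sharp_def matrix_vector_mult_basis column_def)
  also have "\<dots> = axis i 1 \<bullet> sharp q (axis j 1)" by (simp add: inner_axis')
  finally show ?thesis by (simp add: g_sharp[OF q])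
qed

lemma metric_upper_row: "q \<in> U \<Longrightarrow> metric_upper g q $ i $ j = sharp q (axis i 1) $ j"
proof -
  assume q: "q \<in> U"
  have "metric_upper g q $ i $ j = metric_upper g q $ j $ i"
    using metric_upper_nth[OF q] g_sym[OF q] by metis
  also have "\<dots> = sharp q (axis i 1) $ j"
    by (simp add: sharp_def matrix_vector_mult_basis column_def)
  finally show ?thesis .
qed

lemma sharp_metric_lower: "q \<in> U \<Longrightarrow> sharp q (metric_lower g q *v x) = x"
  using metric_lower_mult by (metis sharp_eqI)

lemma metric_lower_nth: "metric_lower g q $ i $ j = g q (axis i 1) (axis j 1)"
  by (simp add: metric_lower_def)

lemma sum_lower_sharp: "q \<in> U \<Longrightarrow> (\<Sum>j\<in>UNIV. g q x (axis j 1) *\<^sub>R sharp q (axis j 1)) = x"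
proof -
  assume q: "q \<in> U"
  have "(metric_lower g q *v x) $ j = g q x (axis j 1)" for j
    using metric_lower_mult[OF q, of x "axis j 1"] by (simp add: inner_axis)
  then show ?thesis using sum_sharp[of "metric_lower g q *v x" q] sharp_metric_lower[OF q] by simp
qed

lemma p_raised_eq: "q \<in> U \<Longrightarrow> p_raised g q p i = ps (q, p) $ i"
proof -
  assume q: "q \<in> U"
  have "metric_upper g q $ h $ i = metric_upper g q $ i $ h" for h
    using metric_upper_nth[OF q] g_sym[OF q] by metis
  then show ?thesis
    by (simp add: p_raised_def ps_def sharp_def matrix_vector_mult_def mult.commute)
qed

lemma ps_nth: "q \<in> U \<Longrightarrow> ps (q, p) $ i = g q (ps (q, p)) (sharp q (axis i 1))"
  using g_sharp[of q "axis i 1" "ps (q, p)"] g_sym[of q] by (simp add: inner_axis')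

lemma p_nth: "q \<in> U \<Longrightarrow> p $ i = g q (ps (q, p)) (axis i 1)"
  using g_ps[of "(q, p)" "axis i 1"] by (simp add: inner_axis)

lemma energy_eq: "q \<in> U \<Longrightarrow> energy g q p = en (q, p)"
proof -
  assume q: "q \<in> U"
  have "g q (ps (q, p)) (ps (q, p)) = p \<bullet> sharp q p"
    by (simp add: ps_def g_sharp[OF q])
  also have "\<dots> = (\<Sum>i\<in>UNIV. \<Sum>k\<in>UNIV. metric_upper g q $ i $ k * p $ i * p $ k)"
    by (simp add: sharp_def inner_vec_def matrix_vector_mult_def sum_distrib_left mult_ac)
  finally show ?thesis by (simp add: energy_def en_def)
qed

lemma hor_eq: "hor g q p i = mk (q, p) (axis i 1) 0"
proof -
  have "(\<Sum>h\<in>UNIV. Gamma0 g q p i h *\<^sub>R axis h (1::real))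
      = (\<Sum>h\<in>UNIV. gam0 (q, p) (axis i 1) $ h *\<^sub>R axis h 1)"
    by (simp add: Gamma0_def gam0_def inner_vec_def)
  then show ?thesis by (simp only: hor_def mk_def axis_expansion) simp
qed

lemma vert_eq: "q \<in> U \<Longrightarrow> vert i = mk (q, p) 0 (sharp q (axis i 1))"
  using linear_0[OF linear_gam0[of "(q, p)"]] by (simp add: vert_def mk_def metric_lower_sharp)

lemma mk_split: "z \<in> W \<Longrightarrow> mk z x h = mk z x 0 + mk z 0 h"
  using mk_linear(1)[of z x 0 0 h] by simp

lemma linear_mk: "z \<in> W \<Longrightarrow> linear (\<lambda>x. mk z x 0)" "z \<in> W \<Longrightarrow> linear (mk z 0)"
  by (rule linearI; use mk_linear(1)[of z] mk_linear(2)[of z] in \<open>metis add_0 scaleR_zero_right\<close>)+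

text \<open>Both sides are linear, so horizontal and vertical arguments are compared on a basis
  separately. Vertical vectors are parametrized by covectors through \<open>sharp\<close>, so that
  coordinate covectors give the fields \<partial>; every raised vector is reached since
  \<open>sharp\<close> is onto.\<close>

lemma natural_J_vector:
  assumes q: "q \<in> U" and JJ: "linear JJ"
    and hor: "\<And>i. JJ (hor g q p i) = (\<Sum>j\<in>UNIV. (a * metric_lower g q $ i $ j + b * p $ i * p $ j) *\<^sub>R vert j)"
    and vert: "\<And>i. JJ (vert i) = (\<Sum>j\<in>UNIV. (- a' * metric_upper g q $ i $ j
        - b' * p_raised g q p i * p_raised g q p j) *\<^sub>R hor g q p j)"
  shows "JJ v = mk (q, p) (- (a' *\<^sub>R Dv ps (q, p) v) - (b' * g q (ps (q, p)) (Dv ps (q, p) v)) *\<^sub>R ps (q, p))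
      (a *\<^sub>R fst v + (b * g q (ps (q, p)) (fst v)) *\<^sub>R ps (q, p))"
proof -
  let ?z = "(q, p)" and ?P = "ps (q, p)"
  have z: "?z \<in> W" using q by simp
  note gs = g_simps[OF q]
  note l1 = linear_mk(1)[OF z] and l2 = linear_mk(2)[OF z]
  have h: "JJ (mk ?z x 0) = mk ?z 0 (a *\<^sub>R x + (b * g q ?P x) *\<^sub>R ?P)" for x
  proof (rule linear_eq_axis[of "\<lambda>x. JJ (mk ?z x 0)"])
    show "linear (\<lambda>x. JJ (mk ?z x 0))" using linear_compose[OF l1 JJ] by (simp add: o_def)
    have "linear (\<lambda>x. a *\<^sub>R x + (b * g q ?P x) *\<^sub>R ?P)"
      by (rule linearI) (simp_all add: gs algebra_simps)
    from linear_compose[OF this l2] show "linear (\<lambda>x. mk ?z 0 (a *\<^sub>R x + (b * g q ?P x) *\<^sub>R ?P))"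
      by (simp add: o_def)
  next
    fix i :: 'n
    have "JJ (mk ?z (axis i 1) 0)
        = (\<Sum>j\<in>UNIV. (a * g q (axis i 1) (axis j 1) + b * p $ i * p $ j) *\<^sub>R mk ?z 0 (sharp q (axis j 1)))"
      using hor[of i] by (simp only: hor_eq vert_eq[OF q, of _ p] metric_lower_nth)
    also have "\<dots> = mk ?z 0 (\<Sum>j\<in>UNIV. (a * g q (axis i 1) (axis j 1) + b * p $ i * p $ j) *\<^sub>R sharp q (axis j 1))"
      by (simp only: linear_sum[OF l2] linear_cmul[OF l2])
    also have "(\<Sum>j\<in>UNIV. (a * g q (axis i 1) (axis j 1) + b * p $ i * p $ j) *\<^sub>R sharp q (axis j 1))
        = a *\<^sub>R (\<Sum>j\<in>UNIV. g q (axis i 1) (axis j 1) *\<^sub>R sharp q (axis j 1))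
          + (b * p $ i) *\<^sub>R (\<Sum>j\<in>UNIV. p $ j *\<^sub>R sharp q (axis j 1))"
      by (simp add: scaleR_add_left sum.distrib scaleR_sum_right)
    also have "\<dots> = a *\<^sub>R axis i 1 + (b * g q ?P (axis i 1)) *\<^sub>R ?P"
      by (simp only: sum_lower_sharp[OF q] sum_sharp p_nth[OF q, of p i]) (simp add: ps_def)
    finally show "JJ (mk ?z (axis i 1) 0) = mk ?z 0 (a *\<^sub>R axis i 1 + (b * g q ?P (axis i 1)) *\<^sub>R ?P)" .
  qed
  have v: "JJ (mk ?z 0 (sharp q x)) = mk ?z (- (a' *\<^sub>R sharp q x) - (b' * g q ?P (sharp q x)) *\<^sub>R ?P) 0" for x
  proof (rule linear_eq_axis[of "\<lambda>x. JJ (mk ?z 0 (sharp q x))"])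
    have "linear (\<lambda>x. mk ?z 0 (sharp q x))" using linear_compose[OF linear_sharp l2] by (simp add: o_def)
    from linear_compose[OF this JJ] show "linear (\<lambda>x. JJ (mk ?z 0 (sharp q x)))" by (simp add: o_def)
    have "linear (\<lambda>x. - (a' *\<^sub>R sharp q x) - (b' * g q ?P (sharp q x)) *\<^sub>R ?P)"
      by (rule linearI) (simp_all add: gs linear_add[OF linear_sharp] linear_cmul[OF linear_sharp] algebra_simps)
    from linear_compose[OF this l1]
    show "linear (\<lambda>x. mk ?z (- (a' *\<^sub>R sharp q x) - (b' * g q ?P (sharp q x)) *\<^sub>R ?P) 0)"
      by (simp add: o_def)
  next
    fix i :: 'n
    have "JJ (mk ?z 0 (sharp q (axis i 1)))
        = (\<Sum>j\<in>UNIV. (- a' * sharp q (axis i 1) $ j - b' * ?P $ i * ?P $ j) *\<^sub>R mk ?z (axis j 1) 0)"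
      using vert[of i] by (simp only: hor_eq vert_eq[OF q, of _ p] metric_upper_row[OF q] p_raised_eq[OF q])
    also have "\<dots> = mk ?z (\<Sum>j\<in>UNIV. (- a' * sharp q (axis i 1) $ j - b' * ?P $ i * ?P $ j) *\<^sub>R axis j 1) 0"
      by (simp only: linear_sum[OF l1] linear_cmul[OF l1])
    also have "(\<Sum>j\<in>UNIV. (- a' * sharp q (axis i 1) $ j - b' * ?P $ i * ?P $ j) *\<^sub>R axis j (1::real))
        = - (a' *\<^sub>R (\<Sum>j\<in>UNIV. sharp q (axis i 1) $ j *\<^sub>R axis j 1))
          - (b' * ?P $ i) *\<^sub>R (\<Sum>j\<in>UNIV. ?P $ j *\<^sub>R axis j 1)"
      unfolding scaleR_sum_right scaleR_scaleR sum_negf[symmetric] sum_subtractf[symmetric]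
      by (intro sum.cong refl) (simp only: scaleR_diff_left scaleR_minus_left mult_minus_left mult.assoc)
    also have "\<dots> = - (a' *\<^sub>R sharp q (axis i 1)) - (b' * g q ?P (sharp q (axis i 1))) *\<^sub>R ?P"
      by (simp only: axis_expansion) (simp only: ps_nth[OF q])
    finally show "JJ (mk ?z 0 (sharp q (axis i 1)))
        = mk ?z (- (a' *\<^sub>R sharp q (axis i 1)) - (b' * g q ?P (sharp q (axis i 1))) *\<^sub>R ?P) 0" .
  qed
  have v': "JJ (mk ?z 0 h) = mk ?z (- (a' *\<^sub>R h) - (b' * g q ?P h) *\<^sub>R ?P) 0" for h
    using v[of "metric_lower g q *v h"] by (simp only: sharp_metric_lower[OF q])
  let ?h = "Dv ps ?z v"
  have "v = mk ?z (fst v) 0 + mk ?z 0 (sharp q (metric_lower g q *v ?h))"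
    using mk_Dv_ps[OF z, of v] mk_split[OF z, of "fst v" "Dv ps ?z v"] by (simp only: sharp_metric_lower[OF q])
  then have "JJ v = JJ (mk ?z (fst v) 0) + JJ (mk ?z 0 (sharp q (metric_lower g q *v ?h)))"
    using linear_add[OF JJ, of "mk ?z (fst v) 0" "mk ?z 0 (sharp q (metric_lower g q *v ?h))"] by (simp only:)
  also have "\<dots> = mk ?z 0 (a *\<^sub>R fst v + (b * g q ?P (fst v)) *\<^sub>R ?P)
      + mk ?z (- (a' *\<^sub>R ?h) - (b' * g q ?P ?h) *\<^sub>R ?P) 0"
    by (simp only: h v' sharp_metric_lower[OF q])
  finally show ?thesis
    using mk_split[OF z, of "- (a' *\<^sub>R ?h) - (b' * g q ?P ?h) *\<^sub>R ?P"
        "a *\<^sub>R fst v + (b * g q ?P (fst v)) *\<^sub>R ?P"] by (simp only: add.commute)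
qed

lemma natural_G_vector:
  assumes q: "q \<in> U" and GG: "bilinear GG" "\<And>v w. GG v w = GG w v"
    and hh: "\<And>i j. GG (hor g q p i) (hor g q p j) = c1 * metric_lower g q $ i $ j + d1 * p $ i * p $ j"
    and vv: "\<And>i j. GG (vert i) (vert j) = c2 * metric_upper g q $ i $ j + d2 * p_raised g q p i * p_raised g q p j"
    and vh: "\<And>i j. GG (vert i) (hor g q p j) = 0"
  shows "GG u v = c1 * g q (fst u) (fst v) + d1 * g q (ps (q, p)) (fst u) * g q (ps (q, p)) (fst v)
     + (c2 * g q (Dv ps (q, p) u) (Dv ps (q, p) v)
     + d2 * g q (ps (q, p)) (Dv ps (q, p) u) * g q (ps (q, p)) (Dv ps (q, p) v))"
proof -
  let ?z = "(q, p)" and ?P = "ps (q, p)"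
  have z: "?z \<in> W" using q by simp
  note gs = g_simps[OF q]
  note l1 = linear_mk(1)[OF z] and l2 = linear_mk(2)[OF z]
  note mkl = linear_add[OF l1] linear_add[OF l2] linear_cmul[OF l1] linear_cmul[OF l2]
    linear_add[OF linear_sharp] linear_cmul[OF linear_sharp]
    bilinear_ladd[OF GG(1)] bilinear_radd[OF GG(1)] bilinear_lmul[OF GG(1)] bilinear_rmul[OF GG(1)]
  have 1: "GG (mk ?z x 0) (mk ?z y 0) = c1 * g q x y + d1 * g q ?P x * g q ?P y" for x y
  proof (rule bilinear_eq_axis[of "\<lambda>x y. GG (mk ?z x 0) (mk ?z y 0)"])
    show "bilinear (\<lambda>x y. GG (mk ?z x 0) (mk ?z y 0))"
      unfolding bilinear_def by (intro conjI allI linearI) (simp_all add: mkl)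
    show "bilinear (\<lambda>x y. c1 * g q x y + d1 * g q ?P x * g q ?P y)"
      unfolding bilinear_def by (intro conjI allI linearI) (simp_all add: gs algebra_simps)
    show "GG (mk ?z (axis i 1) 0) (mk ?z (axis j 1) 0)
        = c1 * g q (axis i 1) (axis j 1) + d1 * g q ?P (axis i 1) * g q ?P (axis j 1)" for i j
      using hh[of i j] by (simp only: hor_eq metric_lower_nth p_nth[OF q, of p])
  qed
  have 2: "GG (mk ?z 0 (sharp q x)) (mk ?z 0 (sharp q y))
      = c2 * g q (sharp q x) (sharp q y) + d2 * g q ?P (sharp q x) * g q ?P (sharp q y)" for x y
  proof (rule bilinear_eq_axis[of "\<lambda>x y. GG (mk ?z 0 (sharp q x)) (mk ?z 0 (sharp q y))"])
    show "bilinear (\<lambda>x y. GG (mk ?z 0 (sharp q x)) (mk ?z 0 (sharp q y)))"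
      unfolding bilinear_def by (intro conjI allI linearI) (simp_all add: mkl)
    show "bilinear (\<lambda>x y. c2 * g q (sharp q x) (sharp q y) + d2 * g q ?P (sharp q x) * g q ?P (sharp q y))"
      unfolding bilinear_def by (intro conjI allI linearI) (simp_all add: gs mkl algebra_simps)
    show "GG (mk ?z 0 (sharp q (axis i 1))) (mk ?z 0 (sharp q (axis j 1)))
      = c2 * g q (sharp q (axis i 1)) (sharp q (axis j 1))
        + d2 * g q ?P (sharp q (axis i 1)) * g q ?P (sharp q (axis j 1))" for i j
      using vv[of i j]
      by (simp only: vert_eq[OF q, of _ p] metric_upper_nth[OF q] p_raised_eq[OF q] ps_nth[OF q])
  qed
  have 3: "GG (mk ?z 0 (sharp q x)) (mk ?z y 0) = 0" for x y
  proof (rule bilinear_eq_axis[of "\<lambda>x y. GG (mk ?z 0 (sharp q x)) (mk ?z y 0)" "\<lambda>_ _. 0"])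
    show "bilinear (\<lambda>x y. GG (mk ?z 0 (sharp q x)) (mk ?z y 0))"
      unfolding bilinear_def by (intro conjI allI linearI) (simp_all add: mkl)
    show "bilinear (\<lambda>(_ :: real^'n) (_ :: real^'n). 0 :: real)"
      unfolding bilinear_def by (intro conjI allI linearI) simp_all
    show "GG (mk ?z 0 (sharp q (axis i 1))) (mk ?z (axis j 1) 0) = 0" for i j
      using vh[of i j] by (simp only: hor_eq vert_eq[OF q, of _ p])
  qed
  have 2: "GG (mk ?z 0 x) (mk ?z 0 y) = c2 * g q x y + d2 * g q ?P x * g q ?P y" for x y
    using 2[of "metric_lower g q *v x" "metric_lower g q *v y"] by (simp only: sharp_metric_lower[OF q])
  have dec: "v = mk ?z (fst v) 0 + mk ?z 0 (sharp q (metric_lower g q *v Dv ps ?z v))" for v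
    using mk_Dv_ps[OF z, of v] mk_split[OF z, of "fst v" "Dv ps ?z v"] by (simp only: sharp_metric_lower[OF q])
  have "GG u v = GG (mk ?z (fst u) 0 + mk ?z 0 (sharp q (metric_lower g q *v Dv ps ?z u)))
      (mk ?z (fst v) 0 + mk ?z 0 (sharp q (metric_lower g q *v Dv ps ?z v)))"
    by (simp only: dec[symmetric])
  also have "\<dots> = GG (mk ?z (fst u) 0) (mk ?z (fst v) 0)
      + GG (mk ?z 0 (sharp q (metric_lower g q *v Dv ps ?z u))) (mk ?z 0 (sharp q (metric_lower g q *v Dv ps ?z v)))"
    using GG(2)[of "mk ?z (fst u) 0" "mk ?z 0 (sharp q (metric_lower g q *v Dv ps ?z v))"]
    by (simp add: bilinear_ladd[OF GG(1)] bilinear_radd[OF GG(1)] 3)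
  finally show ?thesis by (simp only: 1 2 sharp_metric_lower[OF q])
qed

end

section \<open>Change of charts\<close>

locale chart_change = X: metric_chart U g + Y: metric_chart U' g'
  for U :: "(real^'n) set" and g and U' :: "(real^'n) set" and g' +
  fixes V V' :: "(real^'n) set" and \<phi> \<phi>' :: "real^'n \<Rightarrow> real^'n"
  assumes open_V: "open V" and V_U: "V \<subseteq> U" and open_V': "open V'"
    and phi_V: "q \<in> V \<Longrightarrow> \<phi> q \<in> U' \<and> \<phi> q \<in> V'"
    and phi_smooth: "smooth_on V \<phi>" and phi'_smooth: "smooth_on V' \<phi>'"
    and dphi'_dphi: "q \<in> V \<Longrightarrow> dd \<phi>' (\<phi> q) (dd \<phi> q v) = v"
    and dphi_dphi': "q \<in> V \<Longrightarrow> dd \<phi> q (dd \<phi>' (\<phi> q) v) = v"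
    and g_phi: "q \<in> V \<Longrightarrow> g q u v = g' (\<phi> q) (dd \<phi> q u) (dd \<phi> q v)"
begin

lemma phi_differentiable: "q \<in> V \<Longrightarrow> \<phi> differentiable (at q)"
  by (rule smooth_on_differentiable[OF phi_smooth])

lemma dphi_linear: "q \<in> V \<Longrightarrow> linear (dd \<phi> q)"
  by (rule linear_frechet_derivative[OF phi_differentiable])

lemma dphi_differentiable: "q \<in> V \<Longrightarrow> (\<lambda>y. dd \<phi> y v) differentiable (at q)"
  by (rule smooth_on_differentiable[OF smooth_on_dd[OF phi_smooth]])

text \<open>The differential of \<phi> is a moving frame for g, with the metric and the Christoffel
  symbols of g' pulled back; absence of torsion is the symmetry of second derivatives. The classical
  transformation law is then \<open>christoffel_eq\<close>.\<close>

lemma phi_christoffel: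
  assumes q: "q \<in> V"
  shows "dd \<phi> q (christoffel g q u v)
    = dd (\<lambda>y. dd \<phi> y v) q u + christoffel g' (\<phi> q) (dd \<phi> q u) (dd \<phi> q v)"
proof -
  interpret F: moving_frame V "\<lambda>q. dd \<phi> q" "\<lambda>q. dd \<phi>' (\<phi> q)" "\<lambda>q. g' (\<phi> q)"
    "\<lambda>q u b. christoffel g' (\<phi> q) (dd \<phi> q u) b" g
  proof (rule moving_frame.intro)
    fix q u v a b assume q: "q \<in> V"
    have U': "\<phi> q \<in> U'" using phi_V[OF q] by simp
    show "linear (dd \<phi> q)" by (rule dphi_linear[OF q])
    show "dd \<phi> q (dd \<phi>' (\<phi> q) b) = b" by (rule dphi_dphi'[OF q])
    show "dd \<phi>' (\<phi> q) (dd \<phi> q v) = v" by (rule dphi'_dphi[OF q])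
    show "(\<lambda>y. dd \<phi> y v) differentiable at q" by (rule dphi_differentiable[OF q])
    show "bilinear (g' (\<phi> q))" by (rule Y.bil_g[OF U'])
    show "g' (\<phi> q) a b = g' (\<phi> q) b a" by (rule Y.g_sym[OF U'])
    show "a \<noteq> 0 \<Longrightarrow> g' (\<phi> q) a a > 0" by (rule Y.g_pos[OF U'])
    show "(\<lambda>y. g' (\<phi> y) a b) differentiable at q"
      by (rule differentiable_compose[OF Y.g_differentiable[OF U'] phi_differentiable[OF q]])
    note l = linear_add[OF dphi_linear[OF q]] linear_cmul[OF dphi_linear[OF q]]
    note b = Y.bil_christoffel[OF U']
    show "bilinear (\<lambda>u b. christoffel g' (\<phi> q) (dd \<phi> q u) b)"
      unfolding bilinear_def
      by (intro conjI allI linearI)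
        (simp_all add: l bilinear_ladd[OF b] bilinear_radd[OF b] bilinear_lmul[OF b] bilinear_rmul[OF b])
    show "dd (\<lambda>y. g' (\<phi> y) a b) q u = g' (\<phi> q) (christoffel g' (\<phi> q) (dd \<phi> q u) a) b
        + g' (\<phi> q) a (christoffel g' (\<phi> q) (dd \<phi> q u) b)"
      using dd_compose[of "\<lambda>y. g' y a b" \<phi> q u, OF Y.g_differentiable[OF U'] phi_differentiable[OF q]]
      by (simp only: Y.dd_g[OF U'])
    show "dd (\<lambda>y. dd \<phi> y v) q u + christoffel g' (\<phi> q) (dd \<phi> q u) (dd \<phi> q v)
        = dd (\<lambda>y. dd \<phi> y u) q v + christoffel g' (\<phi> q) (dd \<phi> q v) (dd \<phi> q u)"
      using dd_commute[OF open_V q phi_smooth, of v u] Y.christoffel_sym[OF U', of "dd \<phi> q u"] by simp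
    show "g q u v = g' (\<phi> q) (dd \<phi> q u) (dd \<phi> q v)" by (rule g_phi[OF q])
  qed (rule open_V)
  show ?thesis
    using F.psi_nab[OF q, of u v] F.christoffel_eq[OF q, of u v] by simp
qed

text \<open>The induced map of covectors: its second component is p composed with the differential
  of the inverse change of charts.\<close>

definition Phi where
  "Phi z = (\<phi> (fst z), \<chi> i. snd z \<bullet> dd \<phi>' (\<phi> (fst z)) (axis i 1))"

abbreviation VV :: "((real^'n) \<times> (real^'n)) set" where "VV \<equiv> V \<times> UNIV"

lemma open_VV: "open VV"
  by (simp add: open_Times open_V)

lemma VV_W: "z \<in> VV \<Longrightarrow> z \<in> X.W" "z \<in> VV \<Longrightarrow> fst z \<in> V" "z \<in> VV \<Longrightarrow> Phi z \<in> Y.W"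
  using V_U phi_V by (auto simp: Phi_def)

lemma fst_Phi: "fst (Phi z) = \<phi> (fst z)"
  by (simp add: Phi_def)

lemma phi_fst: "z \<in> VV \<Longrightarrow> (\<lambda>z. \<phi> (fst z)) differentiable (at z)"
  by (rule smooth_on_differentiable[OF smooth_on_compose_fst[OF open_V phi_smooth]])

lemma Phi_differentiable:
  assumes z: "z \<in> VV"
  shows "Phi differentiable (at z)"
proof -
  have V': "\<phi> (fst z) \<in> V'" using phi_V VV_W[OF z] by blast
  have d: "(\<lambda>z. dd \<phi>' (\<phi> (fst z)) (axis i 1)) differentiable (at z)" for i
    by (rule differentiable_compose[OF smooth_on_differentiable[OF smooth_on_dd[OF phi'_smooth] V'] phi_fst[OF z]])
  have s: "snd differentiable (at z)"
    by (intro bounded_linear_imp_differentiable bounded_linear_snd)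
  have "(\<lambda>z. \<Sum>i\<in>UNIV. (snd z \<bullet> dd \<phi>' (\<phi> (fst z)) (axis i 1)) *\<^sub>R (axis i 1 :: real^'n)) differentiable (at z)"
    using d s
    by (intro differentiable_sum ballI finite differentiable_bounded_bilinear[OF bounded_bilinear_scaleR]
        differentiable_bounded_bilinear[OF bounded_bilinear_inner] differentiable_const)
  moreover have "(\<Sum>i\<in>UNIV. (snd z \<bullet> dd \<phi>' (\<phi> (fst z)) (axis i 1)) *\<^sub>R (axis i 1 :: real^'n))
      = (\<chi> i. snd z \<bullet> dd \<phi>' (\<phi> (fst z)) (axis i 1))" for z
    using axis_expansion[of "\<chi> i. snd z \<bullet> dd \<phi>' (\<phi> (fst z)) (axis i 1)"] by simp
  ultimately have "(\<lambda>z. \<chi> i. snd z \<bullet> dd \<phi>' (\<phi> (fst z)) (axis i 1)) differentiable (at z)" by simp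
  from has_derivative_Pair[OF differentiable_has_dd[OF phi_fst[OF z]] differentiable_has_dd[OF this]]
  show ?thesis
    unfolding Phi_def[abs_def] by (rule differentiableI)
qed

lemma fst_dd_Phi:
  assumes z: "z \<in> VV"
  shows "fst (dd Phi z u) = dd \<phi> (fst z) (fst u)"
proof -
  have "fst (dd Phi z u) = dd (\<lambda>z. fst (Phi z)) z u"
    by (rule dd_bounded_linear[OF bounded_linear_fst Phi_differentiable[OF z], symmetric])
  also have "\<dots> = dd \<phi> (fst z) (fst u)"
    unfolding fst_Phi by (rule X.dd_compose_fst[OF phi_differentiable[OF VV_W(2)[OF z]]])
  finally show ?thesis .
qed

lemma snd_Phi:
  assumes z: "z \<in> VV"
  shows "snd (Phi z) \<bullet> dd \<phi> (fst z) w = snd z \<bullet> w"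
proof -
  have V': "\<phi> (fst z) \<in> V'" using phi_V VV_W[OF z] by blast
  have l: "linear (dd \<phi>' (\<phi> (fst z)))"
    by (rule linear_frechet_derivative[OF smooth_on_differentiable[OF phi'_smooth V']])
  have "snd (Phi z) \<bullet> y = snd z \<bullet> dd \<phi>' (\<phi> (fst z)) y" for y
  proof (rule linear_eq_axis[of "\<lambda>y. snd (Phi z) \<bullet> y"])
    show "linear (\<lambda>y. snd (Phi z) \<bullet> y)" by (simp add: linear_iff inner_add_right)
    show "linear (\<lambda>y. snd z \<bullet> dd \<phi>' (\<phi> (fst z)) y)"
      by (simp add: linear_iff inner_add_right linear_add[OF l] linear_cmul[OF l])
    show "snd (Phi z) \<bullet> axis i 1 = snd z \<bullet> dd \<phi>' (\<phi> (fst z)) (axis i 1)" for i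
      by (simp add: Phi_def inner_axis)
  qed
  then show ?thesis by (simp add: dphi'_dphi[OF VV_W(2)[OF z]])
qed

lemma ps_Phi:
  assumes z: "z \<in> VV"
  shows "Y.ps (Phi z) = dd \<phi> (fst z) (X.ps z)"
proof -
  have q: "fst z \<in> V" by (rule VV_W(2)[OF z])
  have U': "\<phi> (fst z) \<in> U'" using phi_V[OF q] by simp
  have "g' (\<phi> (fst z)) (dd \<phi> (fst z) (X.ps z)) y = snd (Phi z) \<bullet> y" for y
  proof -
    have "g' (\<phi> (fst z)) (dd \<phi> (fst z) (X.ps z)) (dd \<phi> (fst z) w) = snd (Phi z) \<bullet> dd \<phi> (fst z) w" for w
      using g_phi[OF q, of "X.ps z" w] X.g_ps[OF VV_W(1)[OF z], of w] snd_Phi[OF z, of w] by simp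
    from this[of "dd \<phi>' (\<phi> (fst z)) y"] show ?thesis by (simp add: dphi_dphi'[OF q])
  qed
  from Y.sharp_eqI[OF U' this] show ?thesis by (simp add: Y.ps_def fst_Phi)
qed

lemma en_Phi: "z \<in> VV \<Longrightarrow> Y.en (Phi z) = X.en z"
  by (simp add: Y.en_def X.en_def ps_Phi fst_Phi g_phi[OF VV_W(2)])

text \<open>The raised vertical part transforms like a vector of the base: in the derivative of
  \<open>ps_Phi\<close> the second derivatives of \<phi> are compensated by the inhomogeneous term
  in \<open>phi_christoffel\<close>.\<close>

lemma Dv_ps_Phi:
  assumes z: "z \<in> VV"
  shows "Y.Dv Y.ps (Phi z) (dd Phi z u) = dd \<phi> (fst z) (X.Dv X.ps z u)"
proof -
  have q: "fst z \<in> V" by (rule VV_W(2)[OF z])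
  have pd: "X.ps differentiable (at z)" by (rule smooth_on_differentiable[OF X.ps_smooth VV_W(1)[OF z]])
  have pd': "Y.ps differentiable (at (Phi z))" by (rule smooth_on_differentiable[OF Y.ps_smooth VV_W(3)[OF z]])
  have dl: "linear (dd \<phi> (fst y))" if "y \<in> VV" for y by (rule dphi_linear[OF VV_W(2)[OF that]])
  have dT: "(\<lambda>y. dd \<phi> (fst y) b) differentiable (at z)" for b
    by (rule smooth_on_differentiable[OF smooth_on_compose_fst[OF open_V smooth_on_dd[OF phi_smooth]] z])
  have "dd Y.ps (Phi z) (dd Phi z u) = dd (\<lambda>y. Y.ps (Phi y)) z u"
    by (rule dd_compose[OF pd' Phi_differentiable[OF z], symmetric])
  also have "\<dots> = dd (\<lambda>y. dd \<phi> (fst y) (X.ps y)) z u"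
    by (rule dd_cong_open[OF open_VV z ps_Phi])
  also have "\<dots> = dd (\<lambda>y. dd \<phi> (fst y) (X.ps z)) z u + dd \<phi> (fst z) (dd X.ps z u)"
    by (rule dd_linear_app[OF open_VV z dl dT pd])
  also have "dd (\<lambda>y. dd \<phi> (fst y) (X.ps z)) z u = dd (\<lambda>y. dd \<phi> y (X.ps z)) (fst z) (fst u)"
    by (rule X.dd_compose_fst[OF dphi_differentiable[OF q]])
  also have "\<dots> = dd \<phi> (fst z) (christoffel g (fst z) (fst u) (X.ps z))
      - christoffel g' (\<phi> (fst z)) (dd \<phi> (fst z) (fst u)) (dd \<phi> (fst z) (X.ps z))"
    using phi_christoffel[OF q, of "fst u" "X.ps z"] by simp
  finally show ?thesis
    by (simp add: Y.Dv_def X.Dv_def fst_Phi fst_dd_Phi[OF z] ps_Phi[OF z] linear_add[OF dphi_linear[OF q]])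
qed

end

section \<open>The atlas of the cotangent bundle\<close>

locale atlas =
  fixes M :: "'m set" and A :: "('m, real^'n) chart set"
  assumes atlas: "smooth_atlas M A"
begin

lemma chart_inj: "C \<in> A \<Longrightarrow> inj_on (snd C) (fst C)"
  using atlas by (auto simp: smooth_atlas_def)

lemma open_chart_image: "C \<in> A \<Longrightarrow> open (chart_image C)"
  using atlas by (auto simp: smooth_atlas_def)

lemma open_overlap: "C \<in> A \<Longrightarrow> C' \<in> A \<Longrightarrow> open (overlap C C')"
  using atlas by (auto simp: smooth_atlas_def)

lemma transition_smooth: "C \<in> A \<Longrightarrow> C' \<in> A \<Longrightarrow> smooth_on (overlap C C') (transition C C')"
  using atlas by (auto simp: smooth_atlas_def)

lemma transition_eq: "C \<in> A \<Longrightarrow> x \<in> fst C \<Longrightarrow> transition C C' (snd C x) = snd C' x"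
  by (simp add: transition_def inv_into_f_f[OF chart_inj])

lemma overlap_I: "x \<in> fst C \<Longrightarrow> x \<in> fst C' \<Longrightarrow> snd C x \<in> overlap C C'"
  by (auto simp: overlap_def)

lemma transition_overlap:
  "C \<in> A \<Longrightarrow> q \<in> overlap C C' \<Longrightarrow> transition C C' q \<in> overlap C' C"
  by (auto simp: overlap_def transition_eq)

lemma transition_differentiable:
  "C \<in> A \<Longrightarrow> C' \<in> A \<Longrightarrow> q \<in> overlap C C' \<Longrightarrow> transition C C' differentiable (at q)"
  by (rule smooth_on_differentiable[OF transition_smooth])

lemma linear_transition_deriv:
  "C \<in> A \<Longrightarrow> C' \<in> A \<Longrightarrow> q \<in> overlap C C' \<Longrightarrow> linear (transition_deriv C C' q)"
  by (rule linear_frechet_derivative[OF transition_differentiable])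

lemma transition_deriv_self:
  assumes C: "C \<in> A" and q: "q \<in> chart_image C"
  shows "transition_deriv C C q v = v"
proof -
  have "transition_deriv C C q v = dd (\<lambda>y. y) q v"
    by (rule dd_cong_open[OF open_chart_image[OF C] q]) (auto simp: chart_image_def transition_eq[OF C])
  then show ?thesis by simp
qed

lemma transition_deriv_chain:
  assumes C: "C \<in> A" "C' \<in> A" "C'' \<in> A" and x: "x \<in> fst C" "x \<in> fst C'" "x \<in> fst C''"
  shows "transition_deriv C' C'' (snd C' x) (transition_deriv C C' (snd C x) v) = transition_deriv C C'' (snd C x) v"
proof -
  have op: "open (overlap C C' \<inter> overlap C C'')" by (intro open_Int open_overlap C)
  have q: "snd C x \<in> overlap C C' \<inter> overlap C C''" using x by (simp add: overlap_I)
  have e: "transition C C'' y = transition C' C'' (transition C C' y)"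
    if y: "y \<in> overlap C C' \<inter> overlap C C''" for y
  proof -
    obtain a where a: "y = snd C a" "a \<in> fst C" "a \<in> fst C'" using y by (auto simp: overlap_def)
    then show ?thesis by (simp add: transition_eq C)
  qed
  have d: "transition C' C'' differentiable (at (transition C C' (snd C x)))"
    using transition_differentiable[OF C(2,3)] x by (simp add: transition_eq[OF C(1)] overlap_I)
  have "transition_deriv C C'' (snd C x) v = dd (\<lambda>y. transition C' C'' (transition C C' y)) (snd C x) v"
    by (rule dd_cong_open[OF op q e])
  also have "\<dots> = transition_deriv C' C'' (snd C' x) (transition_deriv C C' (snd C x) v)"
    using dd_compose[OF d transition_differentiable[OF C(1,2)], of v] q
    by (simp add: transition_eq[OF C(1)] x)
  finally show ?thesis ..
qed

text \<open>The components in all other charts are forced by the transformation law and are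
  consistent by the chain rule. Hence an induced chart fills the whole product of the base chart
  image with the fibre.\<close>

lemma covector_extend:
  assumes C: "C \<in> A" and x: "x \<in> fst C"
  obtains \<omega> where "(x, \<omega>) \<in> cotangent_bundle A" "\<omega> C = p"
proof -
  define \<omega> where "\<omega> = (\<lambda>C'. if C' \<in> A \<and> x \<in> fst C' then
      (\<chi> i. p \<bullet> transition_deriv C' C (snd C' x) (axis i 1)) else 0)"
  have w: "\<omega> C' \<bullet> u = p \<bullet> transition_deriv C' C (snd C' x) u" if "C' \<in> A" "x \<in> fst C'" for C' u
  proof (rule linear_eq_axis[of "\<lambda>u. \<omega> C' \<bullet> u"])
    have l: "linear (transition_deriv C' C (snd C' x))"
      by (rule linear_transition_deriv[OF that(1) C overlap_I[OF that(2) x]])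
    show "linear (\<lambda>u. \<omega> C' \<bullet> u)" by (simp add: linear_iff inner_add_right)
    show "linear (\<lambda>u. p \<bullet> transition_deriv C' C (snd C' x) u)"
      by (simp add: linear_iff inner_add_right linear_add[OF l] linear_cmul[OF l])
    show "\<omega> C' \<bullet> axis i 1 = p \<bullet> transition_deriv C' C (snd C' x) (axis i 1)" for i
      using that by (simp add: \<omega>_def inner_axis)
  qed
  show thesis
  proof (rule that)
    show "(x, \<omega>) \<in> cotangent_bundle A"
      unfolding cotangent_bundle_def mem_Collect_eq prod.case
    proof (intro conjI ballI impI allI)
      show "x \<in> (\<Union>C\<in>A. fst C)" using C x by blast
      fix C' C'' u assume c: "C' \<in> A" "C'' \<in> A" "x \<in> fst C' \<inter> fst C''"
      then have "x \<in> fst C'" "x \<in> fst C''" by auto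
      then show "\<omega> C' \<bullet> u = \<omega> C'' \<bullet> transition_deriv C' C'' (snd C' x) u"
        using w[OF c(1), of u] w[OF c(2), of "transition_deriv C' C'' (snd C' x) u"]
          transition_deriv_chain[OF c(1,2) C, of x u] x by simp
    next
      show "\<omega> C' = 0" if "\<not> (C' \<in> A \<and> x \<in> fst C')" for C'
        using that by (simp only: \<omega>_def if_False)
    qed
    have "\<omega> C \<bullet> u = p \<bullet> u" for u
      using x by (simp add: w[OF C x] transition_deriv_self[OF C] chart_image_def)
    then show "\<omega> C = p" by (metis vector_eq_rdot)
  qed
qed

lemma cotangent_bundle_D:
  assumes "(x, \<omega>) \<in> cotangent_bundle A" "C \<in> A" "C' \<in> A" "x \<in> fst C" "x \<in> fst C'"
  shows "\<omega> C \<bullet> u = \<omega> C' \<bullet> transition_deriv C C' (snd C x) u"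
  using assms unfolding cotangent_bundle_def mem_Collect_eq prod.case by blast

lemma fst_cotangent_chart: "(x, \<omega>) \<in> fst (cotangent_chart A C) \<longleftrightarrow> (x, \<omega>) \<in> cotangent_bundle A \<and> x \<in> fst C"
  by (simp add: cotangent_chart_def)

lemma snd_cotangent_chart: "snd (cotangent_chart A C) (x, \<omega>) = (snd C x, \<omega> C)"
  by (simp add: cotangent_chart_def)

text \<open>Components in one chart determine those in all charts around the point, and the
  remaining entries of a covector are 0 by convention.\<close>

lemma cotangent_chart_inj:
  assumes C: "C \<in> A"
  shows "inj_on (snd (cotangent_chart A C)) (fst (cotangent_chart A C))"
proof (rule inj_onI, clarify)
  fix x \<omega> x' \<omega>'
  assume 1: "(x, \<omega>) \<in> fst (cotangent_chart A C)" and 2: "(x', \<omega>') \<in> fst (cotangent_chart A C)"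
    and e: "snd (cotangent_chart A C) (x, \<omega>) = snd (cotangent_chart A C) (x', \<omega>')"
  have x: "x' = x" and w: "\<omega>' C = \<omega> C"
    using inj_onD[OF chart_inj[OF C]] 1 2 e by (auto simp: fst_cotangent_chart snd_cotangent_chart)
  have xC: "x \<in> fst C" and b: "(x, \<omega>) \<in> cotangent_bundle A" "(x, \<omega>') \<in> cotangent_bundle A"
    using 1 2 x by (auto simp: fst_cotangent_chart)
  have "\<omega> C' = \<omega>' C'" for C'
  proof (cases "C' \<in> A \<and> x \<in> fst C'")
    case True
    then have "\<omega> C' \<bullet> u = \<omega>' C' \<bullet> u" for u
      using cotangent_bundle_D[OF b(1) _ C _ xC] cotangent_bundle_D[OF b(2) _ C _ xC] w by metis
    then show ?thesis by (metis vector_eq_rdot)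
  next
    case False
    then have "\<omega> C' = 0" "\<omega>' C' = 0" using b unfolding cotangent_bundle_def mem_Collect_eq prod.case by blast+
    then show ?thesis by simp
  qed
  then show "x = x' \<and> \<omega> = \<omega>'" using x by auto
qed

lemma cotangent_image_Int:
  assumes C: "C \<in> A"
  shows "snd (cotangent_chart A C) ` (fst (cotangent_chart A C) \<inter> {(x, \<omega>). x \<in> X})
    = (snd C ` (fst C \<inter> X)) \<times> UNIV"
proof (intro equalityI subsetI)
  fix z assume "z \<in> snd (cotangent_chart A C) ` (fst (cotangent_chart A C) \<inter> {(x, \<omega>). x \<in> X})"
  then show "z \<in> (snd C ` (fst C \<inter> X)) \<times> UNIV"
    by (auto simp: fst_cotangent_chart snd_cotangent_chart)
next
  fix z :: "(real^'n) \<times> (real^'n)" assume "z \<in> (snd C ` (fst C \<inter> X)) \<times> UNIV"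
  then obtain x p where x: "x \<in> fst C" "x \<in> X" and z: "z = (snd C x, p)" by (cases z) auto
  obtain \<omega> where "(x, \<omega>) \<in> cotangent_bundle A" "\<omega> C = p" by (rule covector_extend[OF C x(1)])
  then show "z \<in> snd (cotangent_chart A C) ` (fst (cotangent_chart A C) \<inter> {(x, \<omega>). x \<in> X})"
    using x z by (intro image_eqI[of _ _ "(x, \<omega>)"]) (auto simp: fst_cotangent_chart snd_cotangent_chart)
qed

lemma cotangent_chart_image:
  assumes C: "C \<in> A"
  shows "chart_image (cotangent_chart A C) = chart_image C \<times> UNIV"
  using cotangent_image_Int[OF C, of UNIV] by (simp add: chart_image_def)

lemma cotangent_overlap:
  assumes C: "C \<in> A"
  shows "overlap (cotangent_chart A C) (cotangent_chart A C') = overlap C C' \<times> UNIV"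
proof -
  have "fst (cotangent_chart A C) \<inter> fst (cotangent_chart A C')
      = fst (cotangent_chart A C) \<inter> {(x, \<omega>). x \<in> fst C'}"
    by (auto simp: fst_cotangent_chart)
  then show ?thesis
    using cotangent_image_Int[OF C, of "fst C'"] by (simp add: overlap_def)
qed

lemma cotangent_transition:
  assumes C: "C \<in> A" "C' \<in> A" and z: "z \<in> overlap C C' \<times> UNIV"
  shows "transition (cotangent_chart A C) (cotangent_chart A C') z
    = (transition C C' (fst z), \<chi> i. snd z \<bullet> transition_deriv C' C (transition C C' (fst z)) (axis i 1))"
proof -
  obtain x \<omega> where m: "(x, \<omega>) \<in> fst (cotangent_chart A C)" "(x, \<omega>) \<in> fst (cotangent_chart A C')"
    and ze: "z = snd (cotangent_chart A C) (x, \<omega>)"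
  proof -
    have "z \<in> overlap (cotangent_chart A C) (cotangent_chart A C')"
      using z by (simp only: cotangent_overlap[OF C(1)])
    then show ?thesis using that unfolding overlap_def by auto
  qed
  have x: "x \<in> fst C" "x \<in> fst C'" and b: "(x, \<omega>) \<in> cotangent_bundle A" using m by (auto simp: fst_cotangent_chart)
  have "transition (cotangent_chart A C) (cotangent_chart A C') z = (snd C' x, \<omega> C')"
    unfolding ze transition_def comp_apply inv_into_f_f[OF cotangent_chart_inj[OF C(1)] m(1)]
    by (rule snd_cotangent_chart)
  moreover have "\<omega> C' = (\<chi> i. \<omega> C \<bullet> transition_deriv C' C (snd C' x) (axis i 1))"
  proof (unfold vec_eq_iff, intro allI)
    fix i
    show "\<omega> C' $ i = (\<chi> i. \<omega> C \<bullet> transition_deriv C' C (snd C' x) (axis i 1)) $ i"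
      using cotangent_bundle_D[OF b C(2,1) x(2,1), of "axis i 1"] by (simp add: inner_axis)
  qed
  ultimately show ?thesis
    by (simp add: ze snd_cotangent_chart transition_eq[OF C(1) x(1)])
qed

end

section \<open>The structures on the whole cotangent bundle\<close>

context natural_chart
begin

lemma G_smooth: "smooth_on W (\<lambda>z. G z u v)"
proof -
  have "smooth_on W (\<lambda>z. mm k z (psi z u) (psi z v))"
    by (rule smooth_on_bilinear_app[OF open_W mm_bilinear mm_smooth psi_smooth psi_smooth])
  then show ?thesis by (simp only: smooth_on_cong[OF open_W G_mm])
qed

lemma kaehler_chart:
  assumes z: "z \<in> W"
  shows "bilinear (G z)" "G z u v = G z v u" "u \<noteq> 0 \<Longrightarrow> G z u u > 0"
    "linear (J z)" "J z (J z u) = - u" "nijenhuis J z u v = 0" "G z (J z u) (J z v) = G z u v"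
    "dd (\<lambda>y. G y v (J y w)) z u + dd (\<lambda>y. G y w (J y u)) z v + dd (\<lambda>y. G y u (J y v)) z w = 0"
  by (rule T.bilinear_G[OF z] T.G_sym[OF z] T.G_pos[OF z] T.lin_J[OF z] T.J_J[OF z] T.nijenhuis_zero[OF z]
      T.G_J[OF z] T.fundamental_form_closed[OF z]; assumption)+

end

lemma constant_curvature_chartI:
  assumes "smooth_atlas M A" "riemannian_metric A g" "constant_sectional_curvature A g c" "C \<in> A"
  shows "constant_curvature_chart (chart_image C) (g C) c"
proof (intro constant_curvature_chart.intro metric_chart.intro constant_curvature_chart_axioms.intro)
  show "open (chart_image C)" using assms(1,4) by (auto simp: smooth_atlas_def)
  show "smooth_on (chart_image C) (\<lambda>q. g C q u v)" for u v
    using assms(2,4) unfolding riemannian_metric_def by blast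
  fix q u v assume q: "q \<in> chart_image C"
  show "bilinear (g C q)" "g C q u v = g C q v u" "u \<noteq> 0 \<Longrightarrow> g C q u u > 0"
    using assms(2,4) q unfolding riemannian_metric_def by blast+
  show "u \<noteq> v \<Longrightarrow> independent {u, v} \<Longrightarrow> sectional_curvature (g C) q u v = c"
    using assms(3,4) q unfolding constant_sectional_curvature_def by blast
qed

lemma natural_chartI:
  assumes C: "C \<in> A" and atl: "smooth_atlas M A"
    and cc: "constant_curvature_chart (chart_image C) (g C) c"
    and nf: "natural_functions c k a1 b1 lam mu"
    and nat: "natural_diagonal_structure A g a1 b1 lam mu G J"
  shows "natural_chart (chart_image C) (g C) c k a1 b1 lam mu
    (G (cotangent_chart A C)) (J (cotangent_chart A C))"
proof (rule natural_chart.intro[OF cc nf], rule natural_chart_axioms.intro)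
  interpret constant_curvature_chart "chart_image C" "g C" c by (rule cc)
  interpret atlas M A by unfold_locales (rule atl)
  let ?K = "cotangent_chart A C"
  fix z t a2 b2 u v
  assume z: "z \<in> chart_image C \<times> UNIV" and t: "t = en z" and a2: "a2 = 1 / a1 t"
    and b2: "b2 = - b1 t / (a1 t * (a1 t + 2 * t * b1 t))"
  obtain q p where zqp: "z = (q, p)" by (cases z)
  have q: "q \<in> chart_image C" using z zqp by simp
  have zK: "(q, p) \<in> chart_image ?K" using z zqp cotangent_chart_image[OF C] by simp
  have te: "energy (g C) q p = t" using energy_eq[OF q, of p] t zqp by simp
  note N = bspec[OF bspec[OF nat[unfolded natural_diagonal_structure_def] C] zK,
      unfolded prod.case Let_def te, folded a2, folded b2]
  show "G ?K z u v = lam t * a1 t * g C (fst z) (fst u) (fst v)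
      + (lam t * b1 t + mu t * (a1 t + 2 * t * b1 t)) * g C (fst z) (ps z) (fst u) * g C (fst z) (ps z) (fst v)
      + (lam t * a2 * g C (fst z) (Dv ps z u) (Dv ps z v)
      + (lam t * b2 + mu t * (a2 + 2 * t * b2)) * g C (fst z) (ps z) (Dv ps z u) * g C (fst z) (ps z) (Dv ps z v))"
    unfolding zqp fst_conv
    by (rule natural_G_vector[OF q]) (use N in \<open>simp_all only: simp_thms\<close>)
  show "J ?K z v = mk z (- (a2 *\<^sub>R Dv ps z v) - (b2 * g C (fst z) (ps z) (Dv ps z v)) *\<^sub>R ps z)
        (a1 t *\<^sub>R fst v + (b1 t * g C (fst z) (ps z) (fst v)) *\<^sub>R ps z)"
    unfolding zqp fst_conv
    by (rule natural_J_vector[OF q]) (use N in \<open>simp_all only: simp_thms\<close>)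
qed

lemma chart_changeI:
  assumes atl: "smooth_atlas M A" and met: "riemannian_metric A g"
    and cc: "\<And>C. C \<in> A \<Longrightarrow> constant_curvature_chart (chart_image C) (g C) c"
    and C: "C \<in> A" "C' \<in> A"
  shows "chart_change (chart_image C) (g C) (chart_image C') (g C') (overlap C C') (overlap C' C)
    (transition C C') (transition C' C)"
proof -
  interpret atlas M A by unfold_locales (rule atl)
  interpret X: constant_curvature_chart "chart_image C" "g C" c by (rule cc[OF C(1)])
  interpret Y: constant_curvature_chart "chart_image C'" "g C'" c by (rule cc[OF C(2)])
  have inv: "transition_deriv D' D (transition D D' q) (transition_deriv D D' q v) = v"
    if D: "D \<in> A" "D' \<in> A" and q: "q \<in> overlap D D'" for D D' q v
  proof -
    obtain x where x: "x \<in> fst D" "x \<in> fst D'" and qx: "q = snd D x" using q by (auto simp: overlap_def)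
    have "transition_deriv D' D (snd D' x) (transition_deriv D D' (snd D x) v) = v"
      using transition_deriv_chain[OF D D(1) x x(1)] transition_deriv_self[OF D(1), of "snd D x" v] x
      by (simp add: chart_image_def)
    then show ?thesis by (simp only: qx transition_eq[OF D(1) x(1)])
  qed
  show ?thesis
  proof (intro chart_change.intro chart_change_axioms.intro X.metric_chart_axioms Y.metric_chart_axioms)
    show "open (overlap C C')" "open (overlap C' C)" by (intro open_overlap C)+
    show "overlap C C' \<subseteq> chart_image C" by (auto simp: overlap_def chart_image_def)
    show "smooth_on (overlap C C') (transition C C')" "smooth_on (overlap C' C) (transition C' C)"
      by (intro transition_smooth C)+
    fix q u v assume q: "q \<in> overlap C C'"
    have q': "transition C C' q \<in> overlap C' C" by (rule transition_overlap[OF C(1) q])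
    then show "transition C C' q \<in> chart_image C' \<and> transition C C' q \<in> overlap C' C"
      by (auto simp: overlap_def chart_image_def)
    show "transition_deriv C' C (transition C C' q) (transition_deriv C C' q v) = v"
      by (rule inv[OF C q])
    have "transition C' C (transition C C' q) = q"
      using q by (auto simp: overlap_def transition_eq C)
    then show "transition_deriv C C' q (transition_deriv C' C (transition C C' q) v) = v"
      using inv[OF C(2,1) q', of v] by simp
    show "g C q u v = g C' (transition C C' q) (transition_deriv C C' q u) (transition_deriv C C' q v)"
      using met C q unfolding riemannian_metric_def by blast
  qed
qed

text \<open>The formulas for G and J involve only the energy, the metric, the raised p, the
  projection and the raised vertical part, and all of these transform by the differential of the
  base transition map. For J the two parts are compared and the vector is recovered by
  \<open>mk_Dv_ps\<close>.\<close>

lemma natural_transform: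
  assumes atl: "smooth_atlas M A" and met: "riemannian_metric A g"
    and cc: "\<And>C. C \<in> A \<Longrightarrow> constant_curvature_chart (chart_image C) (g C) c"
    and nf: "natural_functions c k a1 b1 lam mu"
    and nat: "natural_diagonal_structure A g a1 b1 lam mu G J"
    and C: "C \<in> A" "C' \<in> A"
    and z: "z \<in> overlap (cotangent_chart A C) (cotangent_chart A C')"
  defines "K \<equiv> cotangent_chart A C" and "K' \<equiv> cotangent_chart A C'"
  shows "G K z u v = G K' (transition K K' z) (transition_deriv K K' z u) (transition_deriv K K' z v)"
    and "transition_deriv K K' z (J K z u) = J K' (transition K K' z) (transition_deriv K K' z u)"
proof -
  interpret atlas M A by unfold_locales (rule atl)
  interpret H: chart_change "chart_image C" "g C" "chart_image C'" "g C'" "overlap C C'" "overlap C' C"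
    "transition C C'" "transition C' C"
    by (rule chart_changeI[OF atl met cc C])
  interpret X: natural_chart "chart_image C" "g C" c k a1 b1 lam mu "G K" "J K"
    unfolding K_def by (rule natural_chartI[OF C(1) atl cc[OF C(1)] nf nat])
  interpret Y: natural_chart "chart_image C'" "g C'" c k a1 b1 lam mu "G K'" "J K'"
    unfolding K'_def by (rule natural_chartI[OF C(2) atl cc[OF C(2)] nf nat])
  have zV: "z \<in> overlap C C' \<times> UNIV" using z cotangent_overlap[OF C(1)] by blast
  have tr: "transition K K' y = H.Phi y" if "y \<in> overlap C C' \<times> UNIV" for y
    unfolding K_def K'_def H.Phi_def by (rule cotangent_transition[OF C that])
  have td: "transition_deriv K K' z w = dd H.Phi z w" for w
    by (rule dd_cong_open[OF H.open_VV zV tr])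
  note W = H.VV_W[OF zV]
  let ?T = "transition_deriv C C' (fst z)"
  have f: "fst (H.Phi z) = transition C C' (fst z)" by (rule H.fst_Phi)
  note nat' = f H.en_Phi[OF zV] H.ps_Phi[OF zV] H.fst_dd_Phi[OF zV] H.Dv_ps_Phi[OF zV]
  note gT = H.g_phi[OF W(2), symmetric]
  note T = linear_add[OF H.dphi_linear[OF W(2)]] linear_diff[OF H.dphi_linear[OF W(2)]]
    linear_cmul[OF H.dphi_linear[OF W(2)]] linear_neg[OF H.dphi_linear[OF W(2)]]
  show "G K z u v = G K' (transition K K' z) (transition_deriv K K' z u) (transition_deriv K K' z v)"
    unfolding tr[OF zV] td X.G_natural[OF W(1) refl refl refl] Y.G_natural[OF W(3) refl refl refl]
    by (simp only: nat' gT)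
  have "H.Y.Dv H.Y.ps (H.Phi z) (dd H.Phi z (J K z u)) = H.Y.Dv H.Y.ps (H.Phi z) (J K' (H.Phi z) (dd H.Phi z u))"
    unfolding Y.J_parts[OF W(3)] H.Dv_ps_Phi[OF zV] X.J_parts[OF W(1)]
    by (simp only: nat' gT T)
  moreover have "fst (dd H.Phi z (J K z u)) = fst (J K' (H.Phi z) (dd H.Phi z u))"
    unfolding Y.J_parts[OF W(3)] H.fst_dd_Phi[OF zV] X.J_parts[OF W(1)] X.b2_def Y.b2_def
    by (simp only: nat' gT T)
  ultimately show "transition_deriv K K' z (J K z u) = J K' (transition K K' z) (transition_deriv K K' z u)"
    unfolding tr[OF zV] td using H.Y.mk_Dv_ps[OF W(3)] by metis
qed

text \<open>The cases left out of the last claim do occur. For c = 0 the curvature form vanishes, so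
  G is flat and \<kappa> = 0; for n = 1 the bundle is a surface of constant Gauss curvature
  c/k.\<close>

theorem theorem10:
  fixes M :: "'m set"
    and A :: "('m, real^'n) chart set"
    and g :: "('m, real^'n) chart \<Rightarrow> real^'n \<Rightarrow> real^'n \<Rightarrow> real^'n \<Rightarrow> real"
    and c k :: real
    and a1 b1 lam mu :: "real \<Rightarrow> real"
    and G :: "(('m, 'n) cotangent, (real^'n) \<times> (real^'n)) chart \<Rightarrow>
                (real^'n) \<times> (real^'n) \<Rightarrow> (real^'n) \<times> (real^'n) \<Rightarrow> (real^'n) \<times> (real^'n) \<Rightarrow> real"
    and J :: "(('m, 'n) cotangent, (real^'n) \<times> (real^'n)) chart \<Rightarrow>
                (real^'n) \<times> (real^'n) \<Rightarrow> (real^'n) \<times> (real^'n) \<Rightarrow> (real^'n) \<times> (real^'n)"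
  assumes "smooth_manifold M A"
    and "riemannian_metric A g"
    and "constant_sectional_curvature A g c"
    and "smooth_halfline a1"
    and "\<And>t. t \<ge> 0 \<Longrightarrow> a1 t - 2 * t * halfline_deriv a1 t \<noteq> 0"
    and "\<And>t. t \<ge> 0 \<Longrightarrow> b1 t = (a1 t * halfline_deriv a1 t - c) / (a1 t - 2 * t * halfline_deriv a1 t)"
    and "\<And>t. t \<ge> 0 \<Longrightarrow> lam t = k / a1 t"
    and "\<And>t. t \<ge> 0 \<Longrightarrow> mu t = halfline_deriv lam t"
    and "\<And>t. t \<ge> 0 \<Longrightarrow> a1 t > 0"
    and "\<And>t. t \<ge> 0 \<Longrightarrow> a1 t + 2 * t * b1 t > 0"
    and "\<And>t. t \<ge> 0 \<Longrightarrow> lam t > 0"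
    and "\<And>t. t \<ge> 0 \<Longrightarrow> lam t + 2 * t * halfline_deriv lam t > 0"
    and "natural_diagonal_structure A g a1 b1 lam mu G J"
  shows "kaehler (cotangent_atlas A) G J \<and> einstein (cotangent_atlas A) G \<and>
         (CARD('n) \<ge> 2 \<longrightarrow> (\<forall>\<kappa>. c \<noteq> 0 \<or> \<kappa> \<noteq> 0 \<longrightarrow>
            \<not> constant_holomorphic_sectional_curvature (cotangent_atlas A) G J \<kappa>))"
proof (intro conjI impI allI notI)
  have atl: "smooth_atlas M A" and M: "M \<noteq> {}" using assms(1) by (auto simp: smooth_manifold_def)
  interpret atlas M A by unfold_locales (rule atl)
  have cc: "constant_curvature_chart (chart_image C) (g C) c" if "C \<in> A" for C
    by (rule constant_curvature_chartI[OF atl assms(2,3) that])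
  have nf: "natural_functions c k a1 b1 lam mu"
    by (rule natural_functions.intro) (fact assms)+
  have nc: "natural_chart (chart_image C) (g C) c k a1 b1 lam mu
      (G (cotangent_chart A C)) (J (cotangent_chart A C))" if "C \<in> A" for C
    by (rule natural_chartI[OF that atl cc[OF that] nf assms(13)])
  note tf = natural_transform[OF atl assms(2) cc nf assms(13)]
  show "kaehler (cotangent_atlas A) G J"
    unfolding kaehler_def riemannian_metric_def almost_complex_structure_def integrable_structure_def
      cotangent_atlas_def ball_simps Let_def
  proof (intro conjI ballI allI impI)
    fix C assume C: "C \<in> A"
    interpret X: natural_chart "chart_image C" "g C" c k a1 b1 lam mu
      "G (cotangent_chart A C)" "J (cotangent_chart A C)" by (rule nc[OF C])
    let ?G = "G (cotangent_chart A C)" and ?J = "J (cotangent_chart A C)"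
    show "smooth_on (chart_image (cotangent_chart A C)) (\<lambda>z. ?G z u v)" for u v
      using X.G_smooth by (simp only: cotangent_chart_image[OF C])
    show "smooth_on (chart_image (cotangent_chart A C)) (\<lambda>z. ?J z u)" for u
      using X.T.J_smooth by (simp only: cotangent_chart_image[OF C])
    fix z u v w assume "z \<in> chart_image (cotangent_chart A C)"
    then have z: "z \<in> chart_image C \<times> UNIV" by (simp only: cotangent_chart_image[OF C])
    note F = X.kaehler_chart[OF z]
    show "bilinear (?G z)" by (rule F(1))
    show "?G z u v = ?G z v u" by (rule F(2))
    show "u \<noteq> 0 \<Longrightarrow> ?G z u u > 0" by (rule F(3))
    show "linear (?J z)" by (rule F(4))
    show "?J z (?J z u) = - u" by (rule F(5))
    show "nijenhuis ?J z u v = 0" by (rule F(6))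
    show "?G z (?J z u) (?J z v) = ?G z u v" by (rule F(7))
    show "dd (\<lambda>y. ?G y v (?J y w)) z u + dd (\<lambda>y. ?G y w (?J y u)) z v
        + dd (\<lambda>y. ?G y u (?J y v)) z w = 0" by (rule F(8))
  qed (rule tf; assumption)+
  show "einstein (cotangent_atlas A) G"
    unfolding einstein_def cotangent_atlas_def ball_simps
  proof (intro exI ballI allI)
    fix C z u v assume C: "C \<in> A" and "z \<in> chart_image (cotangent_chart A C)"
    then have z: "z \<in> chart_image C \<times> UNIV" by (simp only: cotangent_chart_image[OF C])
    interpret X: natural_chart "chart_image C" "g C" c k a1 b1 lam mu
      "G (cotangent_chart A C)" "J (cotangent_chart A C)" by (rule nc[OF C])
    show "ricci (G (cotangent_chart A C)) z u v = (of_nat CARD('n) * c / k) * G (cotangent_chart A C) z u v"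
      by (rule X.ricci_eq[OF z])
  qed
  fix \<kappa> assume card: "CARD('n) \<ge> 2" and nz: "c \<noteq> 0 \<or> \<kappa> \<noteq> 0"
    and H: "constant_holomorphic_sectional_curvature (cotangent_atlas A) G J \<kappa>"
  obtain C x where C: "C \<in> A" and x: "x \<in> fst C" using M atl unfolding smooth_atlas_def by blast
  interpret X: natural_chart "chart_image C" "g C" c k a1 b1 lam mu
    "G (cotangent_chart A C)" "J (cotangent_chart A C)" by (rule nc[OF C])
  \<comment> \<open>A point of the zero section over a point of the nonempty base.\<close>
  have z: "(snd C x, 0) \<in> chart_image C \<times> UNIV" using x by (simp add: chart_image_def)
  then have zK: "(snd C x, 0) \<in> chart_image (cotangent_chart A C)" by (simp only: cotangent_chart_image[OF C])
  have K: "cotangent_chart A C \<in> cotangent_atlas A" using C by (simp add: cotangent_atlas_def)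
  have "c = 0 \<and> \<kappa> = 0"
    by (rule X.constant_holomorphic_imp_flat[OF z card])
      (use H K zK in \<open>unfold constant_holomorphic_sectional_curvature_def, blast\<close>)
  then show False using nz by blast
qed

end
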